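(* Let $t:\mathbb Z^2\to\mathbb C$ be a t-realization, and consider the square lattice with face weights $(a_{i,j})_{(i,j)\in\mathbb Z^2}$ given by $a_{i,j}=t_{i,j}$. Let $T$ denote Miquel dynamics. Then, for all $(i,j)\in\mathbb Z^2$ and $k\ge1$ such that $[i+j+k]_2=1$, $$T^k(t)_{i,j}=Y\bigl(A_k(i,j),t\bigr),$$ where $A_k(i,j)$ is the Aztec diamond of size $k$ centered at the face $(i,j)$ (which carries the weight $t_{i,j}$).
   Context: $\hat{\mathbb C}=\mathbb C\cup\{\infty\}$ is identified with $\mathbb{CP}^1$; $[n]_q\in\{0,\dots,q-1\}$ is the residue of $n$ modulo $q$. A (square grid) circle pattern is a map $p:\mathbb Z^2\to\hat{\mathbb C}$ such that for all $(i,j)$ there is a circle $c_{i,j}$ (Euclidean circle or line) containing $p_{i,j},p_{i+1,j},p_{i+1,j+1},p_{i,j+1}$; $t_{i,j}$ denotes the center of $c_{i,j}$. A t-realization is a map $t:\mathbb Z^2\to\mathbb C$ with $\frac{(t_{i+1,j}-t_{i,j})(t_{i-1,j}-t_{i,j})}{(t_{i,j+1}-t_{i,j})(t_{i,j-1}-t_{i,j})}\in\mathbb R$ for all $(i,j)$. The circle centers of a circle pattern form a t-realization, and a t-realization is the family of circle centers of a circle pattern, which is unique up to the choice of one intersection point. Miquel dynamics. In a circle pattern, each circle $c_{i,j}$ has four neighbours $c_{i\pm1,j},c_{i,j\pm1}$; cyclically consecutive neighbours intersect in eight points in total, four of which lie on $c_{i,j}$; by Miquel's theorem the other four lie on a sixth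 circle. The parity of $c_{i,j}$ is that of $i+j$. Starting from $T^0(c)=c$, for $k\ge1$ the circle pattern $T^k(c)$ is $T^{k-1}(c)$ except that, if $k$ is odd (resp. even), every even (resp. odd) circle is replaced by the sixth circle given by Miquel's theorem. $T^k(t)$ denotes the centers of the circles $T^k(c)$, where $c$ is a circle pattern with centers $t$; it depends only on $t$. Ratio function of oriented dimers. Consider the square lattice whose faces are the unit squares centered at the points of $\mathbb Z^2$, face $(i,j)$ carrying the weight $a_{i,j}$. For $k\ge1$, the Aztec diamond $A_k(i,j)$ is the subgraph formed by the vertices and edges of its internal faces, which are the faces $(i',j')$ with $|i'-i|+|j'-j|<k$; its open faces are the $(i',j')$ with $|i'-i|+|j'-j|=k$; $F$ is the set of all internal and open faces. The graph is bipartite. A Kasteleyn orientation is a skew-symmetric function $\varphi$ from directed edges to $\{-1,1\}$ such that for every internal face $f$, $\prod_{wb\in\partial f}\varphi_{(w,b)}=-1$ (product over the four boundary edges, each directed from white to black). An oriented dimer configuration $\vec{M}$ is a set of directed edges whose undirected version is a perfect matching (each matched edge carrying exactly one direction). Its weight is $\prod_{\vec e\in\vec M}\varphi_{\vec e}\,a_{f(\vec e)}$, where $f(\vec e)\in F$ is the face to the right of $\vec e$. $Z(A,a,\varphi)$ is the sum of the weights of all oriented dimer configurations of $A$, and $Y(A,a)=\bigl(\prod_{f\in F}a_f\bigr)\frac{Z(A,a^{-1},\varphi)}{Z(A,a,\varphi)}$, where $a^{-1}$ denotes the inverse face weights; this does not depend on $\varphi$. $Y$ is regarded as a rational function of the face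 weights. Standing assumption: the data are generic, so that the dynamics and all expressions are well defined. *)

theory Defs
  imports "HOL-Analysis.Analysis"
begin

text \<open>
  The extended complex plane is \<open>complex option\<close>, with \<open>None\<close> as the point at infinity
  (the convention of \<open>Alexandroff_compactification\<close>).
\<close>

type_synonym csphere = "complex option"

definition is_center :: "complex \<Rightarrow> csphere set \<Rightarrow> bool" where
  "is_center z C \<longleftrightarrow> (\<exists>r>0. C = Some ` sphere z r)"

definition is_line :: "csphere set \<Rightarrow> bool" where
  "is_line C \<longleftrightarrow> (\<exists>z v. v \<noteq> 0 \<and> C = insert None (Some ` range (\<lambda>s::real. z + of_real s * v)))"

definition is_circle :: "csphere set \<Rightarrow> bool" where
  "is_circle C \<longleftrightarrow> (\<exists>z. is_center z C) \<or> is_line C"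

definition center :: "csphere set \<Rightarrow> complex" where
  "center C = (THE z. is_center z C)"

text \<open>
  The four corners of a face are indexed as the points \<open>p\<close> of a circle pattern: the circle
  \<open>c f\<close> contains \<open>p v\<close> for the corners \<open>v\<close> of \<open>f\<close>. In the planar
  drawing where face \<open>(i, j)\<close> is the unit square centered at \<open>(i, j)\<close>, the vertex
  \<open>(x, y)\<close> is thus located at \<open>(x - 1/2, y - 1/2)\<close>.
\<close>

type_synonym face = "int \<times> int"
type_synonym vertex = "int \<times> int"

definition corners :: "face \<Rightarrow> vertex set" where
  "corners = (\<lambda>(i, j). {(i, j), (i + 1, j), (i + 1, j + 1), (i, j + 1)})"

definition circle_pattern :: "(vertex \<Rightarrow> csphere) \<Rightarrow> (face \<Rightarrow> csphere set) \<Rightarrow> bool" where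
  "circle_pattern p c \<longleftrightarrow> (\<forall>f. is_circle (c f) \<and> p ` corners f \<subseteq> c f)"

definition t_realization :: "(face \<Rightarrow> complex) \<Rightarrow> bool" where
  "t_realization t \<longleftrightarrow> (\<forall>i j.
     (t (i, j + 1) - t (i, j)) * (t (i, j - 1) - t (i, j)) \<noteq> 0 \<and>
     ((t (i + 1, j) - t (i, j)) * (t (i - 1, j) - t (i, j))) /
     ((t (i, j + 1) - t (i, j)) * (t (i, j - 1) - t (i, j))) \<in> \<real>)"


subsection \<open>Miquel dynamics\<close>

definition neighbour_points :: "(face \<Rightarrow> csphere set) \<Rightarrow> face \<Rightarrow> csphere set" where
  "neighbour_points c = (\<lambda>(i, j).
     (c (i + 1, j) \<inter> c (i, j + 1)) \<union> (c (i, j + 1) \<inter> c (i - 1, j)) \<union>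
     (c (i - 1, j) \<inter> c (i, j - 1)) \<union> (c (i, j - 1) \<inter> c (i + 1, j)))"

definition sixth_circle :: "(face \<Rightarrow> csphere set) \<Rightarrow> face \<Rightarrow> csphere set" where
  "sixth_circle c f = (THE d. is_circle d \<and> neighbour_points c f - c f \<subseteq> d)"

definition updated :: "nat \<Rightarrow> face \<Rightarrow> bool" where
  "updated k = (\<lambda>(i, j). if odd k then even (i + j) else odd (i + j))"

fun miquel :: "nat \<Rightarrow> (face \<Rightarrow> csphere set) \<Rightarrow> face \<Rightarrow> csphere set" where
  "miquel 0 c = c"
| "miquel (Suc k) c =
     (\<lambda>f. if updated (Suc k) f then sixth_circle (miquel k c) f else miquel k c f)"

text \<open>
  Genericity of the dynamics up to time \<open>k\<close>: no circle degenerates to a line, so that all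
  centers are complex numbers, and around every circle that gets replaced the consecutive
  neighbours meet in eight distinct points.
\<close>

definition miquel_defined :: "nat \<Rightarrow> (face \<Rightarrow> csphere set) \<Rightarrow> bool" where
  "miquel_defined k c \<longleftrightarrow>
     (\<forall>m\<le>k. \<forall>f. \<exists>z. is_center z (miquel m c f)) \<and>
     (\<forall>m<k. \<forall>f. updated (Suc m) f \<longrightarrow> card (neighbour_points (miquel m c) f) = 8)"


subsection \<open>Oriented dimers on the Aztec diamond\<close>

definition internal_faces :: "nat \<Rightarrow> face \<Rightarrow> face set" where
  "internal_faces k = (\<lambda>(i, j). {(i', j'). \<bar>i' - i\<bar> + \<bar>j' - j\<bar> < int k})"

definition open_faces :: "nat \<Rightarrow> face \<Rightarrow> face set" where
  "open_faces k = (\<lambda>(i, j). {(i', j'). \<bar>i' - i\<bar> + \<bar>j' - j\<bar> = int k})"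

definition faces :: "nat \<Rightarrow> face \<Rightarrow> face set" where
  "faces k f = internal_faces k f \<union> open_faces k f"

definition adjacent :: "vertex \<Rightarrow> vertex \<Rightarrow> bool" where
  "adjacent = (\<lambda>(x, y) (x', y'). \<bar>x - x'\<bar> + \<bar>y - y'\<bar> = 1)"

definition face_edges :: "face \<Rightarrow> (vertex \<times> vertex) set" where
  "face_edges f = {(u, v). u \<in> corners f \<and> v \<in> corners f \<and> adjacent u v}"

definition aztec_vertices :: "nat \<Rightarrow> face \<Rightarrow> vertex set" where
  "aztec_vertices k f = (\<Union>g\<in>internal_faces k f. corners g)"

definition aztec_edges :: "nat \<Rightarrow> face \<Rightarrow> (vertex \<times> vertex) set" where
  "aztec_edges k f = (\<Union>g\<in>internal_faces k f. face_edges g)"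

definition right_face :: "vertex \<times> vertex \<Rightarrow> face" where
  "right_face = (\<lambda>((x, y), (x', y')).
     if x' = x + 1 then (x, y - 1)           \<comment> \<open>eastwards: face to the south\<close>
     else if x' = x - 1 then (x - 1, y)      \<comment> \<open>westwards: face to the north\<close>
     else if y' = y + 1 then (x, y)          \<comment> \<open>northwards: face to the east\<close>
     else (x - 1, y - 1))                    \<comment> \<open>southwards: face to the west\<close>"

text \<open>
  Exchanging the two colour classes reverses all four signs around a face, so the notion of
  Kasteleyn orientation does not depend on which class is called white.
\<close>

definition white :: "vertex \<Rightarrow> bool" where
  "white = (\<lambda>(x, y). even (x + y))"

definition kasteleyn :: "nat \<Rightarrow> face \<Rightarrow> (vertex \<times> vertex \<Rightarrow> int) \<Rightarrow> bool" where
  "kasteleyn k f \<phi> \<longleftrightarrow>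
     (\<forall>(u, v)\<in>aztec_edges k f. \<phi> (u, v) \<in> {-1, 1} \<and> \<phi> (v, u) = - \<phi> (u, v)) \<and>
     (\<forall>g\<in>internal_faces k f. (\<Prod>e\<in>{e \<in> face_edges g. white (fst e)}. \<phi> e) = -1)"

definition perfect_matching :: "nat \<Rightarrow> face \<Rightarrow> vertex set set \<Rightarrow> bool" where
  "perfect_matching k f N \<longleftrightarrow>
     N \<subseteq> (\<lambda>(u, v). {u, v}) ` aztec_edges k f \<and>
     (\<forall>v\<in>aztec_vertices k f. \<exists>!e. e \<in> N \<and> v \<in> e)"

definition oriented_dimers :: "nat \<Rightarrow> face \<Rightarrow> (vertex \<times> vertex) set set" where
  "oriented_dimers k f = {M. M \<subseteq> aztec_edges k f \<and>
     perfect_matching k f ((\<lambda>(u, v). {u, v}) ` M) \<and>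
     (\<forall>(u, v)\<in>M. (v, u) \<notin> M)}"

definition Z :: "nat \<Rightarrow> face \<Rightarrow> (face \<Rightarrow> complex) \<Rightarrow> (vertex \<times> vertex \<Rightarrow> int) \<Rightarrow> complex" where
  "Z k f a \<phi> = (\<Sum>M\<in>oriented_dimers k f. \<Prod>e\<in>M. of_int (\<phi> e) * a (right_face e))"

definition Y :: "nat \<Rightarrow> face \<Rightarrow> (face \<Rightarrow> complex) \<Rightarrow> (vertex \<times> vertex \<Rightarrow> int) \<Rightarrow> complex" where
  "Y k f a \<phi> = (\<Prod>g\<in>faces k f. a g) * (Z k f (\<lambda>g. inverse (a g)) \<phi> / Z k f a \<phi>)"

text \<open>Kasteleyn orientations exist: make the horizontal edges at even heights negative.\<close>

lemma kasteleyn_exists: "\<exists>\<phi>. kasteleyn k f \<phi>"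
proof -
  define \<psi> :: "vertex \<times> vertex \<Rightarrow> int" where
    "\<psi> = (\<lambda>((x, y), (x', y')). if y = y' \<and> even y then -1 else 1)"
  define \<phi> where "\<phi> = (\<lambda>(u, v). if white u then \<psi> (u, v) else - \<psi> (u, v))"
  have adj: "white v \<longleftrightarrow> \<not> white u" if "adjacent u v" for u v
  proof -
    obtain x y x' y' where uv: "u = (x, y)" "v = (x', y')" by (cases u, cases v) auto
    have "(x' = x + 1 \<or> x' = x - 1) \<and> y' = y \<or> x' = x \<and> (y' = y + 1 \<or> y' = y - 1)"
      using that unfolding uv adjacent_def by auto
    then show ?thesis unfolding uv white_def by auto
  qed
  have 1: "\<phi> (u, v) \<in> {-1, 1} \<and> \<phi> (v, u) = - \<phi> (u, v)" if "(u, v) \<in> aztec_edges k f" for u v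
  proof -
    have "adjacent u v" using that by (auto simp: aztec_edges_def face_edges_def)
    from adj[OF this] show ?thesis by (auto simp: \<phi>_def \<psi>_def split: prod.splits)
  qed
  have 2: "(\<Prod>e\<in>{e \<in> face_edges g. white (fst e)}. \<phi> e) = -1" for g
  proof -
    obtain i j where g: "g = (i, j)" by (cases g)
    show ?thesis
    proof (cases "even (i + j)")
      case True
      let ?R = "{((i, j), (i + 1, j)), ((i, j), (i, j + 1)),
         ((i + 1, j + 1), (i + 1, j)), ((i + 1, j + 1), (i, j + 1))}"
      have "{e \<in> face_edges g. white (fst e)} = ?R"
      proof (intro equalityI subsetI)
        fix e assume "e \<in> {e \<in> face_edges g. white (fst e)}"
        then obtain u v where e: "e = (u, v)" and u: "u \<in> corners g" and v: "v \<in> corners g"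
          and "adjacent u v" "white u" by (auto simp: face_edges_def)
        then have *: "white u \<and> adjacent u v" by simp
        from u have "u = (i, j) \<or> u = (i + 1, j) \<or> u = (i + 1, j + 1) \<or> u = (i, j + 1)"
          by (simp add: g corners_def)
        moreover from v have "v = (i, j) \<or> v = (i + 1, j) \<or> v = (i + 1, j + 1) \<or> v = (i, j + 1)"
          by (simp add: g corners_def)
        ultimately show "e \<in> ?R" using * True unfolding e
          by (elim disjE; simp add: white_def adjacent_def)
      next
        fix e assume "e \<in> ?R"
        then show "e \<in> {e \<in> face_edges g. white (fst e)}" using True
          by (elim insertE emptyE;
              simp add: g face_edges_def corners_def white_def adjacent_def)
      qed
      then show ?thesis using True by (simp add: \<phi>_def \<psi>_def white_def)
    next
      case False
      let ?R = "{((i + 1, j), (i, j)), ((i + 1, j), (i + 1, j + 1)),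
         ((i, j + 1), (i, j)), ((i, j + 1), (i + 1, j + 1))}"
      have "{e \<in> face_edges g. white (fst e)} = ?R"
      proof (intro equalityI subsetI)
        fix e assume "e \<in> {e \<in> face_edges g. white (fst e)}"
        then obtain u v where e: "e = (u, v)" and u: "u \<in> corners g" and v: "v \<in> corners g"
          and "adjacent u v" "white u" by (auto simp: face_edges_def)
        then have *: "white u \<and> adjacent u v" by simp
        from u have "u = (i, j) \<or> u = (i + 1, j) \<or> u = (i + 1, j + 1) \<or> u = (i, j + 1)"
          by (simp add: g corners_def)
        moreover from v have "v = (i, j) \<or> v = (i + 1, j) \<or> v = (i + 1, j + 1) \<or> v = (i, j + 1)"
          by (simp add: g corners_def)
        ultimately show "e \<in> ?R" using * False unfolding e
          by (elim disjE; simp add: white_def adjacent_def)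
      next
        fix e assume "e \<in> ?R"
        then show "e \<in> {e \<in> face_edges g. white (fst e)}" using False
          by (elim insertE emptyE;
              simp add: g face_edges_def corners_def white_def adjacent_def)
      qed
      then show ?thesis using False by (simp add: \<phi>_def \<psi>_def white_def)
    qed
  qed
  have "kasteleyn k f \<phi>" unfolding kasteleyn_def using 1 2 by auto
  then show ?thesis by blast
qed

end

theory Submission
  imports Defs
begin

text \<open>
  Let \<open>m\<close> be the center of a circle and \<open>E, N, W, S\<close> those of its neighbours, let \<open>f\<^sub>0, f\<^sub>E, f\<^sub>N, f\<^sub>W, f\<^sub>S\<close>
  be the power functions of the five circles, and \<open>l\<^sub>X = f\<^sub>X - f\<^sub>0\<close>, which is affine. The degenerate conics
  \<open>l\<^sub>E l\<^sub>W\<close> and \<open>l\<^sub>N l\<^sub>S\<close> and the circle \<open>f\<^sub>0\<close> lie in the pencil of conics through the four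
  corners, so \<open>l\<^sub>E l\<^sub>W - R l\<^sub>N l\<^sub>S = g f\<^sub>0\<close> with \<open>(E - m)(W - m) = R (N - m)(S - m)\<close>. At each of the four
  other intersection points two consecutive functions \<open>l\<^sub>X\<close> equal \<open>- f\<^sub>0 \<noteq> 0\<close>; dividing by \<open>f\<^sub>0\<close> gives the
  equation of the sixth circle, whose center is thus a rational function of the five old centers
  (the dSKP recurrence).

  On the dimer side, summing over both directions of every edge turns \<open>Z\<close> into a sum over matchings
  whose edge weights are signed differences of face weights. Urban renewal at every second internal face of
  the Aztec diamond of size \<open>k\<close>, starting with the outermost ones, leaves the Aztec diamond of size \<open>k - 1\<close>.
  By the dSKP recurrence the new edge weights are, up to a gauge, again differences of face weights, namely of
  the new centers, with the same signs. The recurrence is invariant under \<open>z \<mapsto> 1/z\<close>, so the same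
  applies to the inverse weights, and all correction factors cancel in \<open>Y\<close>. As intermediate centers may
  vanish, all centers are first translated by a generic \<open>s\<close>, and then \<open>s\<close> tends to \<open>0\<close>.
\<close>

section \<open>Circles and Miquel's theorem\<close>

text \<open>Urban renewal is usually a chain of vertex splittings, square moves and contractions,
  leading through auxiliary graphs. Here it is a single complementation. The renewed faces, the
  cells, partition the edges of the diamond into four-cycles. On a four-cycle the sum over matchings
  covering a vertex set S is, up to a factor, the sum over matchings covering the complement of S,
  with the weights of opposite edges exchanged and rescaled. A vertex of the diamond of size k lies
  in two cells if it also belongs to the diamond of size k - 1, and in one otherwise. Complementing
  in all cells at once therefore turns the sum for the larger diamond into one for the smaller.

  The parity of i + j + k makes the cells of the first renewal even faces, which Miquel dynamics
  replaces first; afterwards both parities alternate in step.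

  In Y the factors of numerator and denominator differ only by the monomials that inverting the
  weights produces. Comparing the exponent of each face weight shows that these monomials change the
  prefactor of the larger diamond into that of the smaller one.\<close>

lemma line_circle_two_points:
  fixes a v z :: complex
  assumes v: "v \<noteq> 0"
    and d: "dist z (a + of_real s1 * v) = r" "dist z (a + of_real s2 * v) = r"
      "dist z (a + of_real s3 * v) = r"
    and ne: "s1 \<noteq> s2" "s1 \<noteq> s3"
  shows "s2 = s3"
proof -
  define B where "B = Re ((a - z) * cnj v)"
  have sq: "(cmod v)\<^sup>2 * s\<^sup>2 + 2 * B * s + (cmod (a - z))\<^sup>2 = r\<^sup>2"
    if "dist z (a + of_real s * v) = r" for s
  proof -
    have "r\<^sup>2 = (cmod (a + of_real s * v - z))\<^sup>2" using that by (metis dist_commute dist_norm)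
    also have "\<dots> = (cmod v)\<^sup>2 * s\<^sup>2 + 2 * B * s + (cmod (a - z))\<^sup>2"
      unfolding B_def cmod_power2 by (simp add: power2_eq_square algebra_simps)
    finally show ?thesis by simp
  qed
  \<comment> \<open>The difference of the quadratic equations at s and s1, divided by s - s1, is
    linear in s.\<close>
  have e: "(cmod v)\<^sup>2 * (s + s1) + 2 * B = 0" if "dist z (a + of_real s * v) = r" "s1 \<noteq> s" for s
  proof -
    have "(s - s1) * ((cmod v)\<^sup>2 * (s + s1) + 2 * B) = 0"
      using sq[OF that(1)] sq[OF d(1)] by (simp add: algebra_simps power2_eq_square)
    then show ?thesis using that(2) by simp
  qed
  from e[OF d(2) ne(1)] e[OF d(3) ne(2)] have "(cmod v)\<^sup>2 * (s2 + s1) = (cmod v)\<^sup>2 * (s3 + s1)"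
    by linarith
  then show ?thesis using v by simp
qed

text \<open>Subtracting the equations of two circles with different centers leaves their radical
  axis, a line orthogonal to \<open>z - z'\<close>, and a line meets a circle in at most two
  points.\<close>

lemma concentric_if_three_common_points:
  fixes z z' x y w :: complex
  assumes "dist z x = r" "dist z y = r" "dist z w = r"
    and "dist z' x = r'" "dist z' y = r'" "dist z' w = r'"
    and "x \<noteq> y" "x \<noteq> w" "y \<noteq> w"
  shows "z = z'"
proof (rule ccontr)
  assume "z \<noteq> z'"
  define u where "u = \<i> * (z - z')"
  have u: "u \<noteq> 0" using \<open>z \<noteq> z'\<close> by (simp add: u_def)
  have par: "\<exists>s. p = x + of_real s * u" if p: "dist z p = r" "dist z' p = r'" for p
  proof -
    have "(cmod (p - z))\<^sup>2 = (cmod (x - z))\<^sup>2" "(cmod (p - z'))\<^sup>2 = (cmod (x - z'))\<^sup>2"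
      using p assms by (simp_all add: dist_commute dist_norm[symmetric])
    then have "Re ((p - x) * cnj (z - z')) = 0"
      unfolding cmod_power2 by (simp add: power2_eq_square algebra_simps)
    then have "Im ((p - x) / u) = 0"
      unfolding u_def by (simp add: Im_divide algebra_simps)
    then have "(p - x) / u = of_real (Re ((p - x) / u))"
      by (simp add: complex_eq_iff)
    then have "p = x + of_real (Re ((p - x) / u)) * u"
      using u by (metis add.commute diff_add_cancel nonzero_divide_eq_eq)
    then show ?thesis by blast
  qed
  obtain s where s: "y = x + of_real s * u" using par assms by blast
  obtain s' where s': "w = x + of_real s' * u" using par assms by blast
  have "s = s'"
    by (rule line_circle_two_points[OF u, of z x 0 r]) (use assms s s' in auto)
  then show False using s s' assms by simp
qed

lemma unique_circle:
  assumes "is_circle C" "is_circle D"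
    and "{Some x, Some y, Some w} \<subseteq> C" "{Some x, Some y, Some w} \<subseteq> D"
    and ne: "x \<noteq> y" "x \<noteq> w" "y \<noteq> w"
  shows "C = D"
proof -
  have cc: "C = D" if h: "is_center z C" "is_center z' D" "{Some x, Some y, Some w} \<subseteq> C" "{Some x, Some y, Some w} \<subseteq> D" for z z' C D
  proof -
    obtain r r' where r: "C = Some ` sphere z r" "D = Some ` sphere z' r'"
      using h unfolding is_center_def by blast
    have d: "dist z x = r" "dist z y = r" "dist z w = r"
      "dist z' x = r'" "dist z' y = r'" "dist z' w = r'"
      using h r by auto
    from concentric_if_three_common_points[OF d ne] d r show ?thesis by simp
  qed
  have cl: False if h: "is_center z C" "is_line D" "{Some x, Some y, Some w} \<subseteq> C" "{Some x, Some y, Some w} \<subseteq> D" for z C D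
  proof -
    obtain r where r: "C = Some ` sphere z r" using h unfolding is_center_def by blast
    obtain a v where v: "v \<noteq> 0" "D = insert None (Some ` range (\<lambda>s::real. a + of_real s * v))"
      using h unfolding is_line_def by blast
    obtain s1 s2 s3 where s: "x = a + of_real s1 * v" "y = a + of_real s2 * v" "w = a + of_real s3 * v"
      using h v by auto
    have d: "dist z x = r" "dist z y = r" "dist z w = r" using h r by auto
    have "s2 = s3"
      by (rule line_circle_two_points[OF v(1), of z a s1 r]) (use d s ne in auto)
    then show False using s ne by simp
  qed
  have ll: "D \<subseteq> C" if h: "is_line C" "is_line D" "{Some x, Some y, Some w} \<subseteq> C" "{Some x, Some y, Some w} \<subseteq> D" for C D
  proof -
    obtain a v where v: "v \<noteq> 0" "C = insert None (Some ` range (\<lambda>s::real. a + of_real s * v))"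
      using h unfolding is_line_def by blast
    obtain a' v' where v': "v' \<noteq> 0" "D = insert None (Some ` range (\<lambda>s::real. a' + of_real s * v'))"
      using h unfolding is_line_def by blast
    obtain s1 s2 where s: "x = a + of_real s1 * v" "y = a + of_real s2 * v"
      using h v by auto
    obtain s1' s2' where s': "x = a' + of_real s1' * v'" "y = a' + of_real s2' * v'"
      using h v' by auto
    have ne': "s1' \<noteq> s2'" using s' ne by auto
    have "(of_real s2' - of_real s1') * v' = y - x" using s' by (simp add: algebra_simps)
    then have "(of_real s2' - of_real s1') * v' = (of_real s2 - of_real s1) * v"
      using s by (simp add: algebra_simps)
    then have v'_eq: "v' = of_real ((s2 - s1) / (s2' - s1')) * v"
      using ne' by (simp add: field_simps)
    have "a' + of_real t * v' \<in> range (\<lambda>s::real. a + of_real s * v)" for t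
    proof (rule range_eqI)
      have "a' + of_real t * v' = x + of_real (t - s1') * v'" using s' by (simp add: algebra_simps)
      also have "\<dots> = a + of_real s1 * v + of_real (t - s1') * (of_real ((s2 - s1) / (s2' - s1')) * v)"
        using s(1) v'_eq by simp
      also have "\<dots> = a + of_real (s1 + (t - s1') * ((s2 - s1) / (s2' - s1'))) * v"
        by (simp add: algebra_simps)
      finally show "a' + of_real t * v' = a + of_real (s1 + (t - s1') * ((s2 - s1) / (s2' - s1'))) * v" .
    qed
    then have "range (\<lambda>s::real. a' + of_real s * v') \<subseteq> range (\<lambda>s::real. a + of_real s * v)"
      by blast
    then show ?thesis unfolding v(2) v'(2) by blast
  qed
  show ?thesis
    using assms cc cl ll unfolding is_circle_def by (metis subset_antisym)
qed

section \<open>The pencil of conics through four concyclic points\<close>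

text \<open>On a circle around the origin \<open>cnj p\<close> is \<rho>^2 / p, which turns
  equidistance from p and q into the first equation. In the second, the difference of the two power
  functions is \<open>- c\<close> times the equation of the chord through p and q, normalised so
  that \<open>cnj x\<close> has coefficient 1 whatever c is.\<close>

lemma chord_equation:
  fixes c p q x :: complex
  assumes p: "cmod p = \<rho>" and q: "cmod q = \<rho>" and "\<rho> > 0" "p \<noteq> q"
    and c: "cmod (p - c) = cmod (q - c)"
  shows "cnj c = of_real (\<rho>\<^sup>2) * c / (p * q)"
    and "of_real ((cmod (x - c))\<^sup>2 - (cmod (p - c))\<^sup>2 - ((cmod x)\<^sup>2 - \<rho>\<^sup>2)) =
      - c * (cnj x + of_real (\<rho>\<^sup>2) * (x - p - q) / (p * q))"
proof -
  define k :: complex where "k = of_real (\<rho>\<^sup>2)"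
  have nz: "p \<noteq> 0" "q \<noteq> 0" "k \<noteq> 0" using assms by (auto simp: k_def)
  have pk: "p * cnj p = k" "q * cnj q = k"
    using p q by (simp_all add: k_def flip: complex_norm_square)
  have cp: "cnj p = k / p" "cnj q = k / q" using pk nz by (simp_all add: field_simps)
  have "(p - c) * cnj (p - c) = (q - c) * cnj (q - c)"
    using c by (simp only: complex_norm_square[symmetric])
  then have "c * cnj p + cnj c * p = c * cnj q + cnj c * q"
    using pk by (simp add: algebra_simps)
  then have "(p - q) * (cnj c * (p * q) - k * c) = 0"
    unfolding cp using nz by (simp add: field_simps)
  then have "cnj c * (p * q) = k * c" using \<open>p \<noteq> q\<close> by simp
  then have cc: "cnj c = k * c / (p * q)" using nz by (simp add: field_simps)
  then show "cnj c = of_real (\<rho>\<^sup>2) * c / (p * q)" unfolding k_def .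
  have "of_real ((cmod (x - c))\<^sup>2 - (cmod (p - c))\<^sup>2 - ((cmod x)\<^sup>2 - \<rho>\<^sup>2)) =
    (x - c) * cnj (x - c) - (p - c) * cnj (p - c) - (x * cnj x - k)"
    unfolding of_real_diff complex_norm_square by (simp add: k_def)
  also have "\<dots> = c * cnj p + cnj c * p - c * cnj x - cnj c * x"
    using pk by (simp add: algebra_simps)
  also have "\<dots> = - c * (cnj x + k * (x - p - q) / (p * q))"
    unfolding cp cc using nz by (simp add: field_simps)
  finally show "of_real ((cmod (x - c))\<^sup>2 - (cmod (p - c))\<^sup>2 - ((cmod x)\<^sup>2 - \<rho>\<^sup>2)) =
      - c * (cnj x + of_real (\<rho>\<^sup>2) * (x - p - q) / (p * q))" unfolding k_def .
qed

text \<open>In the two products of normalised equations of opposite chords, the squares of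
  \<open>x\<close> and \<open>cnj x\<close> and all linear terms have the same coefficients. The
  products thus differ by a multiple of \<open>x * cnj x - k\<close>, the equation of the
  circle.\<close>

lemma conics_through_four_concyclic_points:
  fixes E N W S p1 p2 p3 p4 :: complex
  defines "f \<equiv> \<lambda>c p x. (cmod (x - c))\<^sup>2 - (cmod (p - c))\<^sup>2"
  assumes p: "cmod p1 = \<rho>" "cmod p2 = \<rho>" "cmod p3 = \<rho>" "cmod p4 = \<rho>" and "\<rho> > 0"
    and ne: "p4 \<noteq> p1" "p1 \<noteq> p2" "p2 \<noteq> p3" "p3 \<noteq> p4"
    and E: "cmod (p4 - E) = cmod (p1 - E)" and N: "cmod (p1 - N) = cmod (p2 - N)"
    and W: "cmod (p2 - W) = cmod (p3 - W)" and S: "cmod (p3 - S) = cmod (p4 - S)"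
    and nz: "E \<noteq> 0" "N \<noteq> 0" "W \<noteq> 0" "S \<noteq> 0"
  shows "\<exists>R g :: real. R \<noteq> 0 \<and> E * W = of_real R * (N * S) \<and>
    (\<forall>x. (f E p4 x - f 0 p1 x) * (f W p2 x - f 0 p1 x)
        - R * ((f N p1 x - f 0 p1 x) * (f S p3 x - f 0 p1 x)) = g * f 0 p1 x)"
proof -
  define k :: complex where "k = of_real (\<rho>\<^sup>2)"
  have kz: "k \<noteq> 0" "p1 \<noteq> 0" "p2 \<noteq> 0" "p3 \<noteq> 0" "p4 \<noteq> 0" using p \<open>\<rho> > 0\<close> by (auto simp: k_def)
  have kcnj: "cnj k = k" by (simp add: k_def)
  note cE = chord_equation[OF p(4) p(1) \<open>\<rho> > 0\<close> ne(1) E, folded k_def]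
  note cN = chord_equation[OF p(1) p(2) \<open>\<rho> > 0\<close> ne(2) N, folded k_def]
  note cW = chord_equation[OF p(2) p(3) \<open>\<rho> > 0\<close> ne(3) W, folded k_def]
  note cS = chord_equation[OF p(3) p(4) \<open>\<rho> > 0\<close> ne(4) S, folded k_def]
  \<comment> \<open>Conjugation multiplies each center by k / (p q) for the ends p, q of its chord.
    Every corner occurs once above and once below the fraction bar, so the quotient is
    unchanged.\<close>
  have "cnj (E * W / (N * S)) = E * W / (N * S)"
    using nz kz unfolding complex_cnj_divide complex_cnj_mult cE(1) cN(1) cW(1) cS(1)
    by (simp add: field_simps)
  then have "E * W / (N * S) \<in> \<real>" by (simp add: Reals_cnj_iff)
  then obtain R where "E * W / (N * S) = of_real R" by (auto elim: Reals_cases)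
  then have R: "E * W = of_real R * (N * S)" using nz by (simp add: field_simps)
  have "R \<noteq> 0" using R nz by auto
  define lE where "lE = (\<lambda>x. f E p4 x - f 0 p1 x)"
  define lN where "lN = (\<lambda>x. f N p1 x - f 0 p1 x)"
  define lW where "lW = (\<lambda>x. f W p2 x - f 0 p1 x)"
  define lS where "lS = (\<lambda>x. f S p3 x - f 0 p1 x)"
  define h where "h = (\<lambda>x. lE x * lW x - R * (lN x * lS x))"
  define d where "d = k / (p1 * p2 * p3 * p4) * (p2 * p3 + p1 * p4 - p1 * p2 - p3 * p4)"
  have f0: "f 0 p1 x = (cmod x)\<^sup>2 - \<rho>\<^sup>2" for x by (simp add: f_def p)
  have l: "of_real (lE x) = - E * (cnj x + k * (x - p4 - p1) / (p4 * p1))"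
    "of_real (lN x) = - N * (cnj x + k * (x - p1 - p2) / (p1 * p2))"
    "of_real (lW x) = - W * (cnj x + k * (x - p2 - p3) / (p2 * p3))"
    "of_real (lS x) = - S * (cnj x + k * (x - p3 - p4) / (p3 * p4))" for x
    unfolding lE_def lN_def lW_def lS_def f0
    by (simp_all only: f_def cE(2) cN(2) cW(2) cS(2))
  have h: "of_real (h x) = (E * W * d) * of_real (f 0 p1 x)" for x
  proof -
    have gen: "(- E * a) * (- W * b) - r * ((- N * c) * (- S * d)) = E * W * (a * b) - r * (N * S) * (c * d)"
      for a b c d r by (simp add: algebra_simps)
    have "complex_of_real (h x) = E * W * ((cnj x + k * (x - p4 - p1) / (p4 * p1)) * (cnj x + k * (x - p2 - p3) / (p2 * p3)))
       - of_real R * (N * S) * ((cnj x + k * (x - p1 - p2) / (p1 * p2)) * (cnj x + k * (x - p3 - p4) / (p3 * p4)))"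
      unfolding h_def of_real_diff of_real_mult l by (rule gen)
    also have "\<dots> = E * W * ((cnj x + k * (x - p4 - p1) / (p4 * p1)) * (cnj x + k * (x - p2 - p3) / (p2 * p3))
       - (cnj x + k * (x - p1 - p2) / (p1 * p2)) * (cnj x + k * (x - p3 - p4) / (p3 * p4)))"
      unfolding R[symmetric] by (simp only: right_diff_distrib)
    also have "(cnj x + k * (x - p4 - p1) / (p4 * p1)) * (cnj x + k * (x - p2 - p3) / (p2 * p3))
       - (cnj x + k * (x - p1 - p2) / (p1 * p2)) * (cnj x + k * (x - p3 - p4) / (p3 * p4)) = d * (x * cnj x - k)"
      unfolding d_def using kz by (simp add: field_simps)
    also have "x * cnj x - k = of_real (f 0 p1 x)"
      unfolding f0 of_real_diff complex_norm_square by (simp add: k_def)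
    finally show ?thesis by (simp only: mult.assoc)
  qed
  \<comment> \<open>Evaluation at the center, where \<open>f 0 p1\<close> equals - \<rho>^2, shows
    that the complex factor \<open>E * W * d\<close> is real.\<close>
  have "h x = - h 0 / \<rho>\<^sup>2 * f 0 p1 x" for x
  proof -
    have "complex_of_real (h 0) = - (E * W * d) * k" unfolding h f0 by (simp add: k_def)
    then have "E * W * d = of_real (- h 0 / \<rho>\<^sup>2)"
      using kz by (simp add: k_def field_simps)
    with h[of x] have "complex_of_real (h x) = of_real (- h 0 / \<rho>\<^sup>2 * f 0 p1 x)" by simp
    then show ?thesis using of_real_eq_iff by blast
  qed
  then show ?thesis
    using \<open>R \<noteq> 0\<close> R unfolding h_def lE_def lN_def lW_def lS_def by blast
qed

section \<open>Intersections of two circles\<close>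

lemma infinite_circle:
  assumes "is_center z C"
  shows "infinite C"
proof -
  obtain r where r: "r > 0" "C = Some ` sphere z r" using assms unfolding is_center_def by blast
  have "connected (sphere z r)" by (rule connected_sphere) simp
  moreover have "z + of_real r \<in> sphere z r" "z - of_real r \<in> sphere z r"
    using r by (auto simp: dist_norm)
  moreover have "z + of_real r \<noteq> z - of_real r" using r by (simp add: complex_eq_iff)
  ultimately have "uncountable (sphere z r)" using connected_uncountable by blast
  then have "infinite (sphere z r)" using countable_finite by blast
  then show ?thesis unfolding r(2) using finite_imageD[of Some "sphere z r"] by (auto simp: inj_on_def)
qed

lemma is_centerD:
  assumes "is_center z C"
  obtains r where "r > 0" "C = Some ` {x. cmod (x - z) = r}"
proof -
  obtain r where r: "r > 0" "C = Some ` sphere z r" using assms unfolding is_center_def by blast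
  have "sphere z r = {x. cmod (x - z) = r}" by (auto simp: dist_norm norm_minus_commute)
  then show ?thesis using that r by simp
qed

lemma center_eqI:
  assumes "is_center z C" "is_center z' D" "{x, y, w} \<subseteq> C \<inter> D" "x \<noteq> y" "x \<noteq> w" "y \<noteq> w"
  shows "z = z'"
proof -
  obtain r where r: "C = Some ` {x. cmod (x - z) = r}" using is_centerD[OF assms(1)] by blast
  obtain r' where r': "D = Some ` {x. cmod (x - z') = r'}" using is_centerD[OF assms(2)] by blast
  show ?thesis
    by (rule concentric_if_three_common_points[of z "the x" r "the y" "the w" z' r'])
      (use assms r r' in \<open>auto simp: dist_norm norm_minus_commute\<close>)
qed

lemma concentric_eqI:
  assumes "is_center z C" "is_center z D" "x \<in> C" "x \<in> D"
  shows "C = D"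
proof -
  obtain r where r: "C = Some ` {x. cmod (x - z) = r}" using is_centerD[OF assms(1)] by blast
  obtain r' where r': "D = Some ` {x. cmod (x - z) = r'}" using is_centerD[OF assms(2)] by blast
  show ?thesis using assms r r' by auto
qed

lemma card_circle_Int_le:
  assumes C: "is_center z C" and D: "is_center z' D" and "z \<noteq> z'"
  shows "finite (C \<inter> D) \<and> card (C \<inter> D) \<le> 2"
proof (rule ccontr)
  assume neg: "\<not> ?thesis"
  have "\<exists>T\<subseteq>C \<inter> D. card T = 3"
  proof (cases "finite (C \<inter> D)")
    case True
    with neg have "3 \<le> card (C \<inter> D)" by auto
    then show ?thesis using obtain_subset_with_card_n by metis
  next
    case False
    then show ?thesis using infinite_arbitrarily_large by blast
  qed
  then obtain x y w where "{x, y, w} \<subseteq> C \<inter> D" "x \<noteq> y" "x \<noteq> w" "y \<noteq> w"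
    by (auto simp: card_3_iff)
  from center_eqI[OF C D this] \<open>z \<noteq> z'\<close> show False by simp
qed

text \<open>Concentric circles with a common point coincide, and a circle is infinite, so a finite
  nonempty intersection forces distinct centers. In the dynamics the finiteness comes from the count
  of eight points.\<close>

lemma circle_Int:
  assumes C: "is_center z C" and D: "is_center z' D" and "finite (C \<inter> D)" "x \<in> C" "x \<in> D"
  shows "z \<noteq> z'" and "card (C \<inter> D) \<le> 2"
proof -
  show "z \<noteq> z'"
  proof
    assume "z = z'"
    then have "C = D" using concentric_eqI[of z C D x] assms by simp
    then show False using infinite_circle[OF C] assms by simp
  qed
  then show "card (C \<inter> D) \<le> 2" using card_circle_Int_le[OF C D] by simp
qed

text \<open>The relation between an old center \<open>m\<close>, its four neighbours and the new center \<open>z\<close>, written with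
  \<open>m\<close> as origin; the inequalities are the genericity that urban renewal needs.\<close>

definition dskp :: "complex \<Rightarrow> complex \<Rightarrow> complex \<Rightarrow> complex \<Rightarrow> complex \<Rightarrow> complex \<Rightarrow> bool" where
  "dskp m E N W S z \<longleftrightarrow> E \<noteq> N \<and> N \<noteq> W \<and> W \<noteq> S \<and> S \<noteq> E \<and>
     (N - m) * (S - m) - (E - m) * (W - m) \<noteq> 0 \<and>
     (z - m) * ((N - m) * (S - m) - (E - m) * (W - m)) =
       (N - m) * (S - m) * ((E - m) + (W - m)) - (E - m) * (W - m) * ((N - m) + (S - m))"

text \<open>Completing the square. For R = 1 the locus is a line, which contains \<open>None\<close>
  and so has no center; this is how the existence of a center of the sixth circle excludes R = 1.
  For R \<noteq> 1 the radius is positive because there is more than one zero.\<close>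

lemma real_circle_equation:
  fixes q1 q2 q3 a M :: complex and R K :: real
  defines "H \<equiv> \<lambda>x. (1 - R) * (cmod (x - a))\<^sup>2 - 2 * Re (cnj M * (x - a)) + K"
  assumes H: "H q1 = 0" "H q2 = 0" "H q3 = 0"
    and ne: "q1 \<noteq> q2" "q1 \<noteq> q3" "q2 \<noteq> q3"
    and nd: "R = 1 \<Longrightarrow> M \<noteq> 0"
  shows "\<exists>D. is_circle D \<and> (\<forall>x. H x = 0 \<longrightarrow> Some x \<in> D) \<and>
    (\<forall>z. is_center z D \<longrightarrow> R \<noteq> 1 \<and> z = a + M / (1 - of_real R))"
proof (cases "R = 1")
  case True
  define v where "v = \<i> * M"
  have v: "v \<noteq> 0" using nd True by (simp add: v_def)
  define D where "D = insert None (Some ` range (\<lambda>s::real. q1 + of_real s * v))"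
  have "is_circle D" unfolding is_circle_def is_line_def D_def using v by blast
  moreover have "Some x \<in> D" if "H x = 0" for x
  proof -
    have "Re (cnj M * (x - q1)) = 0" using that H(1) unfolding H_def True by (simp add: algebra_simps)
    then have "Im ((x - q1) / v) = 0" unfolding v_def by (simp add: Im_divide algebra_simps)
    then have "(x - q1) / v = of_real (Re ((x - q1) / v))" by (simp add: complex_eq_iff)
    then have "x = q1 + of_real (Re ((x - q1) / v)) * v"
      using v by (metis add.commute diff_add_cancel nonzero_divide_eq_eq)
    then show ?thesis unfolding D_def by blast
  qed
  moreover have "\<not> is_center z D" for z unfolding is_center_def D_def by auto
  ultimately show ?thesis by blast
next
  case False
  define c where "c = a + M / (1 - of_real R)"
  have nz: "1 - R \<noteq> 0" using False by simp
  have cM: "M = (1 - of_real R) * (c - a)"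
    using nz by (simp add: c_def)
  have sq: "H x = (1 - R) * (cmod (x - c))\<^sup>2 + (K - (1 - R) * (cmod (c - a))\<^sup>2)" for x
    unfolding H_def cM cmod_power2 by (simp add: power2_eq_square algebra_simps)
  define r where "r = cmod (q1 - c)"
  have Hr: "cmod (x - c) = r" if "H x = 0" for x
  proof -
    have "(1 - R) * (cmod (x - c))\<^sup>2 = (1 - R) * (cmod (q1 - c))\<^sup>2"
      using that H(1) unfolding sq by linarith
    then show ?thesis using nz by (simp add: r_def)
  qed
  have "r > 0"
  proof (rule ccontr)
    assume "\<not> r > 0"
    then have "r = 0" by (simp add: r_def)
    with Hr[OF H(1)] Hr[OF H(2)] have "q1 = c" "q2 = c" by auto
    with ne show False by simp
  qed
  define D where "D = Some ` sphere c r"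
  have cD: "is_center c D" unfolding is_center_def D_def using \<open>r > 0\<close> by blast
  have mem: "Some x \<in> D" if "H x = 0" for x
    using Hr[OF that] unfolding D_def by (simp add: dist_norm norm_minus_commute)
  have "z = c" if "is_center z D" for z
    by (rule center_eqI[OF that cD, of "Some q1" "Some q2" "Some q3"]) (use mem H ne in auto)
  then show ?thesis using cD mem False unfolding is_circle_def c_def by blast
qed

text \<open>Four sets of at most two elements reach eight only if nothing is lost to overlaps. The
  bounds are conditional on finiteness, which follows from the nonzero cardinality of the
  union.\<close>

lemma eight_points:
  assumes U: "card (A \<union> B \<union> C \<union> D) = 8"
    and le: "finite A \<Longrightarrow> card A \<le> 2" "finite B \<Longrightarrow> card B \<le> 2" "finite C \<Longrightarrow> card C \<le> 2" "finite D \<Longrightarrow> card D \<le> 2"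
  shows "card A = 2 \<and> card B = 2 \<and> card C = 2 \<and> card D = 2 \<and>
    A \<inter> B = {} \<and> A \<inter> C = {} \<and> A \<inter> D = {} \<and> B \<inter> C = {} \<and> B \<inter> D = {} \<and> C \<inter> D = {}"
proof -
  have "finite (A \<union> B \<union> C \<union> D)" using U by (metis card.infinite zero_neq_numeral)
  then have f: "finite A" "finite B" "finite C" "finite D" by auto
  have 1: "card A + card B = card (A \<union> B) + card (A \<inter> B)"
    "card (A \<union> B) + card C = card (A \<union> B \<union> C) + card ((A \<union> B) \<inter> C)"
    "card (A \<union> B \<union> C) + card D = 8 + card ((A \<union> B \<union> C) \<inter> D)"
    using f card_Un_Int[of A B] card_Un_Int[of "A \<union> B" C] card_Un_Int[of "A \<union> B \<union> C" D] U by auto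
  with le f have c: "card A = 2 \<and> card B = 2 \<and> card C = 2 \<and> card D = 2"
    and "card (A \<inter> B) = 0" "card ((A \<union> B) \<inter> C) = 0" "card ((A \<union> B \<union> C) \<inter> D) = 0" by linarith+
  then have "A \<inter> B = {}" "(A \<union> B) \<inter> C = {}" "(A \<union> B \<union> C) \<inter> D = {}" using f by auto
  with c show ?thesis by blast
qed

lemma card_two_other:
  assumes "card A = 2" "p \<in> A"
  obtains q where "A = {p, q}" "q \<noteq> p"
proof -
  obtain x y where "A = {x, y}" "x \<noteq> y" using assms by (auto simp: card_2_iff)
  then show thesis using assms that[of x] that[of y] by auto
qed

lemma other_point_not_on_circle:
  assumes "is_center m C0" "is_center N C" "m \<noteq> N"
    and "{p, p', q} \<subseteq> C" "{p, p'} \<subseteq> C0" "p \<noteq> p'" "p \<noteq> q" "p' \<noteq> q"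
  shows "q \<notin> C0"
  using center_eqI[of m C0 N C p p' q] assms by auto

text \<open>Besides the relation for the center, the conclusions keep track of the second
  intersection points: they lie on D and become the corners of the pattern after the
  replacement.\<close>

lemma miquel_theorem:
  assumes cen: "is_center m C0" "is_center E CE" "is_center N CN" "is_center W CW" "is_center S CS"
    and p: "p1 \<in> C0 \<inter> (CE \<inter> CN)" "p2 \<in> C0 \<inter> (CN \<inter> CW)" "p3 \<in> C0 \<inter> (CW \<inter> CS)" "p4 \<in> C0 \<inter> (CS \<inter> CE)"
    and card: "card (CE \<inter> CN \<union> CN \<inter> CW \<union> CW \<inter> CS \<union> CS \<inter> CE) = 8"
  defines "D \<equiv> THE d. is_circle d \<and> (CE \<inter> CN \<union> CN \<inter> CW \<union> CW \<inter> CS \<union> CS \<inter> CE) - C0 \<subseteq> d"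
  assumes z: "is_center z D"
  shows "dskp m E N W S z"
    and "\<exists>q. CE \<inter> CN = {p1, q} \<and> q \<noteq> p1 \<and> q \<in> D"
    and "\<exists>q. CN \<inter> CW = {p2, q} \<and> q \<noteq> p2 \<and> q \<in> D"
    and "\<exists>q. CW \<inter> CS = {p3, q} \<and> q \<noteq> p3 \<and> q \<in> D"
    and "\<exists>q. CS \<inter> CE = {p4, q} \<and> q \<noteq> p4 \<and> q \<in> D"
proof -
  let ?U = "CE \<inter> CN \<union> CN \<inter> CW \<union> CW \<inter> CS \<union> CS \<inter> CE"
  have "finite ?U" using card by (metis card.infinite zero_neq_numeral)
  then have fin: "finite (CE \<inter> CN)" "finite (CN \<inter> CW)" "finite (CW \<inter> CS)" "finite (CS \<inter> CE)" by auto
  have ne: "E \<noteq> N" "N \<noteq> W" "W \<noteq> S" "S \<noteq> E"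
    using circle_Int(1)[OF cen(2,3) fin(1), of p1] circle_Int(1)[OF cen(3,4) fin(2), of p2]
      circle_Int(1)[OF cen(4,5) fin(3), of p3] circle_Int(1)[OF cen(5,2) fin(4), of p4] p by auto
  have e8: "card (CE \<inter> CN) = 2 \<and> card (CN \<inter> CW) = 2 \<and> card (CW \<inter> CS) = 2 \<and> card (CS \<inter> CE) = 2 \<and>
    (CE \<inter> CN) \<inter> (CN \<inter> CW) = {} \<and> (CE \<inter> CN) \<inter> (CW \<inter> CS) = {} \<and> (CE \<inter> CN) \<inter> (CS \<inter> CE) = {} \<and>
    (CN \<inter> CW) \<inter> (CW \<inter> CS) = {} \<and> (CN \<inter> CW) \<inter> (CS \<inter> CE) = {} \<and> (CW \<inter> CS) \<inter> (CS \<inter> CE) = {}"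
  proof (rule eight_points[OF card])
    show "card (CE \<inter> CN) \<le> 2" by (rule circle_Int(2)[OF cen(2,3) fin(1), of p1]) (use p in blast)+
    show "card (CN \<inter> CW) \<le> 2" by (rule circle_Int(2)[OF cen(3,4) fin(2), of p2]) (use p in blast)+
    show "card (CW \<inter> CS) \<le> 2" by (rule circle_Int(2)[OF cen(4,5) fin(3), of p3]) (use p in blast)+
    show "card (CS \<inter> CE) \<le> 2" by (rule circle_Int(2)[OF cen(5,2) fin(4), of p4]) (use p in blast)+
  qed
  then have c2: "card (CE \<inter> CN) = 2" "card (CN \<inter> CW) = 2" "card (CW \<inter> CS) = 2" "card (CS \<inter> CE) = 2"
    and disj: "(CE \<inter> CN) \<inter> (CN \<inter> CW) = {}" "(CE \<inter> CN) \<inter> (CW \<inter> CS) = {}" "(CE \<inter> CN) \<inter> (CS \<inter> CE) = {}"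
    "(CN \<inter> CW) \<inter> (CW \<inter> CS) = {}" "(CN \<inter> CW) \<inter> (CS \<inter> CE) = {}" "(CW \<inter> CS) \<inter> (CS \<inter> CE) = {}"
    by blast+
  have c0: "m \<noteq> E" "m \<noteq> N" "m \<noteq> W" "m \<noteq> S"
  proof -
    \<comment> \<open>If C0 were CE, then p2 would lie in both \<open>CE \<inter> CN\<close> and
      \<open>CN \<inter> CW\<close>, which are disjoint. The other three cases are
      analogous.\<close>
    have "C0 \<noteq> CE" using p disj by blast
    then show "m \<noteq> E" using concentric_eqI[OF cen(1), of CE p1] cen(2) p by blast
    have "C0 \<noteq> CN" using p disj by blast
    then show "m \<noteq> N" using concentric_eqI[OF cen(1), of CN p1] cen(3) p by blast
    have "C0 \<noteq> CW" using p disj by blast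
    then show "m \<noteq> W" using concentric_eqI[OF cen(1), of CW p2] cen(4) p by blast
    have "C0 \<noteq> CS" using p disj by blast
    then show "m \<noteq> S" using concentric_eqI[OF cen(1), of CS p3] cen(5) p by blast
  qed
  obtain q1 where q1: "CE \<inter> CN = {p1, q1}" "q1 \<noteq> p1" using card_two_other[OF c2(1), of p1] p by blast
  obtain q2 where q2: "CN \<inter> CW = {p2, q2}" "q2 \<noteq> p2" using card_two_other[OF c2(2), of p2] p by blast
  obtain q3 where q3: "CW \<inter> CS = {p3, q3}" "q3 \<noteq> p3" using card_two_other[OF c2(3), of p3] p by blast
  obtain q4 where q4: "CS \<inter> CE = {p4, q4}" "q4 \<noteq> p4" using card_two_other[OF c2(4), of p4] p by blast
  have qm: "q1 \<in> CE \<inter> CN" "q2 \<in> CN \<inter> CW" "q3 \<in> CW \<inter> CS" "q4 \<in> CS \<inter> CE"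
    using q1 q2 q3 q4 by blast+
  have pne: "p4 \<noteq> p1" "p1 \<noteq> p2" "p2 \<noteq> p3" "p3 \<noteq> p4" using disj p by blast+
  have qq: "q1 \<noteq> q2" "q1 \<noteq> q3" "q2 \<noteq> q3" using disj qm by blast+
  have pq: "p2 \<noteq> q1" "p3 \<noteq> q2" "p4 \<noteq> q3" "p1 \<noteq> q4" using disj p qm by blast+
  have q0: "q1 \<notin> C0" "q2 \<notin> C0" "q3 \<notin> C0" "q4 \<notin> C0"
  proof -
    show "q1 \<notin> C0"
      by (rule other_point_not_on_circle[OF cen(1,3) c0(2) _ _ pne(2) q1(2)[symmetric] pq(1)]) (use p qm in blast)+
    show "q2 \<notin> C0"
      by (rule other_point_not_on_circle[OF cen(1,4) c0(3) _ _ pne(3) q2(2)[symmetric] pq(2)]) (use p qm in blast)+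
    show "q3 \<notin> C0"
      by (rule other_point_not_on_circle[OF cen(1,5) c0(4) _ _ pne(4) q3(2)[symmetric] pq(3)]) (use p qm in blast)+
    show "q4 \<notin> C0"
      by (rule other_point_not_on_circle[OF cen(1,2) c0(1) _ _ pne(1) q4(2)[symmetric] pq(4)]) (use p qm in blast)+
  qed
  obtain r0 where r0: "r0 > 0" "C0 = Some ` {x. cmod (x - m) = r0}" using is_centerD[OF cen(1)] by blast
  obtain rE where rE: "CE = Some ` {x. cmod (x - E) = rE}" using is_centerD[OF cen(2)] by blast
  obtain rN where rN: "CN = Some ` {x. cmod (x - N) = rN}" using is_centerD[OF cen(3)] by blast
  obtain rW where rW: "CW = Some ` {x. cmod (x - W) = rW}" using is_centerD[OF cen(4)] by blast
  obtain rS where rS: "CS = Some ` {x. cmod (x - S) = rS}" using is_centerD[OF cen(5)] by blast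
  obtain u1 u2 u3 u4 where u: "p1 = Some u1" "p2 = Some u2" "p3 = Some u3" "p4 = Some u4"
    using p r0(2) by blast
  obtain x1 x2 x3 where x: "q1 = Some x1" "q2 = Some x2" "q3 = Some x3"
    using qm(1-3) unfolding rE rN rW by blast
  define f where "f = (\<lambda>c p x. (cmod (x - c))\<^sup>2 - (cmod (p - c))\<^sup>2)"
  have on: "cmod (u1 - m) = r0" "cmod (u2 - m) = r0" "cmod (u3 - m) = r0" "cmod (u4 - m) = r0"
    "cmod (u1 - E) = rE" "cmod (u4 - E) = rE" "cmod (u1 - N) = rN" "cmod (u2 - N) = rN"
    "cmod (u2 - W) = rW" "cmod (u3 - W) = rW" "cmod (u3 - S) = rS" "cmod (u4 - S) = rS"
    using p unfolding u r0(2) rE rN rW rS by blast+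
  have tr: "cmod (x - m - (c - m)) = cmod (x - c)" for x c by simp
  have "\<exists>R g :: real. R \<noteq> 0 \<and> (E - m) * (W - m) = of_real R * ((N - m) * (S - m)) \<and>
      (\<forall>x. (f (E - m) (u4 - m) x - f 0 (u1 - m) x) * (f (W - m) (u2 - m) x - f 0 (u1 - m) x)
        - R * ((f (N - m) (u1 - m) x - f 0 (u1 - m) x) * (f (S - m) (u3 - m) x - f 0 (u1 - m) x))
        = g * f 0 (u1 - m) x)"
    unfolding f_def
  proof (rule conics_through_four_concyclic_points[OF on(1-4) r0(1), of "E - m" "N - m" "W - m" "S - m"])
    show "u4 - m \<noteq> u1 - m" "u1 - m \<noteq> u2 - m" "u2 - m \<noteq> u3 - m" "u3 - m \<noteq> u4 - m"
      using pne unfolding u by simp_all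
    show "cmod (u4 - m - (E - m)) = cmod (u1 - m - (E - m))" "cmod (u1 - m - (N - m)) = cmod (u2 - m - (N - m))"
      "cmod (u2 - m - (W - m)) = cmod (u3 - m - (W - m))" "cmod (u3 - m - (S - m)) = cmod (u4 - m - (S - m))"
      unfolding tr on by simp_all
    show "E - m \<noteq> 0" "N - m \<noteq> 0" "W - m \<noteq> 0" "S - m \<noteq> 0" using c0 by simp_all
  qed
  then obtain R g :: real where R: "R \<noteq> 0" "(E - m) * (W - m) = of_real R * ((N - m) * (S - m))"
    and pencil: "\<And>x. (f (E - m) (u4 - m) x - f 0 (u1 - m) x) * (f (W - m) (u2 - m) x - f 0 (u1 - m) x)
        - R * ((f (N - m) (u1 - m) x - f 0 (u1 - m) x) * (f (S - m) (u3 - m) x - f 0 (u1 - m) x))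
        = g * f 0 (u1 - m) x"
    by blast
  have ftr: "f (c - m) (p - m) (x - m) = f c p x" "f 0 (p - m) (x - m) = f m p x" for c p x
    by (simp_all add: f_def)
  have conic: "(f E u4 x - f m u1 x) * (f W u2 x - f m u1 x) - R * ((f N u1 x - f m u1 x) * (f S u3 x - f m u1 x))
        = g * f m u1 x" for x
    using pencil[of "x - m"] unfolding ftr .
  define M where "M = (E - m) + (W - m) - of_real R * ((N - m) + (S - m))"
  \<comment> \<open>Off C0, at a common point of two consecutive neighbours, the conic identity
    divided by \<open>f m u1 x\<close> becomes an affine equation in the other two differences.
    \<open>L\<close> is one expression that reduces to this equation, up to sign, in all four cases;
    its quadratic part is \<open>1 - R\<close> times that of a power function.\<close>
  define L where "L = (\<lambda>x. (f E u4 x - f m u1 x) + (f W u2 x - f m u1 x)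
      - R * ((f N u1 x - f m u1 x) + (f S u3 x - f m u1 x)) + (1 - R) * f m u1 x + g)"
  have L: "L x = (1 - R) * (cmod (x - m))\<^sup>2 - 2 * Re (cnj M * (x - m)) + L m" for x
    unfolding L_def f_def M_def cmod_power2 by (simp add: power2_eq_square algebra_simps)
  have vanish: "L x = 0" if "Some x \<in> ?U - C0" for x
  proof -
    have "f m u1 x \<noteq> 0" using that r0 on(1) by (auto simp: f_def)
    moreover have "(f E u4 x = 0 \<and> f N u1 x = 0) \<or> (f N u1 x = 0 \<and> f W u2 x = 0) \<or>
        (f W u2 x = 0 \<and> f S u3 x = 0) \<or> (f S u3 x = 0 \<and> f E u4 x = 0)"
    proof -
      have "(cmod (x - E) = rE \<and> cmod (x - N) = rN) \<or> (cmod (x - N) = rN \<and> cmod (x - W) = rW) \<or>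
          (cmod (x - W) = rW \<and> cmod (x - S) = rS) \<or> (cmod (x - S) = rS \<and> cmod (x - E) = rE)"
        using that unfolding rE rN rW rS by blast
      then show ?thesis unfolding f_def on by auto
    qed
    ultimately have "f m u1 x * L x = 0"
      using conic[of x] unfolding L_def by (elim disjE conjE) (simp_all add: algebra_simps)
    with \<open>f m u1 x \<noteq> 0\<close> show ?thesis by simp
  qed
  have mem: "{q1, q2, q3, q4} \<subseteq> ?U - C0" using q0 q1 q2 q3 q4 by blast
  have Lq: "L x1 = 0" "L x2 = 0" "L x3 = 0" by (rule vanish; use mem[unfolded x] in blast)+
  \<comment> \<open>With R = 1 and M = 0 the pairs E, W and N, S would have equal sums and equal
    products relative to m, so E would be N or S.\<close>
  have nd: "M \<noteq> 0" if "R = 1"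
  proof
    assume "M = 0"
    moreover have "M = (E - m) + (W - m) - ((N - m) + (S - m))" using that by (simp add: M_def)
    ultimately have "(E - m) + (W - m) = (N - m) + (S - m)" by (metis eq_iff_diff_eq_0)
    moreover have "(E - m) * (W - m) = (N - m) * (S - m)" using R that by simp
    ultimately have "(E - N) * (E - S) = 0" by algebra
    with ne show False by auto
  qed
  have "\<exists>d. is_circle d \<and> (\<forall>x. L x = 0 \<longrightarrow> Some x \<in> d) \<and>
    (\<forall>z. is_center z d \<longrightarrow> R \<noteq> 1 \<and> z = m + M / (1 - of_real R))"
  proof (rule real_circle_equation[of R x1 m M "L m" x2 x3, folded L])
    show "x1 \<noteq> x2" "x1 \<noteq> x3" "x2 \<noteq> x3" using qq unfolding x by simp_all
  qed (use Lq nd in simp_all)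
  then obtain d where d: "is_circle d" "\<And>x. L x = 0 \<Longrightarrow> Some x \<in> d"
    "\<And>z. is_center z d \<Longrightarrow> R \<noteq> 1 \<and> z = m + M / (1 - of_real R)"
    by blast
  have sub: "?U - C0 \<subseteq> d"
  proof
    fix y assume y: "y \<in> ?U - C0"
    then obtain x where "y = Some x" using rE rN rW rS by blast
    then show "y \<in> d" using d(2) vanish[of x] y by blast
  qed
  have "D = d" unfolding D_def
  proof (rule the_equality)
    show "is_circle d \<and> ?U - C0 \<subseteq> d" using d sub by blast
  next
    fix d' assume d': "is_circle d' \<and> ?U - C0 \<subseteq> d'"
    show "d' = d"
    proof (rule unique_circle[of d' d x1 x2 x3])
      show "is_circle d'" "is_circle d" using d d' by blast+
      show "{Some x1, Some x2, Some x3} \<subseteq> d'" "{Some x1, Some x2, Some x3} \<subseteq> d"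
        using d' sub mem unfolding x by blast+
      show "x1 \<noteq> x2" "x1 \<noteq> x3" "x2 \<noteq> x3" using qq unfolding x by simp_all
    qed
  qed
  then have zR: "R \<noteq> 1" "z = m + M / (1 - of_real R)" using d(3) z by auto
  have R1: "1 - complex_of_real R \<noteq> 0" using zR(1) by (simp add: complex_eq_iff)
  have zm: "(z - m) * (1 - of_real R) = M" using zR(2) R1 by simp
  \<comment> \<open>Multiplying \<open>(z - m) * (1 - R) = M\<close> by (N - m)(S - m) eliminates R
    and yields the recurrence.\<close>
  have Q: "(N - m) * (S - m) - (E - m) * (W - m) = (N - m) * (S - m) * (1 - of_real R)"
    unfolding R(2) by (simp add: algebra_simps)
  have "(N - m) * (S - m) - (E - m) * (W - m) \<noteq> 0" unfolding Q using R1 c0 by simp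
  moreover have "(z - m) * ((N - m) * (S - m) - (E - m) * (W - m)) = (N - m) * (S - m) * M"
    unfolding Q using zm by (simp add: mult_ac)
  moreover have "(N - m) * (S - m) * M =
      (N - m) * (S - m) * ((E - m) + (W - m)) - (E - m) * (W - m) * ((N - m) + (S - m))"
    unfolding M_def R(2) by (simp add: algebra_simps)
  ultimately show "dskp m E N W S z" unfolding dskp_def using ne by simp
  have qD: "q1 \<in> D" "q2 \<in> D" "q3 \<in> D" "q4 \<in> D" using mem sub unfolding \<open>D = d\<close> by blast+
  show "\<exists>q. CE \<inter> CN = {p1, q} \<and> q \<noteq> p1 \<and> q \<in> D" using q1 qD by blast
  show "\<exists>q. CN \<inter> CW = {p2, q} \<and> q \<noteq> p2 \<and> q \<in> D" using q2 qD by blast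
  show "\<exists>q. CW \<inter> CS = {p3, q} \<and> q \<noteq> p3 \<and> q \<in> D" using q3 qD by blast
  show "\<exists>q. CS \<inter> CE = {p4, q} \<and> q \<noteq> p4 \<and> q \<in> D" using q4 qD by blast
qed

section \<open>Circle patterns under Miquel dynamics\<close>

lemma center_unique:
  assumes "is_center z C" "is_center z' C"
  shows "z = z'"
  using card_circle_Int_le[OF assms] infinite_circle[OF assms(1)] by auto

lemma center_eq: "is_center z C \<Longrightarrow> center C = z"
  unfolding center_def using center_unique by blast

lemma is_center_center: "\<exists>z. is_center z C \<Longrightarrow> is_center (center C) C"
  using center_eq by blast

lemma miquel_at_face:
  assumes pat: "circle_pattern p b"
    and cen: "\<And>f. \<exists>z. is_center z (b f)"
    and card: "card (neighbour_points b (x, y)) = 8"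
    and z: "is_center z (sixth_circle b (x, y))"
  shows "dskp (center (b (x, y))) (center (b (x + 1, y))) (center (b (x, y + 1)))
      (center (b (x - 1, y))) (center (b (x, y - 1))) z"
    and "\<exists>q. b (x + 1, y) \<inter> b (x, y + 1) = {p (x + 1, y + 1), q} \<and> q \<noteq> p (x + 1, y + 1) \<and> q \<in> sixth_circle b (x, y)"
    and "\<exists>q. b (x, y + 1) \<inter> b (x - 1, y) = {p (x, y + 1), q} \<and> q \<noteq> p (x, y + 1) \<and> q \<in> sixth_circle b (x, y)"
    and "\<exists>q. b (x - 1, y) \<inter> b (x, y - 1) = {p (x, y), q} \<and> q \<noteq> p (x, y) \<and> q \<in> sixth_circle b (x, y)"
    and "\<exists>q. b (x, y - 1) \<inter> b (x + 1, y) = {p (x + 1, y), q} \<and> q \<noteq> p (x + 1, y) \<and> q \<in> sixth_circle b (x, y)"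
proof -
  note c = is_center_center[OF cen]
  have on: "p v \<in> b f" if "v \<in> corners f" for v f
    using pat that unfolding circle_pattern_def by blast
  have p1: "p (x + 1, y + 1) \<in> b (x, y) \<inter> (b (x + 1, y) \<inter> b (x, y + 1))"
    by (intro IntI on) (simp_all add: corners_def)
  have p2: "p (x, y + 1) \<in> b (x, y) \<inter> (b (x, y + 1) \<inter> b (x - 1, y))"
    by (intro IntI on) (simp_all add: corners_def)
  have p3: "p (x, y) \<in> b (x, y) \<inter> (b (x - 1, y) \<inter> b (x, y - 1))"
    by (intro IntI on) (simp_all add: corners_def)
  have p4: "p (x + 1, y) \<in> b (x, y) \<inter> (b (x, y - 1) \<inter> b (x + 1, y))"
    by (intro IntI on) (simp_all add: corners_def)
  note m = miquel_theorem[OF c c c c c p1 p2 p3 p4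
      card[unfolded neighbour_points_def case_prod_conv]]
  have six: "sixth_circle b (x, y) = (THE d. is_circle d \<and> (b (x + 1, y) \<inter> b (x, y + 1) \<union>
      b (x, y + 1) \<inter> b (x - 1, y) \<union> b (x - 1, y) \<inter> b (x, y - 1) \<union>
      b (x, y - 1) \<inter> b (x + 1, y)) - b (x, y) \<subseteq> d)"
    by (simp add: sixth_circle_def neighbour_points_def)
  note m' = m[folded six, OF z]
  from m' show "dskp (center (b (x, y))) (center (b (x + 1, y))) (center (b (x, y + 1)))
      (center (b (x - 1, y))) (center (b (x, y - 1))) z"
    and "\<exists>q. b (x + 1, y) \<inter> b (x, y + 1) = {p (x + 1, y + 1), q} \<and> q \<noteq> p (x + 1, y + 1) \<and> q \<in> sixth_circle b (x, y)"
    and "\<exists>q. b (x, y + 1) \<inter> b (x - 1, y) = {p (x, y + 1), q} \<and> q \<noteq> p (x, y + 1) \<and> q \<in> sixth_circle b (x, y)"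
    and "\<exists>q. b (x - 1, y) \<inter> b (x, y - 1) = {p (x, y), q} \<and> q \<noteq> p (x, y) \<and> q \<in> sixth_circle b (x, y)"
    and "\<exists>q. b (x, y - 1) \<inter> b (x + 1, y) = {p (x + 1, y), q} \<and> q \<noteq> p (x + 1, y) \<and> q \<in> sixth_circle b (x, y)"
    by blast+
qed

lemma updated_neighbours:
  "updated k (x + 1, y) = (\<not> updated k (x, y))" "updated k (x, y + 1) = (\<not> updated k (x, y))"
  "updated k (x - 1, y) = (\<not> updated k (x, y))" "updated k (x, y - 1) = (\<not> updated k (x, y))"
  by (auto simp: updated_def)

text \<open>Around a vertex two opposite circles are kept and the other two are replaced. The kept
  ones meet in the old point and in one further point q; Miquel's theorem at each of the two
  replaced faces puts q on the new circle there. So q is the new point of the pattern.\<close>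

lemma miquel_pattern:
  assumes pat: "circle_pattern p c" and def: "miquel_defined k c" and "m \<le> k"
  shows "\<exists>p. circle_pattern p (miquel m c)"
  using \<open>m \<le> k\<close>
proof (induction m)
  case 0
  then show ?case using pat by auto
next
  case (Suc m)
  define b where "b = miquel m c"
  define b' where "b' = miquel (Suc m) c"
  obtain p where p: "circle_pattern p b" using Suc unfolding b_def by auto
  have cen: "\<exists>z. is_center z (b f)" and cen': "\<exists>z. is_center z (b' f)" for f
    using def Suc.prems unfolding miquel_defined_def b_def b'_def by (meson Suc_leD)+
  have card: "card (neighbour_points b f) = 8" if "updated (Suc m) f" for f
    using def Suc.prems that unfolding miquel_defined_def b_def by (meson Suc_le_lessD)
  have upd: "b' f = sixth_circle b f" if "updated (Suc m) f" for f
    using that by (simp add: b_def b'_def)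
  have nupd: "b' f = b f" if "\<not> updated (Suc m) f" for f
    using that by (simp add: b_def b'_def)
  have six: "is_center (center (b' (x, y))) (sixth_circle b (x, y))" if "updated (Suc m) (x, y)" for x y
    using is_center_center[OF cen'] upd[OF that] by metis
  have "\<exists>q. \<forall>f. v \<in> corners f \<longrightarrow> q \<in> b' f" for v
  proof -
    obtain x y where v: "v = (x, y)" by (cases v)
    have around: "f \<in> {(x, y), (x - 1, y), (x - 1, y - 1), (x, y - 1)}" if "v \<in> corners f" for f
      using that unfolding v corners_def by auto
    show ?thesis
    proof (cases "updated (Suc m) (x, y)")
      case True
      then have u: "updated (Suc m) (x, y)" "updated (Suc m) (x - 1, y - 1)"
        "\<not> updated (Suc m) (x - 1, y)" "\<not> updated (Suc m) (x, y - 1)"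
        by (simp_all add: updated_neighbours)
      obtain q where q: "b (x - 1, y) \<inter> b (x, y - 1) = {p (x, y), q}" "q \<noteq> p (x, y)" "q \<in> b' (x, y)"
        using miquel_at_face(4)[OF p cen card[OF u(1)] six[OF u(1)]] upd[OF u(1)] by auto
      obtain q' where q': "b (x, y - 1) \<inter> b (x - 1, y) = {p (x, y), q'}" "q' \<noteq> p (x, y)" "q' \<in> b' (x - 1, y - 1)"
        using miquel_at_face(2)[OF p cen card[OF u(2)] six[OF u(2)]] upd[OF u(2)] by auto
      have "q' = q" using q q' by blast
      moreover have "q \<in> b' (x - 1, y)" "q \<in> b' (x, y - 1)" using q nupd u by auto
      ultimately show ?thesis using q q' around by blast
    next
      case False
      then have u: "\<not> updated (Suc m) (x, y)" "\<not> updated (Suc m) (x - 1, y - 1)"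
        "updated (Suc m) (x - 1, y)" "updated (Suc m) (x, y - 1)"
        by (simp_all add: updated_neighbours)
      obtain q where q: "b (x - 1, y - 1) \<inter> b (x, y) = {p (x, y), q}" "q \<noteq> p (x, y)" "q \<in> b' (x - 1, y)"
        using miquel_at_face(5)[OF p cen card[OF u(3)] six[OF u(3)]] upd[OF u(3)] by auto
      obtain q' where q': "b (x, y) \<inter> b (x - 1, y - 1) = {p (x, y), q'}" "q' \<noteq> p (x, y)" "q' \<in> b' (x, y - 1)"
        using miquel_at_face(3)[OF p cen card[OF u(4)] six[OF u(4)]] upd[OF u(4)] by auto
      have "q' = q" using q q' by blast
      moreover have "q \<in> b' (x, y)" "q \<in> b' (x - 1, y - 1)" using q nupd u by auto
      ultimately show ?thesis using q q' around by blast
    qed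
  qed
  then obtain p' where "\<And>v f. v \<in> corners f \<Longrightarrow> p' v \<in> b' f" by metis
  then have "circle_pattern p' b'"
    using cen' unfolding circle_pattern_def is_circle_def by blast
  then show ?case unfolding b'_def by blast
qed

lemma miquel_centers_dskp:
  assumes pat: "circle_pattern p c" and def: "miquel_defined k c" and "m < k"
    and u: "updated (Suc m) (x, y)"
  defines "\<tau> \<equiv> \<lambda>m f. center (miquel m c f)"
  shows "dskp (\<tau> m (x, y)) (\<tau> m (x + 1, y)) (\<tau> m (x, y + 1)) (\<tau> m (x - 1, y)) (\<tau> m (x, y - 1))
    (\<tau> (Suc m) (x, y))"
proof -
  obtain p where p: "circle_pattern p (miquel m c)"
    using miquel_pattern[OF pat def, of m] \<open>m < k\<close> by auto
  have cen: "\<exists>z. is_center z (miquel m c f)" and cen': "\<exists>z. is_center z (miquel (Suc m) c f)" for f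
    using def \<open>m < k\<close> unfolding miquel_defined_def by (meson less_imp_le Suc_leI)+
  have card: "card (neighbour_points (miquel m c) (x, y)) = 8"
    using def u \<open>m < k\<close> unfolding miquel_defined_def by simp
  have six: "is_center (\<tau> (Suc m) (x, y)) (sixth_circle (miquel m c) (x, y))"
    using is_center_center[OF cen', of "(x, y)"] u by (simp add: \<tau>_def)
  show ?thesis using miquel_at_face(1)[OF p cen card six] unfolding \<tau>_def .
qed

section \<open>Matching sums and urban renewal\<close>

text \<open>A condition on degrees rather than on unique existence, because degrees add up over
  disjoint sets of edges. It also makes the degree zero outside V.\<close>

definition covers :: "('v \<times> 'v) set \<Rightarrow> 'v set \<Rightarrow> bool" where
  "covers N V \<longleftrightarrow> (\<forall>v. card {e \<in> N. v = fst e \<or> v = snd e} = of_bool (v \<in> V))"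

definition matching_sum :: "('v \<times> 'v) set \<Rightarrow> 'v set \<Rightarrow> ('v \<times> 'v \<Rightarrow> complex) \<Rightarrow> complex" where
  "matching_sum E V w = (\<Sum>N\<in>{N. N \<subseteq> E \<and> covers N V}. \<Prod>e\<in>N. w e)"

lemma coversD:
  assumes "covers N V" "v \<in> V"
  shows "\<exists>!e. e \<in> N \<and> (v = fst e \<or> v = snd e)"
proof -
  have "card {e \<in> N. v = fst e \<or> v = snd e} = 1" using assms by (simp add: covers_def)
  then obtain e where "{e \<in> N. v = fst e \<or> v = snd e} = {e}" by (meson card_1_singletonE)
  then have "e' \<in> N \<and> (v = fst e' \<or> v = snd e') \<longleftrightarrow> e' = e" for e' by blast
  then show ?thesis by metis
qed

lemma coversD2:
  assumes "covers N V" "finite N" "e \<in> N"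
  shows "fst e \<in> V" "snd e \<in> V"
proof -
  have "v \<in> V" if "v = fst e \<or> v = snd e" for v
  proof (rule ccontr)
    assume "v \<notin> V"
    then have "card {e \<in> N. v = fst e \<or> v = snd e} = 0" using assms(1) by (simp add: covers_def)
    then have "{e \<in> N. v = fst e \<or> v = snd e} = {}" using assms(2) by simp
    then show False using that assms(3) by blast
  qed
  then show "fst e \<in> V" "snd e \<in> V" by auto
qed

lemma covers_mem_iff:
  assumes "covers N V" "finite N"
  shows "v \<in> V \<longleftrightarrow> {e \<in> N. v = fst e \<or> v = snd e} \<noteq> {}"
proof -
  have "v \<in> V \<longleftrightarrow> card {e \<in> N. v = fst e \<or> v = snd e} \<noteq> 0"
    using assms(1) by (simp add: covers_def)
  also have "\<dots> \<longleftrightarrow> {e \<in> N. v = fst e \<or> v = snd e} \<noteq> {}" using assms(2) by simp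
  finally show ?thesis .
qed

lemma covers_iff:
  assumes "finite N"
  shows "covers N V \<longleftrightarrow> (\<forall>e\<in>N. fst e \<in> V \<and> snd e \<in> V) \<and> (\<forall>v\<in>V. \<exists>!e. e \<in> N \<and> (v = fst e \<or> v = snd e))"
proof
  assume "covers N V"
  then show "(\<forall>e\<in>N. fst e \<in> V \<and> snd e \<in> V) \<and> (\<forall>v\<in>V. \<exists>!e. e \<in> N \<and> (v = fst e \<or> v = snd e))"
    using coversD[of N V] coversD2[of N V] assms by simp
next
  assume h: "(\<forall>e\<in>N. fst e \<in> V \<and> snd e \<in> V) \<and> (\<forall>v\<in>V. \<exists>!e. e \<in> N \<and> (v = fst e \<or> v = snd e))"
  show "covers N V" unfolding covers_def
  proof
    fix v
    show "card {e \<in> N. v = fst e \<or> v = snd e} = of_bool (v \<in> V)"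
    proof (cases "v \<in> V")
      case True
      then obtain e where "e \<in> N \<and> (v = fst e \<or> v = snd e)"
        "\<And>e'. e' \<in> N \<and> (v = fst e' \<or> v = snd e') \<Longrightarrow> e' = e" using h by blast
      then have "{e \<in> N. v = fst e \<or> v = snd e} = {e}" by blast
      then show ?thesis using True by simp
    next
      case False
      then have "{e \<in> N. v = fst e \<or> v = snd e} = {}" using h by blast
      then have "card {e \<in> N. v = fst e \<or> v = snd e} = 0" by (simp only: card.empty)
      then show ?thesis using False by (simp only: of_bool_def if_False)
    qed
  qed
qed

text \<open>Each vertex of V is an end of exactly one edge of a matching, so the endpoint factors
  multiply to the product over V, independently of the matching.\<close>

lemma matching_sum_gauge:
  assumes "finite E" "\<And>e. e \<in> E \<Longrightarrow> fst e \<noteq> snd e" "finite V"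
  shows "matching_sum E V (\<lambda>e. h (fst e) * h (snd e) * w e) = (\<Prod>v\<in>V. h v) * matching_sum E V w"
  unfolding matching_sum_def sum_distrib_left
proof (rule sum.cong[OF refl])
  fix N assume "N \<in> {N. N \<subseteq> E \<and> covers N V}"
  then have N: "N \<subseteq> E" "covers N V" "finite N" using assms finite_subset by auto
  have "(\<Prod>e\<in>N. h (fst e) * h (snd e)) = (\<Prod>e\<in>N. \<Prod>v\<in>{fst e, snd e}. h v)"
    using N(1) assms(2) by (intro prod.cong) auto
  also have "\<dots> = (\<Prod>v\<in>(\<Union>e\<in>N. {fst e, snd e}). h v)"
  proof (rule prod.UNION_disjoint[symmetric])
    show "\<forall>i\<in>N. \<forall>j\<in>N. i \<noteq> j \<longrightarrow> {fst i, snd i} \<inter> {fst j, snd j} = {}"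
    proof (intro ballI impI, rule ccontr)
      fix i j assume ij: "i \<in> N" "j \<in> N" "i \<noteq> j" "{fst i, snd i} \<inter> {fst j, snd j} \<noteq> {}"
      then obtain v where v: "v = fst i \<or> v = snd i" "v = fst j \<or> v = snd j" by blast
      then have "v \<in> V" using coversD2[OF N(2,3) ij(1)] by auto
      from coversD[OF N(2) this] show False using ij v by blast
    qed
  qed (use N in auto)
  also have "(\<Union>e\<in>N. {fst e, snd e}) = V"
    using covers_mem_iff[OF N(2,3)] by blast
  finally show "(\<Prod>e\<in>N. h (fst e) * h (snd e) * w e) = (\<Prod>v\<in>V. h v) * (\<Prod>e\<in>N. w e)"
    by (simp add: prod.distrib)
qed

text \<open>A matching splits into its restrictions to the cells; only the sets of vertices that they
  cover have to be compatible.\<close>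

lemma matching_sum_cells:
  fixes Ec :: "'c \<Rightarrow> ('v \<times> 'v) set" and K :: "'c \<Rightarrow> 'v set"
  assumes C: "finite C" and fin: "\<And>c. c \<in> C \<Longrightarrow> finite (Ec c)"
    and disj: "\<And>c d. c \<in> C \<Longrightarrow> d \<in> C \<Longrightarrow> c \<noteq> d \<Longrightarrow> Ec c \<inter> Ec d = {}"
    and K: "\<And>c e. c \<in> C \<Longrightarrow> e \<in> Ec c \<Longrightarrow> fst e \<in> K c \<and> snd e \<in> K c"
    and finK: "\<And>c. c \<in> C \<Longrightarrow> finite (K c)"
  shows "matching_sum (\<Union>c\<in>C. Ec c) V w =
    (\<Sum>S\<in>{S \<in> PiE C (\<lambda>c. Pow (K c)). \<forall>v. (\<Sum>c\<in>C. of_bool (v \<in> S c)) = (of_bool (v \<in> V) :: nat)}.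
       \<Prod>c\<in>C. matching_sum (Ec c) (S c) w)"
proof -
  let ?SS = "{S \<in> PiE C (\<lambda>c. Pow (K c)). \<forall>v. (\<Sum>c\<in>C. of_bool (v \<in> S c)) = (of_bool (v \<in> V) :: nat)}"
  let ?X = "\<lambda>S. PiE C (\<lambda>c. {X. X \<subseteq> Ec c \<and> covers X (S c)})"
  let ?D = "\<lambda>N v. {e \<in> N. v = fst e \<or> v = snd e}"
  have finSS: "finite ?SS" using C finK by (intro finite_subset[OF _ finite_PiE[of C "\<lambda>c. Pow (K c)"]]) auto
  have finX: "finite (?X S)" for S
  proof (rule finite_PiE[OF C])
    show "finite {X. X \<subseteq> Ec c \<and> covers X (S c)}" if "c \<in> C" for c
      by (rule finite_subset[of _ "Pow (Ec c)"]) (use fin[OF that] in auto)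
  qed
  have deg: "card (?D N v) = (\<Sum>c\<in>C. card (?D (N \<inter> Ec c) v))" if "N \<subseteq> (\<Union>c\<in>C. Ec c)" for N v
  proof -
    have "?D N v = (\<Union>c\<in>C. ?D (N \<inter> Ec c) v)" using that by auto
    also have "card \<dots> = (\<Sum>c\<in>C. card (?D (N \<inter> Ec c) v))"
    proof (intro card_UN_disjoint ballI impI)
      show "?D (N \<inter> Ec c) v \<inter> ?D (N \<inter> Ec d) v = {}" if "c \<in> C" "d \<in> C" "c \<noteq> d" for c d
        using disj[OF that] by blast
    qed (use C fin in auto)
    finally show ?thesis .
  qed
  have "(\<Sum>S\<in>?SS. \<Prod>c\<in>C. matching_sum (Ec c) (S c) w) = (\<Sum>S\<in>?SS. \<Sum>X\<in>?X S. \<Prod>c\<in>C. \<Prod>e\<in>X c. w e)"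
    unfolding matching_sum_def using C fin by (intro sum.cong refl prod_sum_PiE) auto
  also have "\<dots> = (\<Sum>(S, X)\<in>Sigma ?SS ?X. \<Prod>c\<in>C. \<Prod>e\<in>X c. w e)"
    using finSS finX by (subst sum.Sigma) auto
  also have "\<dots> = (\<Sum>N\<in>{N. N \<subseteq> (\<Union>c\<in>C. Ec c) \<and> covers N V}. \<Prod>e\<in>N. w e)"
  \<comment> \<open>The family S is determined by X: \<open>S c\<close> consists of the vertices
    that \<open>X c\<close> touches. The inverse map recovers it in this way, with restrictions that
    keep both functions extensional as \<open>PiE\<close> demands.\<close>
  proof (rule sum.reindex_bij_witness[where
      j = "\<lambda>(S, X). \<Union>c\<in>C. X c" and
      i = "\<lambda>N. (\<lambda>c\<in>C. {v \<in> K c. ?D (N \<inter> Ec c) v \<noteq> {}}, \<lambda>c\<in>C. N \<inter> Ec c)"])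
    fix p assume "p \<in> Sigma ?SS ?X"
    then obtain S X where p: "p = (S, X)" and S: "S \<in> PiE C (\<lambda>c. Pow (K c))"
      and SV: "\<And>v. (\<Sum>c\<in>C. of_bool (v \<in> S c)) = (of_bool (v \<in> V) :: nat)"
      and X: "X \<in> ?X S" by auto
    have XE: "X c \<subseteq> Ec c" "covers (X c) (S c)" "finite (X c)" if "c \<in> C" for c
      using X that fin[OF that] by (auto intro: finite_subset)
    have int: "(\<Union>c\<in>C. X c) \<inter> Ec d = X d" if "d \<in> C" for d
      using XE(1) disj that by blast
    have SX: "S c = {v \<in> K c. ?D (X c) v \<noteq> {}}" if "c \<in> C" for c
    proof -
      have "v \<in> S c \<longleftrightarrow> ?D (X c) v \<noteq> {}" for v
        by (rule covers_mem_iff[OF XE(2)[OF that] XE(3)[OF that]])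
      moreover have "S c \<subseteq> K c" using S that by auto
      ultimately show ?thesis by blast
    qed
    have "(\<lambda>c\<in>C. {v \<in> K c. ?D ((\<Union>c\<in>C. X c) \<inter> Ec c) v \<noteq> {}}) = S"
    proof (rule extensionalityI[of _ C])
      show "S \<in> extensional C" using S by (simp add: PiE_iff)
      show "(\<lambda>c\<in>C. {v \<in> K c. ?D ((\<Union>c\<in>C. X c) \<inter> Ec c) v \<noteq> {}}) c = S c" if "c \<in> C" for c
        unfolding restrict_apply int[OF that] SX[OF that] using that by simp
    qed simp
    moreover have "(\<lambda>c\<in>C. (\<Union>c\<in>C. X c) \<inter> Ec c) = X"
    proof (rule extensionalityI[of _ C])
      show "X \<in> extensional C" using X by (simp add: PiE_iff)
      show "(\<lambda>c\<in>C. (\<Union>c\<in>C. X c) \<inter> Ec c) c = X c" if "c \<in> C" for c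
        unfolding restrict_apply int[OF that] using that by simp
    qed simp
    ultimately show "(\<lambda>N. (\<lambda>c\<in>C. {v \<in> K c. ?D (N \<inter> Ec c) v \<noteq> {}}, \<lambda>c\<in>C. N \<inter> Ec c))
        ((\<lambda>(S, X). \<Union>c\<in>C. X c) p) = p"
      unfolding p by simp
    have sub: "(\<Union>c\<in>C. X c) \<subseteq> (\<Union>c\<in>C. Ec c)" using XE by blast
    moreover have "covers (\<Union>c\<in>C. X c) V"
      unfolding covers_def
    proof
      fix v
      have "card (?D (\<Union>c\<in>C. X c) v) = (\<Sum>c\<in>C. card (?D (X c) v))"
        unfolding deg[OF sub] using int by (intro sum.cong) auto
      also have "\<dots> = (\<Sum>c\<in>C. of_bool (v \<in> S c))"
        using XE(2) unfolding covers_def by (intro sum.cong) auto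
      finally show "card (?D (\<Union>c\<in>C. X c) v) = of_bool (v \<in> V)" using SV by simp
    qed
    ultimately show "(\<lambda>(S, X). \<Union>c\<in>C. X c) p \<in> {N. N \<subseteq> (\<Union>c\<in>C. Ec c) \<and> covers N V}"
      unfolding p by simp
    have "(\<Prod>e\<in>(\<Union>c\<in>C. X c). w e) = (\<Prod>c\<in>C. \<Prod>e\<in>X c. w e)"
      using C XE disj by (intro prod.UNION_disjoint) (auto, blast)
    then show "(\<Prod>e\<in>(\<lambda>(S, X). \<Union>c\<in>C. X c) p. w e) = (case p of (S, X) \<Rightarrow> \<Prod>c\<in>C. \<Prod>e\<in>X c. w e)"
      unfolding p by simp
  next
    fix N assume "N \<in> {N. N \<subseteq> (\<Union>c\<in>C. Ec c) \<and> covers N V}"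
    then have N: "N \<subseteq> (\<Union>c\<in>C. Ec c)" "covers N V" by auto
    have "finite (\<Union>c\<in>C. Ec c)" using C fin by blast
    then have finN: "finite N" using N finite_subset by blast
    show "(\<lambda>(S, X). \<Union>c\<in>C. X c) ((\<lambda>c\<in>C. {v \<in> K c. ?D (N \<inter> Ec c) v \<noteq> {}}), (\<lambda>c\<in>C. N \<inter> Ec c)) = N"
      using N by auto
    have le: "card (?D (N \<inter> Ec c) v) \<le> of_bool (v \<in> V)" if "c \<in> C" for c v
    proof -
      have "card (?D (N \<inter> Ec c) v) \<le> card (?D N v)" using finN by (intro card_mono) auto
      then show ?thesis using N(2) unfolding covers_def by metis
    qed
    have one: "card (?D (N \<inter> Ec c) v) = of_bool (v \<in> K c \<and> ?D (N \<inter> Ec c) v \<noteq> {})" if "c \<in> C" for c v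
    proof (cases "?D (N \<inter> Ec c) v = {}")
      case True
      then show ?thesis unfolding True by simp
    next
      case False
      then have "v \<in> K c" using K[OF that] by auto
      have "card (?D (N \<inter> Ec c) v) \<noteq> 0" using False finN by auto
      with le[OF that, of v] have "card (?D (N \<inter> Ec c) v) = 1" by (cases "v \<in> V") auto
      then show ?thesis using False \<open>v \<in> K c\<close> by simp
    qed
    show "((\<lambda>c\<in>C. {v \<in> K c. ?D (N \<inter> Ec c) v \<noteq> {}}), (\<lambda>c\<in>C. N \<inter> Ec c)) \<in> Sigma ?SS ?X"
    proof (intro SigmaI CollectI conjI allI)
      show "(\<lambda>c\<in>C. {v \<in> K c. ?D (N \<inter> Ec c) v \<noteq> {}}) \<in> PiE C (\<lambda>c. Pow (K c))" by auto
      fix v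
      have "(\<Sum>c\<in>C. of_bool (v \<in> (\<lambda>c\<in>C. {v \<in> K c. ?D (N \<inter> Ec c) v \<noteq> {}}) c)) = (\<Sum>c\<in>C. card (?D (N \<inter> Ec c) v))"
        by (intro sum.cong refl) (simp only: one restrict_apply mem_Collect_eq if_True)
      also have "\<dots> = of_bool (v \<in> V)" using N(2) unfolding deg[OF N(1), symmetric] covers_def by blast
      finally show "(\<Sum>c\<in>C. of_bool (v \<in> (\<lambda>c\<in>C. {v \<in> K c. ?D (N \<inter> Ec c) v \<noteq> {}}) c)) = (of_bool (v \<in> V) :: nat)" .
    next
      show "(\<lambda>c\<in>C. N \<inter> Ec c) \<in> ?X (\<lambda>c\<in>C. {v \<in> K c. ?D (N \<inter> Ec c) v \<noteq> {}})"
        using one unfolding covers_def by (intro restrict_PiE_iff[THEN iffD2] ballI) simp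
    qed
  qed
  finally show ?thesis unfolding matching_sum_def by simp
qed

text \<open>By \<open>count\<close>, replacing every \<open>S c\<close> by \<open>K c - S c\<close>
  is a bijection between the families that add up to V and those that add up to V'. Identities in
  single cells therefore combine into one for the whole graph.\<close>

lemma matching_sum_complement:
  fixes Ec :: "'c \<Rightarrow> ('v \<times> 'v) set" and K :: "'c \<Rightarrow> 'v set"
  assumes C: "finite C" and fin: "\<And>c. c \<in> C \<Longrightarrow> finite (Ec c)"
    and disj: "\<And>c d. c \<in> C \<Longrightarrow> d \<in> C \<Longrightarrow> c \<noteq> d \<Longrightarrow> Ec c \<inter> Ec d = {}"
    and K: "\<And>c e. c \<in> C \<Longrightarrow> e \<in> Ec c \<Longrightarrow> fst e \<in> K c \<and> snd e \<in> K c"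
    and finK: "\<And>c. c \<in> C \<Longrightarrow> finite (K c)"
    and count: "\<And>v. (\<Sum>c\<in>C. of_bool (v \<in> K c)) = (of_bool (v \<in> V) + of_bool (v \<in> V') :: nat)"
    and local: "\<And>c S. c \<in> C \<Longrightarrow> S \<subseteq> K c \<Longrightarrow>
      matching_sum (Ec c) S w = \<Delta> c * matching_sum (Ec c) (K c - S) w'"
  shows "matching_sum (\<Union>c\<in>C. Ec c) V w = (\<Prod>c\<in>C. \<Delta> c) * matching_sum (\<Union>c\<in>C. Ec c) V' w'"
proof -
  let ?SS = "\<lambda>V. {S \<in> PiE C (\<lambda>c. Pow (K c)). \<forall>v. (\<Sum>c\<in>C. of_bool (v \<in> S c)) = (of_bool (v \<in> V) :: nat)}"
  let ?c = "\<lambda>S. \<lambda>c\<in>C. K c - S c"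
  have flip: "?c S \<in> ?SS V2" if S: "S \<in> ?SS V1"
    and cnt: "\<And>v. (\<Sum>c\<in>C. of_bool (v \<in> K c)) = (of_bool (v \<in> V1) + of_bool (v \<in> V2) :: nat)" for S V1 V2
  proof (intro CollectI conjI allI)
    show "?c S \<in> PiE C (\<lambda>c. Pow (K c))" by auto
    fix v
    have "(\<Sum>c\<in>C. of_bool (v \<in> ?c S c)) + (\<Sum>c\<in>C. of_bool (v \<in> S c)) = (\<Sum>c\<in>C. of_bool (v \<in> K c) :: nat)"
      unfolding sum.distrib[symmetric] using S by (intro sum.cong) (auto simp: PiE_iff)
    moreover have "(\<Sum>c\<in>C. of_bool (v \<in> S c)) = (of_bool (v \<in> V1) :: nat)" using S by blast
    ultimately show "(\<Sum>c\<in>C. of_bool (v \<in> ?c S c)) = (of_bool (v \<in> V2) :: nat)" using cnt[of v] by linarith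
  qed
  have cc: "?c (?c S) = S" if "S \<in> PiE C (\<lambda>c. Pow (K c))" for S
    using that by (intro extensionalityI[of _ C]) (auto simp: PiE_iff)
  have cnt': "(\<Sum>c\<in>C. of_bool (v \<in> K c)) = (of_bool (v \<in> V') + of_bool (v \<in> V) :: nat)" for v
    using count by simp
  have "matching_sum (\<Union>c\<in>C. Ec c) V w = (\<Sum>S\<in>?SS V. \<Prod>c\<in>C. matching_sum (Ec c) (S c) w)"
    using C fin disj K finK by (rule matching_sum_cells)
  also have "\<dots> = (\<Sum>S\<in>?SS V. (\<Prod>c\<in>C. \<Delta> c) * (\<Prod>c\<in>C. matching_sum (Ec c) (?c S c) w'))"
  proof (rule sum.cong[OF refl])
    fix S assume "S \<in> ?SS V"
    then have "S c \<subseteq> K c" if "c \<in> C" for c using that by (auto simp: PiE_iff)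
    then show "(\<Prod>c\<in>C. matching_sum (Ec c) (S c) w) = (\<Prod>c\<in>C. \<Delta> c) * (\<Prod>c\<in>C. matching_sum (Ec c) (?c S c) w')"
      unfolding prod.distrib[symmetric] by (intro prod.cong refl) (simp add: local)
  qed
  also have "\<dots> = (\<Prod>c\<in>C. \<Delta> c) * (\<Sum>S\<in>?SS V. \<Prod>c\<in>C. matching_sum (Ec c) (?c S c) w')"
    by (rule sum_distrib_left[symmetric])
  also have "(\<Sum>S\<in>?SS V. \<Prod>c\<in>C. matching_sum (Ec c) (?c S c) w') = (\<Sum>S\<in>?SS V'. \<Prod>c\<in>C. matching_sum (Ec c) (S c) w')"
  proof (rule sum.reindex_bij_witness[where i = ?c and j = ?c])
    show "?c (?c S) = S" "?c S \<in> ?SS V'" if "S \<in> ?SS V" for S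
      using that cc flip[OF that count] by auto
    show "?c (?c S) = S" "?c S \<in> ?SS V" if "S \<in> ?SS V'" for S
      using that cc flip[OF that cnt'] by auto
  qed simp
  also have "\<dots> = matching_sum (\<Union>c\<in>C. Ec c) V' w'"
    using C fin disj K finK by (rule matching_sum_cells[symmetric])
  finally show ?thesis .
qed

section \<open>Matchings of a four-cycle\<close>

lemma covers_empty: "covers {} S \<longleftrightarrow> S = {}"
  by (auto simp: covers_iff)

lemma covers_single: "covers {(x, y)} S \<longleftrightarrow> S = {x, y}"
  by (subst covers_iff) auto

lemma covers_pair:
  assumes "{x, y} \<inter> {z, u} = {}"
  shows "covers {(x, y), (z, u)} S \<longleftrightarrow> S = {x, y, z, u}"
proof
  assume "covers {(x, y), (z, u)} S"
  then have "v \<in> S \<longleftrightarrow> v \<in> {x, y, z, u}" for v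
    by (subst covers_mem_iff) auto
  then show "S = {x, y, z, u}" by blast
next
  have "\<exists>!e. e \<in> {(x, y), (z, u)} \<and> (v = fst e \<or> v = snd e)" if "v \<in> {x, y, z, u}" for v
  proof (cases "v = x \<or> v = y")
    case True
    show ?thesis by (rule ex1I[of _ "(x, y)"]) (use True assms in auto)
  next
    case False
    show ?thesis by (rule ex1I[of _ "(z, u)"]) (use False that assms in auto)
  qed
  then show "covers {(x, y), (z, u)} S" if "S = {x, y, z, u}"
    unfolding that by (subst covers_iff) simp_all
qed

lemma covers_disjoint:
  assumes "covers N S" "finite N" "e \<in> N" "e' \<in> N" "{fst e, snd e} \<inter> {fst e', snd e'} \<noteq> {}"
  shows "e = e'"
proof -
  obtain v where v: "v = fst e \<or> v = snd e" "v = fst e' \<or> v = snd e'" using assms(5) by blast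
  then have "v \<in> S" using coversD2[OF assms(1,2,3)] by auto
  from coversD[OF assms(1) this] show ?thesis using v assms(3,4) by blast
qed

lemma add_ifs: "X + (if P then x else 0) + (if P then y else 0) = X + (if P then x + y else (0 :: complex))"
  by simp

lemma sum_four_cycle_matchings:
  fixes f :: "'e set \<Rightarrow> complex"
  assumes "p \<noteq> q" "p \<noteq> r" "p \<noteq> s" "q \<noteq> r" "q \<noteq> s" "r \<noteq> s"
  shows "sum f {{}, {p}, {q}, {r}, {s}, {p, s}, {q, r}} = f {} + f {p} + f {q} + f {r} + f {s} + f {p, s} + f {q, r}"
  using assms by (simp add: doubleton_eq_iff add.assoc)

text \<open>A four-cycle has seven matchings: the empty one, four single edges and two pairs of
  opposite edges. Both pairs cover all four vertices, hence the two products in the last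
  line.\<close>

lemma four_cycle_matchings:
  fixes a b c d :: 'v
  assumes ne: "distinct [a, b, c, d]" and S: "S \<subseteq> {a, b, c, d}"
  defines "E \<equiv> {(a, b), (a, d), (c, b), (c, d)}"
  shows "matching_sum E S w =
    (if a \<notin> S \<and> b \<notin> S \<and> c \<notin> S \<and> d \<notin> S then 1 else 0) +
    (if a \<in> S \<and> b \<in> S \<and> c \<notin> S \<and> d \<notin> S then w (a, b) else 0) +
    (if a \<in> S \<and> b \<notin> S \<and> c \<notin> S \<and> d \<in> S then w (a, d) else 0) +
    (if a \<notin> S \<and> b \<in> S \<and> c \<in> S \<and> d \<notin> S then w (c, b) else 0) +
    (if a \<notin> S \<and> b \<notin> S \<and> c \<in> S \<and> d \<in> S then w (c, d) else 0) +
    (if a \<in> S \<and> b \<in> S \<and> c \<in> S \<and> d \<in> S then w (a, b) * w (c, d) + w (a, d) * w (c, b) else 0)"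
proof -
  let ?L = "{{}, {(a, b)}, {(a, d)}, {(c, b)}, {(c, d)}, {(a, b), (c, d)}, {(a, d), (c, b)}}"
  have sub: "N \<in> ?L" if "N \<subseteq> E" "covers N S" for N
  proof -
    have fin: "finite N" using that(1) finite_subset unfolding E_def by blast
    note dj = covers_disjoint[OF that(2) fin]
    have 1: "\<not> ((a, b) \<in> N \<and> (a, d) \<in> N)" "\<not> ((a, b) \<in> N \<and> (c, b) \<in> N)"
      "\<not> ((c, d) \<in> N \<and> (a, d) \<in> N)" "\<not> ((c, d) \<in> N \<and> (c, b) \<in> N)"
      using dj[of "(a, b)" "(a, d)"] dj[of "(a, b)" "(c, b)"] dj[of "(c, d)" "(a, d)"] dj[of "(c, d)" "(c, b)"] ne
      by auto
    have 2: "e \<in> {(a, b), (a, d), (c, b), (c, d)}" if "e \<in> N" for e using that \<open>N \<subseteq> E\<close> unfolding E_def by blast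
    show ?thesis
    proof (cases "(a, b) \<in> N \<or> (c, d) \<in> N")
      case True
      then have "N \<subseteq> {(a, b), (c, d)}" using 1 2 by blast
      then have "N = {} \<or> N = {(a, b)} \<or> N = {(c, d)} \<or> N = {(a, b), (c, d)}" by blast
      then show ?thesis by blast
    next
      case False
      then have "N \<subseteq> {(a, d), (c, b)}" using 2 by blast
      then have "N = {} \<or> N = {(a, d)} \<or> N = {(c, b)} \<or> N = {(a, d), (c, b)}" by blast
      then show ?thesis by blast
    qed
  qed
  have subE: "N \<subseteq> E" if "N \<in> ?L" for N using that unfolding E_def by blast
  have L: "sum f ?L = f {} + f {(a, b)} + f {(a, d)} + f {(c, b)} + f {(c, d)} +
      f {(a, b), (c, d)} + f {(a, d), (c, b)}" for f :: "('v \<times> 'v) set \<Rightarrow> complex"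
  proof -
    have "(a, b) \<noteq> (a, d)" "(a, b) \<noteq> (c, b)" "(a, b) \<noteq> (c, d)" "(a, d) \<noteq> (c, b)" "(a, d) \<noteq> (c, d)"
      "(c, b) \<noteq> (c, d)" using ne by auto
    then show ?thesis
      using sum_four_cycle_matchings[of "(a, b)" "(a, d)" "(c, b)" "(c, d)" f] by blast
  qed
  have "matching_sum E S w = (\<Sum>N\<in>?L. if covers N S then \<Prod>e\<in>N. w e else 0)"
    unfolding matching_sum_def
  proof (rule sum.mono_neutral_cong_left)
    show "{N. N \<subseteq> E \<and> covers N S} \<subseteq> ?L" using sub by blast
    show "\<forall>i\<in>?L - {N. N \<subseteq> E \<and> covers N S}. (if covers i S then prod w i else 0) = 0"
      using subE by simp
  qed simp_all
  also have "\<dots> = (if covers {} S then 1 else 0) + (if covers {(a, b)} S then w (a, b) else 0) +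
    (if covers {(a, d)} S then w (a, d) else 0) + (if covers {(c, b)} S then w (c, b) else 0) +
    (if covers {(c, d)} S then w (c, d) else 0) +
    (if covers {(a, b), (c, d)} S then w (a, b) * w (c, d) else 0) +
    (if covers {(a, d), (c, b)} S then w (a, d) * w (c, b) else 0)"
    unfolding L using ne by simp
  also have "covers {(a, b), (c, d)} S \<longleftrightarrow> a \<in> S \<and> b \<in> S \<and> c \<in> S \<and> d \<in> S"
    by (subst covers_pair) (use ne S in \<open>simp, blast\<close>)
  also have "covers {(a, d), (c, b)} S \<longleftrightarrow> a \<in> S \<and> b \<in> S \<and> c \<in> S \<and> d \<in> S"
    by (subst covers_pair) (use ne S in \<open>simp, blast\<close>)
  also have "covers {} S \<longleftrightarrow> a \<notin> S \<and> b \<notin> S \<and> c \<notin> S \<and> d \<notin> S"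
    unfolding covers_empty using S by blast
  also have "covers {(a, b)} S \<longleftrightarrow> a \<in> S \<and> b \<in> S \<and> c \<notin> S \<and> d \<notin> S"
    unfolding covers_single using ne S by (simp, blast)
  also have "covers {(a, d)} S \<longleftrightarrow> a \<in> S \<and> b \<notin> S \<and> c \<notin> S \<and> d \<in> S"
    unfolding covers_single using ne S by (simp, blast)
  also have "covers {(c, b)} S \<longleftrightarrow> a \<notin> S \<and> b \<in> S \<and> c \<in> S \<and> d \<notin> S"
    unfolding covers_single using ne S by (simp, blast)
  also have "covers {(c, d)} S \<longleftrightarrow> a \<notin> S \<and> b \<notin> S \<and> c \<in> S \<and> d \<in> S"
    unfolding covers_single using ne S by (simp, blast)
  finally show ?thesis
    unfolding add_ifs .
qed

text \<open>Complementing the covered set exchanges an edge with its opposite, and the empty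
  matching with the two perfect ones. The perfect matchings have total weight \<Delta> for
  \<open>w\<close> and 1 / \<Delta> for \<open>w'\<close>, so the extreme cases carry the same
  factor as the single edges.\<close>

lemma four_cycle_complement:
  fixes a b c d :: 'v and \<Delta> :: complex
  assumes ne: "distinct [a, b, c, d]" and S: "S \<subseteq> {a, b, c, d}"
    and \<Delta>: "\<Delta> = w (a, b) * w (c, d) + w (a, d) * w (c, b)" "\<Delta> \<noteq> 0"
    and w': "w' (a, b) = w (c, d) / \<Delta>" "w' (c, d) = w (a, b) / \<Delta>"
      "w' (a, d) = w (c, b) / \<Delta>" "w' (c, b) = w (a, d) / \<Delta>"
  shows "matching_sum {(a, b), (a, d), (c, b), (c, d)} S w =
    \<Delta> * matching_sum {(a, b), (a, d), (c, b), (c, d)} ({a, b, c, d} - S) w'"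
proof -
  have \<Delta>': "w' (a, b) * w' (c, d) + w' (a, d) * w' (c, b) = 1 / \<Delta>"
  proof -
    have "w' (a, b) * w' (c, d) + w' (a, d) * w' (c, b) =
        (w (a, b) * w (c, d) + w (a, d) * w (c, b)) / (\<Delta> * \<Delta>)"
      unfolding w' by (simp add: add_divide_distrib mult.commute)
    also have "\<dots> = 1 / \<Delta>" unfolding \<Delta>(1)[symmetric] using \<Delta>(2) by simp
    finally show ?thesis .
  qed
  show ?thesis
    unfolding four_cycle_matchings[OF ne S] four_cycle_matchings[OF ne Diff_subset] \<Delta>' \<Delta>(1)[symmetric]
    using \<Delta>(2) w'
    by (cases "a \<in> S"; cases "b \<in> S"; cases "c \<in> S"; cases "d \<in> S"; simp)
qed

section \<open>Aztec diamonds\<close>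

definition white_edges :: "face \<Rightarrow> (vertex \<times> vertex) set" where
  "white_edges g = {e \<in> face_edges g. white (fst e)}"

definition aztec_white_edges :: "nat \<Rightarrow> face \<Rightarrow> (vertex \<times> vertex) set" where
  "aztec_white_edges k f = {e \<in> aztec_edges k f. white (fst e)}"

definition dimer_weight :: "(vertex \<times> vertex \<Rightarrow> int) \<Rightarrow> (face \<Rightarrow> complex) \<Rightarrow> vertex \<times> vertex \<Rightarrow> complex" where
  "dimer_weight \<phi> a e = of_int (\<phi> e) * (a (right_face e) - a (right_face (prod.swap e)))"

lemma adjacent_white: "adjacent u v \<Longrightarrow> white v \<longleftrightarrow> \<not> white u"
proof -
  assume a: "adjacent u v"
  obtain x y x' y' where uv: "u = (x, y)" "v = (x', y')" by (cases u, cases v) auto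
  have "(x' = x + 1 \<or> x' = x - 1) \<and> y' = y \<or> x' = x \<and> (y' = y + 1 \<or> y' = y - 1)"
    using a unfolding uv adjacent_def by auto
  then show ?thesis unfolding uv white_def by auto
qed

lemma adjacent_sym: "adjacent u v \<Longrightarrow> adjacent v u"
  by (auto simp: adjacent_def split: prod.splits)

lemma finite_corners: "finite (corners f)"
  by (cases f) (simp add: corners_def)

lemma finite_internal_faces: "finite (internal_faces k f)"
proof (cases f)
  case (Pair i j)
  have "internal_faces k f \<subseteq> {i - int k..i + int k} \<times> {j - int k..j + int k}"
    unfolding Pair internal_faces_def by auto
  then show ?thesis by (rule finite_subset) simp
qed

lemma finite_face_edges: "finite (face_edges f)"
  by (rule finite_subset[of _ "corners f \<times> corners f"]) (auto simp: face_edges_def finite_corners)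

lemma finite_aztec_edges: "finite (aztec_edges k f)"
  unfolding aztec_edges_def using finite_internal_faces finite_face_edges by blast

lemma aztec_edgesD:
  assumes "(u, v) \<in> aztec_edges k f"
  shows "adjacent u v" "u \<in> aztec_vertices k f" "v \<in> aztec_vertices k f" "(v, u) \<in> aztec_edges k f"
proof -
  obtain g where g: "g \<in> internal_faces k f" "u \<in> corners g" "v \<in> corners g" "adjacent u v"
    using assms unfolding aztec_edges_def face_edges_def by blast
  show "adjacent u v" by fact
  show "u \<in> aztec_vertices k f" "v \<in> aztec_vertices k f" using g unfolding aztec_vertices_def by blast+
  show "(v, u) \<in> aztec_edges k f"
    using g(1-3) adjacent_sym[OF g(4)] unfolding aztec_edges_def face_edges_def by blast
qed

section \<open>Oriented dimer configurations as matchings\<close>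

text \<open>N is the matching with all edges directed from white to black, and B the part that keeps
  this direction. Bipartiteness makes N recoverable from the undirected edges and prevents an edge
  from occurring in both directions.\<close>

lemma oriented_dimers_iff:
  assumes N: "N \<subseteq> aztec_white_edges k f" and B: "B \<subseteq> N"
  shows "B \<union> prod.swap ` (N - B) \<in> oriented_dimers k f \<longleftrightarrow> covers N (aztec_vertices k f)"
proof -
  let ?und = "\<lambda>(u, v). {u, v}" and ?M = "B \<union> prod.swap ` (N - B)" and ?V = "aztec_vertices k f"
  have NE: "N \<subseteq> aztec_edges k f" using N unfolding aztec_white_edges_def by blast
  have Nw: "white u" "\<not> white v" if "(u, v) \<in> N" for u v
  proof -
    show "white u" using that N unfolding aztec_white_edges_def by auto
    then show "\<not> white v" using adjacent_white[OF aztec_edgesD(1)] that NE by blast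
  qed
  have ME: "?M \<subseteq> aztec_edges k f" 
  proof
    fix e assume e: "e \<in> ?M"
    show "e \<in> aztec_edges k f"
    proof (cases "e \<in> B")
      case False
      then obtain u v where "(u, v) \<in> N" "e = (v, u)" using e by auto
      then show ?thesis using NE aztec_edgesD(4) by blast
    qed (use B NE in blast)
  qed
  have fin: "finite N" using finite_subset[OF NE finite_aztec_edges] .
  have img: "?und ` ?M = ?und ` N" 
  proof -
    have "?und ` prod.swap ` (N - B) = ?und ` (N - B)"
      unfolding image_image by (intro image_cong) auto
    then have "?und ` ?M = ?und ` B \<union> ?und ` (N - B)" by (simp only: image_Un)
    also have "\<dots> = ?und ` N" using B by blast
    finally show ?thesis .
  qed
  have inj: "e = e'" if "e \<in> N" "e' \<in> N" "?und e = ?und e'" for e e'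
  proof -
    obtain u v u' v' where ee: "e = (u, v)" "e' = (u', v')" by (cases e, cases e')
    have "(u = u' \<and> v = v') \<or> (u = v' \<and> v = u')" using that(3) unfolding ee by (simp add: doubleton_eq_iff)
    then show ?thesis using Nw[of u v] Nw[of u' v'] that unfolding ee by blast
  qed
  have anti: "\<forall>(u, v)\<in>?M. (v, u) \<notin> ?M" 
  proof (intro ballI, clarify)
    fix u v assume "(u, v) \<in> ?M" "(v, u) \<in> ?M"
    then have "(u, v) \<in> B \<or> (v, u) \<in> N - B" "(v, u) \<in> B \<or> (u, v) \<in> N - B" by auto
    then show False using Nw[of u v] Nw[of v u] B by blast
  qed
  have sub: "?und ` N \<subseteq> ?und ` aztec_edges k f" using NE by blast
  have ends: "\<forall>e\<in>N. fst e \<in> ?V \<and> snd e \<in> ?V" 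
  proof
    fix e assume "e \<in> N"
    then have "(fst e, snd e) \<in> aztec_edges k f" using NE by auto
    then show "fst e \<in> ?V \<and> snd e \<in> ?V" using aztec_edgesD(2,3) by blast
  qed
  have mem: "v \<in> ?und e \<longleftrightarrow> v = fst e \<or> v = snd e" for v e by (cases e) auto
  have "(\<exists>!e. e \<in> ?und ` N \<and> v \<in> e) \<longleftrightarrow> (\<exists>!e. e \<in> N \<and> (v = fst e \<or> v = snd e))" for v
  proof
    assume "\<exists>!e. e \<in> ?und ` N \<and> v \<in> e"
    then obtain d where d: "d \<in> ?und ` N" "v \<in> d" "\<And>d'. d' \<in> ?und ` N \<Longrightarrow> v \<in> d' \<Longrightarrow> d' = d" by metis
    then obtain e where e: "e \<in> N" "d = ?und e" by blast
    show "\<exists>!e. e \<in> N \<and> (v = fst e \<or> v = snd e)"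
    proof (rule ex1I[of _ e])
      show "e \<in> N \<and> (v = fst e \<or> v = snd e)" using e d(2) mem by metis
      show "e' = e" if "e' \<in> N \<and> (v = fst e' \<or> v = snd e')" for e'
      proof -
        have "?und e' = d"
          by (rule d(3)[OF imageI[OF conjunct1[OF that]] iffD2[OF mem conjunct2[OF that]]])
        then show ?thesis using inj[OF conjunct1[OF that] e(1)] e(2) by (simp only:)
      qed
    qed
  next
    assume "\<exists>!e. e \<in> N \<and> (v = fst e \<or> v = snd e)"
    then obtain e where e: "e \<in> N" "v = fst e \<or> v = snd e"
      and uniq: "\<forall>e'. e' \<in> N \<and> (v = fst e' \<or> v = snd e') \<longrightarrow> e' = e"
      unfolding Ex1_def by blast
    show "\<exists>!e. e \<in> ?und ` N \<and> v \<in> e"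
    proof (rule ex1I[of _ "?und e"])
      show "?und e \<in> ?und ` N \<and> v \<in> ?und e" by (intro conjI imageI e(1) iffD2[OF mem] e(2))
      show "d = ?und e" if d: "d \<in> ?und ` N \<and> v \<in> d" for d
      proof -
        obtain e' where e': "e' \<in> N" "d = ?und e'" using d by blast
        have "v \<in> ?und e'" using d unfolding e'(2) by (rule conjunct2)
        then have "v = fst e' \<or> v = snd e'" by (rule iffD1[OF mem])
        then have "e' = e" using uniq e'(1) by blast
        then show ?thesis using e'(2) by (simp only:)
      qed
    qed
  qed
  then have "?M \<in> oriented_dimers k f \<longleftrightarrow> (\<forall>v\<in>?V. \<exists>!e. e \<in> N \<and> (v = fst e \<or> v = snd e))"
    unfolding oriented_dimers_def perfect_matching_def mem_Collect_eq img using ME sub anti by simp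
  then show ?thesis unfolding covers_iff[OF fin] using ends by blast
qed

text \<open>Expanding the product of two-term weights over a matching N gives a sum over the subsets
  B of N. Every oriented configuration arises from exactly one pair (N, B), where B consists of its
  edges that start at a white vertex.\<close>

lemma Z_eq_matching_sum:
  assumes kast: "kasteleyn k f \<phi>"
  shows "Z k f a \<phi> = matching_sum (aztec_white_edges k f) (aztec_vertices k f) (dimer_weight \<phi> a)"
proof -
  let ?E = "aztec_edges k f" and ?W = "aztec_white_edges k f" and ?V = "aztec_vertices k f"
  define g where "g = (\<lambda>e. of_int (\<phi> e) * a (right_face e))"
  let ?P = "{N. N \<subseteq> ?W \<and> covers N ?V}"
  have finW: "finite ?W" using finite_aztec_edges unfolding aztec_white_edges_def by simp
  then have finP: "finite ?P" by simp
  have swapE: "prod.swap e \<in> ?E" "\<not> white (fst (prod.swap e)) \<longleftrightarrow> white (fst e)" if "e \<in> ?E" for e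
    using that aztec_edgesD(1,4)[of "fst e" "snd e" k f] adjacent_white[of "fst e" "snd e"] by (auto simp: prod.swap_def)
  have w: "dimer_weight \<phi> a e = g e + g (prod.swap e)" if "e \<in> ?E" for e
  proof -
    have "\<phi> (prod.swap e) = - \<phi> e" using kast that unfolding kasteleyn_def by (cases e) auto
    then show ?thesis by (simp add: dimer_weight_def g_def right_diff_distrib)
  qed
  have "matching_sum ?W ?V (dimer_weight \<phi> a) = (\<Sum>N\<in>?P. \<Sum>B\<in>Pow N. prod g B * prod (g \<circ> prod.swap) (N - B))"
    unfolding matching_sum_def
  proof (rule sum.cong[OF refl])
    fix N assume "N \<in> ?P"
    then have "N \<subseteq> ?W" "finite N" using finW finite_subset by auto
    then have "(\<Prod>e\<in>N. dimer_weight \<phi> a e) = (\<Prod>e\<in>N. g e + (g \<circ> prod.swap) e)"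
      using w unfolding aztec_white_edges_def by (intro prod.cong) auto
    then show "(\<Prod>e\<in>N. dimer_weight \<phi> a e) = (\<Sum>B\<in>Pow N. prod g B * prod (g \<circ> prod.swap) (N - B))"
      unfolding prod_add[OF \<open>finite N\<close>] .
  qed
  also have "\<dots> = (\<Sum>(N, B)\<in>Sigma ?P Pow. prod g B * prod (g \<circ> prod.swap) (N - B))"
    using finP finite_subset[OF _ finW] by (subst sum.Sigma) auto
  also have "\<dots> = (\<Sum>M\<in>oriented_dimers k f. prod g M)"
  proof (rule sum.reindex_bij_witness[where j = "\<lambda>(N, B). B \<union> prod.swap ` (N - B)" and
      i = "\<lambda>M. ({e \<in> ?W. e \<in> M \<or> prod.swap e \<in> M}, {e \<in> M. white (fst e)})"])
    fix p assume p: "p \<in> Sigma ?P Pow"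
    then obtain N B where pNB: "p = (N, B)" and N: "N \<subseteq> ?W" "covers N ?V" and B: "B \<subseteq> N" by auto
    have we: "white (fst e)" "e \<in> ?E" if "e \<in> N" for e using N that unfolding aztec_white_edges_def by auto
    have sw: "\<not> white (fst (prod.swap e))" if "e \<in> N" for e using we swapE that by blast
    have "{e \<in> ?W. e \<in> B \<union> prod.swap ` (N - B) \<or> prod.swap e \<in> B \<union> prod.swap ` (N - B)} = N" (is "?L = N")
    proof
      show "?L \<subseteq> N"
      proof
        fix e assume e: "e \<in> ?L"
        then have ew: "white (fst e)" "e \<in> ?E" unfolding aztec_white_edges_def by auto
        have "e \<notin> prod.swap ` (N - B)" using ew(1) sw by auto
        moreover have "prod.swap e \<notin> B" using ew swapE(2) we B by blast
        moreover have "e \<in> N - B" if "prod.swap e \<in> prod.swap ` (N - B)"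
          using that by (metis image_iff swap_swap)
        ultimately show "e \<in> N" using e B by blast
      qed
      show "N \<subseteq> ?L" using N(1) by auto
    qed
    moreover have "{e \<in> B \<union> prod.swap ` (N - B). white (fst e)} = B" using sw we B by blast
    ultimately show "(\<lambda>M. ({e \<in> ?W. e \<in> M \<or> prod.swap e \<in> M}, {e \<in> M. white (fst e)}))
        ((\<lambda>(N, B). B \<union> prod.swap ` (N - B)) p) = p" unfolding pNB by simp
    show "(\<lambda>(N, B). B \<union> prod.swap ` (N - B)) p \<in> oriented_dimers k f"
      unfolding pNB using oriented_dimers_iff[OF N(1) B] N(2) by simp
    have finN: "finite N" using finite_subset[OF N(1) finW] .
    have "prod g (B \<union> prod.swap ` (N - B)) = prod g B * prod g (prod.swap ` (N - B))"
    proof (rule prod.union_disjoint)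
      show "finite B" using finite_subset[OF B finN] .
      show "B \<inter> prod.swap ` (N - B) = {}" using sw we B by blast
    qed (use finN in simp)
    also have "prod g (prod.swap ` (N - B)) = prod (g \<circ> prod.swap) (N - B)"
      by (rule prod.reindex) simp
    finally show "prod g ((\<lambda>(N, B). B \<union> prod.swap ` (N - B)) p) =
        (case p of (N, B) \<Rightarrow> prod g B * prod (g \<circ> prod.swap) (N - B))" unfolding pNB by simp
  next
    fix M assume M: "M \<in> oriented_dimers k f"
    let ?N = "{e \<in> ?W. e \<in> M \<or> prod.swap e \<in> M}" and ?B = "{e \<in> M. white (fst e)}"
    have ME: "M \<subseteq> ?E" and anti: "\<And>e. e \<in> M \<Longrightarrow> prod.swap e \<notin> M"
      using M unfolding oriented_dimers_def by auto
    have eq: "?B \<union> prod.swap ` (?N - ?B) = M"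
    proof
      show "?B \<union> prod.swap ` (?N - ?B) \<subseteq> M" unfolding aztec_white_edges_def by auto
      show "M \<subseteq> ?B \<union> prod.swap ` (?N - ?B)"
      proof
        fix e assume e: "e \<in> M"
        show "e \<in> ?B \<union> prod.swap ` (?N - ?B)"
        proof (cases "white (fst e)")
          case True
          then show ?thesis using e by simp
        next
          case False
          have eE: "e \<in> ?E" using e ME by blast
          have "prod.swap e \<in> ?W" using swapE[OF eE] False unfolding aztec_white_edges_def by blast
          then have "prod.swap e \<in> ?N - ?B" using e anti[OF e] by simp
          then have "prod.swap (prod.swap e) \<in> prod.swap ` (?N - ?B)" by (rule imageI)
          then show ?thesis by simp
        qed
      qed
    qed
    then show "(\<lambda>(N, B). B \<union> prod.swap ` (N - B)) (?N, ?B) = M" by simp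
    have BN: "?B \<subseteq> ?N" using ME unfolding aztec_white_edges_def by auto
    moreover have "covers ?N ?V" using oriented_dimers_iff[of ?N k f ?B] BN M unfolding eq by blast
    ultimately show "(?N, ?B) \<in> Sigma ?P Pow" by blast
  qed
  finally show ?thesis unfolding Z_def g_def by simp
qed

section \<open>Grid distances and parity\<close>

text \<open>For an integer X the test X \<ge> 1 fixes the signs of X, X - 1 and 2 X - 1 at once,
  which makes the next lemmas linear arithmetic.\<close>

lemma abs_ge_one: "X \<ge> 1 \<Longrightarrow> \<bar>X\<bar> = X \<and> \<bar>X - 1\<bar> = X - 1 \<and> \<bar>2 * X - 1\<bar> = 2 * X - 1"
  and abs_less_one: "\<not> X \<ge> 1 \<Longrightarrow> \<bar>X\<bar> = - X \<and> \<bar>X - 1\<bar> = 1 - X \<and> \<bar>2 * X - 1\<bar> = 1 - 2 * X" for X :: int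
  by auto

text \<open>The vertex (X, Y) sits at (X - 1/2, Y - 1/2), so |2 X - 1| + |2 Y - 1| is its doubled
  distance from the center. Under the parity assumption the faces (X, Y) and (X - 1, Y - 1) at this
  vertex are the candidates for cells: one internal face characterises the vertices of the diamond
  of size K, two those of size K - 1.\<close>

lemma diagonal_dist_le:
  fixes X Y K :: int
  assumes "odd (X + Y + K)"
  shows "(\<bar>X\<bar> + \<bar>Y\<bar> < K \<or> \<bar>X - 1\<bar> + \<bar>Y - 1\<bar> < K \<longleftrightarrow> \<bar>2 * X - 1\<bar> + \<bar>2 * Y - 1\<bar> \<le> 2 * K) \<and>
    (\<bar>X\<bar> + \<bar>Y\<bar> < K \<and> \<bar>X - 1\<bar> + \<bar>Y - 1\<bar> < K \<longleftrightarrow> \<bar>2 * X - 1\<bar> + \<bar>2 * Y - 1\<bar> \<le> 2 * (K - 1))"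
proof -
  obtain n where "X + Y + K = 2 * n + 1" using assms by (rule oddE)
  then have K: "K = 2 * n + 1 - X - Y" by simp
  consider "X \<ge> 1" "Y \<ge> 1" | "X \<ge> 1" "\<not> Y \<ge> 1" | "\<not> X \<ge> 1" "Y \<ge> 1" | "\<not> X \<ge> 1" "\<not> Y \<ge> 1" by blast
  then show ?thesis
    unfolding K by cases (simp_all only: abs_ge_one abs_less_one, presburger+)
qed

lemma antidiagonal_dist_le:
  fixes X Y K :: int
  assumes "even (X + Y + K)"
  shows "(\<bar>X - 1\<bar> + \<bar>Y\<bar> < K \<or> \<bar>X\<bar> + \<bar>Y - 1\<bar> < K \<longleftrightarrow> \<bar>2 * X - 1\<bar> + \<bar>2 * Y - 1\<bar> \<le> 2 * K) \<and>
    (\<bar>X - 1\<bar> + \<bar>Y\<bar> < K \<and> \<bar>X\<bar> + \<bar>Y - 1\<bar> < K \<longleftrightarrow> \<bar>2 * X - 1\<bar> + \<bar>2 * Y - 1\<bar> \<le> 2 * (K - 1))"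
proof -
  obtain n where "X + Y + K = 2 * n" using assms by (rule evenE)
  then have K: "K = 2 * n - X - Y" by simp
  consider "X \<ge> 1" "Y \<ge> 1" | "X \<ge> 1" "\<not> Y \<ge> 1" | "\<not> X \<ge> 1" "Y \<ge> 1" | "\<not> X \<ge> 1" "\<not> Y \<ge> 1" by blast
  then show ?thesis
    unfolding K by cases (simp_all only: abs_ge_one abs_less_one, presburger+)
qed

lemma corner_dist_le:
  fixes X Y K :: int
  shows "\<bar>X\<bar> + \<bar>Y\<bar> < K \<or> \<bar>X - 1\<bar> + \<bar>Y\<bar> < K \<or> \<bar>X\<bar> + \<bar>Y - 1\<bar> < K \<or> \<bar>X - 1\<bar> + \<bar>Y - 1\<bar> < K
    \<longleftrightarrow> \<bar>2 * X - 1\<bar> + \<bar>2 * Y - 1\<bar> \<le> 2 * K"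
proof -
  consider "X \<ge> 1" "Y \<ge> 1" | "X \<ge> 1" "\<not> Y \<ge> 1" | "\<not> X \<ge> 1" "Y \<ge> 1" | "\<not> X \<ge> 1" "\<not> Y \<ge> 1" by blast
  then show ?thesis
    by cases (simp_all only: abs_ge_one abs_less_one, presburger+)
qed

text \<open>For the end of the edge farther from the center, the first absolute value is 2 |X| + 1.
  The additional 1 yields the strict inequality for the face on the inner side of the edge.\<close>

lemma edge_dist_less:
  fixes X Y K :: int
  assumes "\<bar>2 * X - 1\<bar> + \<bar>2 * Y - 1\<bar> \<le> 2 * K" "\<bar>2 * (X + 1) - 1\<bar> + \<bar>2 * Y - 1\<bar> \<le> 2 * K"
  shows "\<bar>X\<bar> + \<bar>Y\<bar> < K \<or> \<bar>X\<bar> + \<bar>Y - 1\<bar> < K"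
proof (cases "Y \<ge> 1")
  case True
  have "2 * \<bar>X\<bar> \<le> \<bar>2 * X - 1\<bar> - 1 \<or> 2 * \<bar>X\<bar> \<le> \<bar>2 * (X + 1) - 1\<bar> - 1" by arith
  then show ?thesis using assms abs_ge_one[OF True] by linarith
next
  case False
  have "2 * \<bar>X\<bar> \<le> \<bar>2 * X - 1\<bar> - 1 \<or> 2 * \<bar>X\<bar> \<le> \<bar>2 * (X + 1) - 1\<bar> - 1" by arith
  then show ?thesis using assms abs_less_one[OF False] by linarith
qed

text \<open>Parity keeps the face (X', Y') away from distance K - 1. It is therefore at distance at
  most K - 2, and all its neighbours are still internal.\<close>

lemma neighbour_dist_less:
  fixes X Y X' Y' K :: int
  assumes "even (X' + Y' + K)" "\<bar>X'\<bar> + \<bar>Y'\<bar> < K" "\<bar>X - X'\<bar> + \<bar>Y - Y'\<bar> = 1"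
  shows "\<bar>X\<bar> + \<bar>Y\<bar> < K"
proof -
  have "even (\<bar>X'\<bar> + \<bar>Y'\<bar> + K)" using assms(1) by simp
  then have "\<bar>X'\<bar> + \<bar>Y'\<bar> \<noteq> K - 1" by presburger
  with assms(2) have "\<bar>X'\<bar> + \<bar>Y'\<bar> + 1 < K" by linarith
  with assms(3) show ?thesis by linarith
qed

lemma diff_one_right_commute: "x - 1 - i = x - i - (1 :: int)"
  by simp

lemma adjacent_iff:
  "adjacent (x, y) v \<longleftrightarrow> v = (x + 1, y) \<or> v = (x - 1, y) \<or> v = (x, y + 1) \<or> v = (x, y - 1)"
  by (cases v) (auto simp: adjacent_def)

lemma right_face_simps:
  "right_face ((x, y), (x + 1, y)) = (x, y - 1)" "right_face ((x, y), (x - 1, y)) = (x - 1, y)"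
  "right_face ((x, y), (x, y + 1)) = (x, y)" "right_face ((x, y), (x, y - 1)) = (x - 1, y - 1)"
  "right_face ((x + 1, y), (x, y)) = (x, y)" "right_face ((x - 1, y), (x, y)) = (x - 1, y - 1)"
  "right_face ((x, y + 1), (x, y)) = (x - 1, y)" "right_face ((x, y - 1), (x, y)) = (x, y - 1)"
  by (simp_all add: right_face_def)

lemma face_edges_iff:
  "(u, v) \<in> face_edges g \<longleftrightarrow> adjacent u v \<and> (g = right_face (u, v) \<or> g = right_face (v, u))"
proof -
  obtain x y where u: "u = (x, y)" by (cases u)
  obtain i j where g: "g = (i, j)" by (cases g)
  show ?thesis
  proof (cases "adjacent u v")
    case True
    then consider "v = (x + 1, y)" | "v = (x - 1, y)" | "v = (x, y + 1)" | "v = (x, y - 1)"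
      unfolding u adjacent_iff by blast
    then show ?thesis
      using True unfolding u g
      by cases (simp_all add: face_edges_def right_face_simps corners_def, presburger+)
  next
    case False
    then show ?thesis unfolding face_edges_def by simp
  qed
qed

lemma right_face_parity:
  assumes "adjacent u v" "right_face (u, v) = (x, y)" "right_face (v, u) = (x', y')"
  shows "even (x + y) \<longleftrightarrow> odd (x' + y')" "\<bar>x - x'\<bar> + \<bar>y - y'\<bar> = 1"
proof -
  obtain a b where u: "u = (a, b)" by (cases u)
  consider "v = (a + 1, b)" | "v = (a - 1, b)" | "v = (a, b + 1)" | "v = (a, b - 1)"
    using assms(1) unfolding u adjacent_iff by blast
  then have "(even (x + y) \<longleftrightarrow> odd (x' + y')) \<and> \<bar>x - x'\<bar> + \<bar>y - y'\<bar> = 1"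
    using assms(2,3) unfolding u by cases (auto simp: right_face_simps)
  then show "even (x + y) \<longleftrightarrow> odd (x' + y')" "\<bar>x - x'\<bar> + \<bar>y - y'\<bar> = 1" by auto
qed

section \<open>Decomposition of the diamond into cells\<close>

text \<open>The internal faces with the parity of the outermost ones, which are at distance k - 1.
  They are renewed in the step from size k to size k - 1; every edge of the diamond borders exactly
  one of them.\<close>

definition cells :: "nat \<Rightarrow> face \<Rightarrow> face set" where
  "cells k = (\<lambda>(i, j). {(x, y). (x, y) \<in> internal_faces k (i, j) \<and> odd (x + y + i + j + int k)})"

lemma internal_faces_iff: "(x, y) \<in> internal_faces k (i, j) \<longleftrightarrow> \<bar>x - i\<bar> + \<bar>y - j\<bar> < int k"
  by (simp add: internal_faces_def)

lemma cells_iff: "(x, y) \<in> cells k (i, j) \<longleftrightarrow> \<bar>x - i\<bar> + \<bar>y - j\<bar> < int k \<and> odd (x + y + i + j + int k)"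
  by (simp add: cells_def internal_faces_iff)

lemma cells_subset: "cells k f \<subseteq> internal_faces k f"
  by (cases f) (auto simp: cells_def)

lemma finite_cells: "finite (cells k f)"
  using cells_subset finite_internal_faces finite_subset by metis

lemma finite_white_edges: "finite (white_edges g)"
  using finite_face_edges unfolding white_edges_def by simp

lemma white_edges_disjoint:
  assumes "c \<in> cells k f" "d \<in> cells k f" "c \<noteq> d"
  shows "white_edges c \<inter> white_edges d = {}"
proof (rule ccontr)
  assume "white_edges c \<inter> white_edges d \<noteq> {}"
  then obtain u v where uv: "(u, v) \<in> face_edges c" "(u, v) \<in> face_edges d"
    unfolding white_edges_def by auto
  obtain i j x y x' y' where f: "f = (i, j)" "c = (x, y)" "d = (x', y')" by (cases f, cases c, cases d)
  have "adjacent u v" "(c = right_face (u, v) \<and> d = right_face (v, u)) \<or> (d = right_face (u, v) \<and> c = right_face (v, u))"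
    using uv assms(3) unfolding face_edges_iff by auto
  then have "even (x + y) \<longleftrightarrow> odd (x' + y')" using right_face_parity(1) unfolding f by metis
  moreover have "odd (x + y + i + j + int k)" "odd (x' + y' + i + j + int k)"
    using assms unfolding f cells_iff by auto
  ultimately show False by presburger
qed

text \<open>Of the two faces beside an edge exactly one has the parity of the cells. If only the
  other one is known to be internal, \<open>neighbour_dist_less\<close> makes this one internal
  too.\<close>

lemma aztec_white_edges_cells: "aztec_white_edges k f = (\<Union>c\<in>cells k f. white_edges c)"
proof
  show "(\<Union>c\<in>cells k f. white_edges c) \<subseteq> aztec_white_edges k f"
    using cells_subset[of k f] unfolding white_edges_def aztec_white_edges_def aztec_edges_def by blast
  show "aztec_white_edges k f \<subseteq> (\<Union>c\<in>cells k f. white_edges c)"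
  proof
    fix e assume "e \<in> aztec_white_edges k f"
    then obtain u v g where e: "e = (u, v)" "g \<in> internal_faces k f" "(u, v) \<in> face_edges g" "white u"
      unfolding aztec_white_edges_def aztec_edges_def by (cases e) auto
    then have adj: "adjacent u v" unfolding face_edges_iff by blast
    obtain i j x y x' y' where f: "f = (i, j)" "right_face (u, v) = (x, y)" "right_face (v, u) = (x', y')"
      by (cases f, cases "right_face (u, v)", cases "right_face (v, u)")
    have both: "(u, v) \<in> face_edges (x, y)" "(u, v) \<in> face_edges (x', y')"
      unfolding face_edges_iff f using adj by auto
    have "g = (x, y) \<or> g = (x', y')" using e(3) unfolding face_edges_iff f by blast
    then have internal: "\<bar>x - i\<bar> + \<bar>y - j\<bar> < int k \<or> \<bar>x' - i\<bar> + \<bar>y' - j\<bar> < int k"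
      using e(2) unfolding f by (auto simp: internal_faces_iff)
    have "(x, y) \<in> cells k f \<or> (x', y') \<in> cells k f"
    proof (cases "odd (x + y + i + j + int k)")
      case True
      then have "even ((x' - i) + (y' - j) + int k)" using right_face_parity(1)[OF adj f(2,3)] by auto
      then have "\<bar>x - i\<bar> + \<bar>y - j\<bar> < int k" if "\<bar>x' - i\<bar> + \<bar>y' - j\<bar> < int k"
        using neighbour_dist_less[of "x' - i" "y' - j" "int k" "x - i" "y - j"] that
          right_face_parity(2)[OF adj f(2,3)] by simp
      then have "(x, y) \<in> cells k f" using internal True unfolding f(1) cells_iff by blast
      then show ?thesis ..
    next
      case False
      then have "even ((x - i) + (y - j) + int k)" "odd (x' + y' + i + j + int k)"
        using right_face_parity(1)[OF adj f(2,3)] by auto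
      then have "\<bar>x' - i\<bar> + \<bar>y' - j\<bar> < int k" if "\<bar>x - i\<bar> + \<bar>y - j\<bar> < int k"
        using neighbour_dist_less[of "x - i" "y - j" "int k" "x' - i" "y' - j"] that
          right_face_parity(2)[OF adj f(2,3)] by (simp add: abs_minus_commute)
      then have "(x', y') \<in> cells k f"
        using internal \<open>odd (x' + y' + i + j + int k)\<close> unfolding f(1) cells_iff by blast
      then show ?thesis ..
    qed
    then show "e \<in> (\<Union>c\<in>cells k f. white_edges c)"
      using both e unfolding white_edges_def by auto
  qed
qed

lemma corners_iff: "(x, y) \<in> corners (a, b) \<longleftrightarrow> (a = x \<or> a = x - 1) \<and> (b = y \<or> b = y - 1)"
  by (simp add: corners_def) presburger

lemma aztec_vertices_iff:
  "(x, y) \<in> aztec_vertices k (i, j) \<longleftrightarrow> \<bar>2 * (x - i) - 1\<bar> + \<bar>2 * (y - j) - 1\<bar> \<le> 2 * int k"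
proof -
  have "(x, y) \<in> aztec_vertices k (i, j) \<longleftrightarrow>
    (\<exists>a b. (a, b) \<in> internal_faces k (i, j) \<and> (a = x \<or> a = x - 1) \<and> (b = y \<or> b = y - 1))"
    unfolding aztec_vertices_def UN_iff corners_iff[symmetric] by (metis surj_pair)
  also have "\<dots> \<longleftrightarrow> (x, y) \<in> internal_faces k (i, j) \<or> (x - 1, y) \<in> internal_faces k (i, j) \<or>
      (x, y - 1) \<in> internal_faces k (i, j) \<or> (x - 1, y - 1) \<in> internal_faces k (i, j)"
    by blast
  also have "\<dots> \<longleftrightarrow> \<bar>2 * (x - i) - 1\<bar> + \<bar>2 * (y - j) - 1\<bar> \<le> 2 * int k"
    unfolding internal_faces_iff corner_dist_le[symmetric] diff_one_right_commute[of x i] diff_one_right_commute[of y j] ..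
  finally show ?thesis .
qed

lemma sum_of_bool_two:
  assumes "finite C" "p \<noteq> q" and iff: "\<And>c. c \<in> C \<and> P c \<longleftrightarrow> (c = p \<or> c = q) \<and> Q c"
  shows "(\<Sum>c\<in>C. of_bool (P c)) = (of_bool (Q p) + of_bool (Q q) :: nat)"
proof -
  have "{c \<in> C. P c} = {c \<in> {p, q}. Q c}" using iff by blast
  then have "(\<Sum>c\<in>C. of_bool (P c)) = (\<Sum>c\<in>{p, q}. of_bool (Q c) :: nat)"
    using assms(1) by (simp only: sum_of_bool_eq finite.insertI finite.emptyI Collect_conj_eq[symmetric] Int_def mem_Collect_eq)
  also have "\<dots> = of_bool (Q p) + of_bool (Q q)" using assms(2) by simp
  finally show ?thesis .
qed

text \<open>Two opposite ones among the four faces at v have the parity of the cells. If P and Q say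
  that they are internal, then [P] + [Q] = [P or Q] + [P and Q], and these two terms are the two
  diamonds. This supplies \<open>count\<close> in \<open>matching_sum_complement\<close>.\<close>

lemma cells_at_vertex:
  assumes "k \<ge> 1"
  shows "(\<Sum>c\<in>cells k f. of_bool (v \<in> corners c)) =
    (of_bool (v \<in> aztec_vertices k f) + of_bool (v \<in> aztec_vertices (k - 1) f) :: nat)"
proof -
  obtain i j x y where f: "f = (i, j)" "v = (x, y)" by (cases f, cases v)
  have k1: "int (k - 1) = int k - 1" using assms by simp
  have in_corner: "c = (x, y) \<or> c = (x - 1, y) \<or> c = (x, y - 1) \<or> c = (x - 1, y - 1) \<longleftrightarrow> v \<in> corners c" for c
    by (cases c) (simp only: f corners_iff prod.inject, blast)
  show ?thesis
  proof (cases "odd (x + y + i + j + int k)")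
    case True
    then have par: "odd (x - 1 + (y - 1) + i + j + int k)" "even (x - 1 + y + i + j + int k)" "even (x + (y - 1) + i + j + int k)"
      by presburger+
    have "(\<Sum>c\<in>cells k f. of_bool (v \<in> corners c)) =
        (of_bool ((x, y) \<in> internal_faces k f) + of_bool ((x - 1, y - 1) \<in> internal_faces k f) :: nat)"
    proof (rule sum_of_bool_two[OF finite_cells])
      show "c \<in> cells k f \<and> v \<in> corners c \<longleftrightarrow> (c = (x, y) \<or> c = (x - 1, y - 1)) \<and> c \<in> internal_faces k f" for c
        unfolding in_corner[symmetric]
        using True par cells_iff[of x y k i j] cells_iff[of "x - 1" y k i j] cells_iff[of x "y - 1" k i j]
          cells_iff[of "x - 1" "y - 1" k i j] internal_faces_iff[of x y k i j] internal_faces_iff[of "x - 1" "y - 1" k i j]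
        unfolding f by blast
    qed simp
    also have "\<dots> = of_bool (v \<in> aztec_vertices k f) + of_bool (v \<in> aztec_vertices (k - 1) f)"
    proof -
      have "odd ((x - i) + (y - j) + int k)" using True by presburger
      note d = diagonal_dist_le[OF this]
      have "(x, y) \<in> internal_faces k f \<or> (x - 1, y - 1) \<in> internal_faces k f \<longleftrightarrow> v \<in> aztec_vertices k f"
        "(x, y) \<in> internal_faces k f \<and> (x - 1, y - 1) \<in> internal_faces k f \<longleftrightarrow> v \<in> aztec_vertices (k - 1) f"
        unfolding f internal_faces_iff aztec_vertices_iff k1 diff_one_right_commute[of x i] diff_one_right_commute[of y j]
        using d by blast+
      then show ?thesis
        by (cases "(x, y) \<in> internal_faces k f"; cases "(x - 1, y - 1) \<in> internal_faces k f"; simp only: of_bool_def simp_thms if_True if_False)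
    qed
    finally show ?thesis .
  next
    case False
    then have par: "even (x - 1 + (y - 1) + i + j + int k)" "odd (x - 1 + y + i + j + int k)" "odd (x + (y - 1) + i + j + int k)"
      by presburger+
    have "(\<Sum>c\<in>cells k f. of_bool (v \<in> corners c)) =
        (of_bool ((x - 1, y) \<in> internal_faces k f) + of_bool ((x, y - 1) \<in> internal_faces k f) :: nat)"
    proof (rule sum_of_bool_two[OF finite_cells])
      show "c \<in> cells k f \<and> v \<in> corners c \<longleftrightarrow> (c = (x - 1, y) \<or> c = (x, y - 1)) \<and> c \<in> internal_faces k f" for c
        unfolding in_corner[symmetric]
        using False par cells_iff[of x y k i j] cells_iff[of "x - 1" y k i j] cells_iff[of x "y - 1" k i j]
          cells_iff[of "x - 1" "y - 1" k i j] internal_faces_iff[of "x - 1" y k i j] internal_faces_iff[of x "y - 1" k i j]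
        unfolding f by blast
    qed simp
    also have "\<dots> = of_bool (v \<in> aztec_vertices k f) + of_bool (v \<in> aztec_vertices (k - 1) f)"
    proof -
      have "even ((x - i) + (y - j) + int k)" using False by presburger
      note d = antidiagonal_dist_le[OF this]
      have "(x - 1, y) \<in> internal_faces k f \<or> (x, y - 1) \<in> internal_faces k f \<longleftrightarrow> v \<in> aztec_vertices k f"
        "(x - 1, y) \<in> internal_faces k f \<and> (x, y - 1) \<in> internal_faces k f \<longleftrightarrow> v \<in> aztec_vertices (k - 1) f"
        unfolding f internal_faces_iff aztec_vertices_iff k1 diff_one_right_commute[of x i] diff_one_right_commute[of y j]
        using d by blast+
      then show ?thesis
        by (cases "(x - 1, y) \<in> internal_faces k f"; cases "(x, y - 1) \<in> internal_faces k f"; simp only: of_bool_def simp_thms if_True if_False)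
    qed
    finally show ?thesis .
  qed
qed

lemma edge_dist_less':
  fixes X Y K :: int
  assumes "\<bar>2 * Y - 1\<bar> + \<bar>2 * X - 1\<bar> \<le> 2 * K" "\<bar>2 * Y - 1\<bar> + \<bar>2 * (X + 1) - 1\<bar> \<le> 2 * K"
  shows "\<bar>Y\<bar> + \<bar>X\<bar> < K \<or> \<bar>Y - 1\<bar> + \<bar>X\<bar> < K"
  using edge_dist_less[of X Y K] assms by linarith

text \<open>The diamond is an induced subgraph of the grid. Hence a matching by edges of the larger
  diamond that covers just the vertices of the smaller one uses edges of the smaller one
  only.\<close>

lemma aztec_edges_induced:
  assumes uv: "u \<in> aztec_vertices k f" "v \<in> aztec_vertices k f" and adj: "adjacent u v"
  shows "(u, v) \<in> aztec_edges k f"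
proof -
  obtain i j where f: "f = (i, j)" by (cases f)
  obtain x y where u: "u = (x, y)" by (cases u)
  consider "v = (x + 1, y)" | "v = (x - 1, y)" | "v = (x, y + 1)" | "v = (x, y - 1)"
    using adj unfolding u adjacent_iff by blast
  then have "right_face (u, v) \<in> internal_faces k f \<or> right_face (v, u) \<in> internal_faces k f"
  proof cases
    case 1
    have e: "x - i + 1 = x + 1 - i" by simp
    have "\<bar>2 * (x - i) - 1\<bar> + \<bar>2 * (y - j) - 1\<bar> \<le> 2 * int k" "\<bar>2 * (x - i + 1) - 1\<bar> + \<bar>2 * (y - j) - 1\<bar> \<le> 2 * int k"
      using uv unfolding u f 1 aztec_vertices_iff e by blast+
    from edge_dist_less[OF this] show ?thesis
      unfolding u f 1 right_face_simps internal_faces_iff diff_one_right_commute[of x i] diff_one_right_commute[of y j] by blast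
  next
    case 2
    have e: "x - 1 - i + 1 = x - i" by simp
    have "\<bar>2 * (x - 1 - i) - 1\<bar> + \<bar>2 * (y - j) - 1\<bar> \<le> 2 * int k" "\<bar>2 * (x - 1 - i + 1) - 1\<bar> + \<bar>2 * (y - j) - 1\<bar> \<le> 2 * int k"
      using uv unfolding u f 2 aztec_vertices_iff e by blast+
    from edge_dist_less[OF this] show ?thesis
      unfolding u f 2 right_face_simps internal_faces_iff diff_one_right_commute[of x i] diff_one_right_commute[of y j] by blast
  next
    case 3
    have e: "y - j + 1 = y + 1 - j" by simp
    have "\<bar>2 * (x - i) - 1\<bar> + \<bar>2 * (y - j) - 1\<bar> \<le> 2 * int k" "\<bar>2 * (x - i) - 1\<bar> + \<bar>2 * (y - j + 1) - 1\<bar> \<le> 2 * int k"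
      using uv unfolding u f 3 aztec_vertices_iff e by blast+
    from edge_dist_less'[OF this] show ?thesis
      unfolding u f 3 right_face_simps internal_faces_iff diff_one_right_commute[of x i] diff_one_right_commute[of y j] by blast
  next
    case 4
    have e: "y - 1 - j + 1 = y - j" by simp
    have "\<bar>2 * (x - i) - 1\<bar> + \<bar>2 * (y - 1 - j) - 1\<bar> \<le> 2 * int k" "\<bar>2 * (x - i) - 1\<bar> + \<bar>2 * (y - 1 - j + 1) - 1\<bar> \<le> 2 * int k"
      using uv unfolding u f 4 aztec_vertices_iff e by blast+
    from edge_dist_less'[OF this] show ?thesis
      unfolding u f 4 right_face_simps internal_faces_iff diff_one_right_commute[of x i] diff_one_right_commute[of y j] by blast
  qed
  then show ?thesis using adj unfolding aztec_edges_def UN_iff face_edges_iff by blast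
qed

lemma internal_faces_mono: "k \<le> l \<Longrightarrow> internal_faces k f \<subseteq> internal_faces l f"
  by (cases f) (auto simp: internal_faces_def)

lemma finite_aztec_white_edges: "finite (aztec_white_edges k f)"
  using finite_aztec_edges[of k f] unfolding aztec_white_edges_def by simp

lemma matching_sum_smaller_diamond:
  "matching_sum (aztec_white_edges k f) (aztec_vertices (k - 1) f) w =
   matching_sum (aztec_white_edges (k - 1) f) (aztec_vertices (k - 1) f) w"
proof -
  have sub: "aztec_white_edges (k - 1) f \<subseteq> aztec_white_edges k f"
    using internal_faces_mono[of "k - 1" k f] unfolding aztec_white_edges_def aztec_edges_def by auto
  have "N \<subseteq> aztec_white_edges (k - 1) f"
    if N: "N \<subseteq> aztec_white_edges k f" "covers N (aztec_vertices (k - 1) f)" for N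
  proof
    fix e assume e: "e \<in> N"
    have fin: "finite N" using finite_subset[OF N(1) finite_aztec_white_edges] .
    have "e \<in> aztec_white_edges k f" using e N(1) by blast
    then have eE: "(fst e, snd e) \<in> aztec_edges k f" "white (fst e)" unfolding aztec_white_edges_def by simp_all
    have "(fst e, snd e) \<in> aztec_edges (k - 1) f"
      by (rule aztec_edges_induced[OF coversD2[OF N(2) fin e] aztec_edgesD(1)[OF eE(1)]])
    then show "e \<in> aztec_white_edges (k - 1) f" using eE unfolding aztec_white_edges_def by simp
  qed
  with sub have "{N. N \<subseteq> aztec_white_edges k f \<and> covers N (aztec_vertices (k - 1) f)} =
    {N. N \<subseteq> aztec_white_edges (k - 1) f \<and> covers N (aztec_vertices (k - 1) f)}" by blast
  then show ?thesis unfolding matching_sum_def by simp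
qed

section \<open>The renewal step\<close>

text \<open>Up to the sign \<open>cell_sign\<close>, the quantity \<Delta> of
  \<open>four_cycle_complement\<close> for the difference weights; at the same time the coefficient
  of z - m in \<open>dskp\<close>.\<close>

definition cell_det :: "(face \<Rightarrow> complex) \<Rightarrow> face \<Rightarrow> complex" where
  "cell_det a = (\<lambda>(x, y). (a (x, y + 1) - a (x, y)) * (a (x, y - 1) - a (x, y)) -
     (a (x + 1, y) - a (x, y)) * (a (x - 1, y) - a (x, y)))"

text \<open>The product of the signs of the two horizontal edges; the Kasteleyn condition makes it
  minus the product for the vertical ones.\<close>

definition cell_sign :: "(vertex \<times> vertex \<Rightarrow> int) \<Rightarrow> face \<Rightarrow> int" where
  "cell_sign \<phi> = (\<lambda>(x, y). if even (x + y)
     then \<phi> ((x, y), (x + 1, y)) * \<phi> ((x + 1, y + 1), (x, y + 1))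
     else \<phi> ((x + 1, y), (x, y)) * \<phi> ((x, y + 1), (x + 1, y + 1)))"

text \<open>Relative to a cell \<open>c\<close> at \<open>v\<close>, the gauge is, up to a sign depending only on \<open>c\<close>,
  the weight of the northern or southern face at \<open>v\<close> minus that of the eastern or western one.\<close>

definition spider_gauge :: "nat \<Rightarrow> face \<Rightarrow> (face \<Rightarrow> complex) \<Rightarrow> vertex \<Rightarrow> complex" where
  "spider_gauge k = (\<lambda>(i, j) a (x, y). (if even x then 1 else -1) *
     (if odd (x + y + i + j + int k) then a (x, y - 1) - a (x - 1, y) else a (x, y) - a (x - 1, y - 1)))"

definition dskp_at :: "(face \<Rightarrow> complex) \<Rightarrow> face \<Rightarrow> complex \<Rightarrow> bool" where
  "dskp_at a = (\<lambda>(x, y) z. dskp (a (x, y)) (a (x + 1, y)) (a (x, y + 1)) (a (x - 1, y)) (a (x, y - 1)) z)"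

text \<open>The difference between z and a neighbour factors completely. Up to sign, two factors are
  the gauges at the ends of the edge shared with that neighbour, and the third is the old difference
  across the opposite edge, as the complementary weights require.\<close>

lemma dskp_differences:
  assumes "dskp m E N W S z"
  defines "Q \<equiv> (N - m) * (S - m) - (E - m) * (W - m)"
  shows "(N - z) * Q = (N - E) * (N - W) * (S - m)" "(S - z) * Q = (S - E) * (S - W) * (N - m)"
    "(z - E) * Q = (N - E) * (S - E) * (W - m)" "(z - W) * Q = (N - W) * (S - W) * (E - m)"
proof -
  have z: "(z - m) * Q = (N - m) * (S - m) * ((E - m) + (W - m)) - (E - m) * (W - m) * ((N - m) + (S - m))"
    using assms unfolding dskp_def by blast
  have N: "(N - z) * Q = (N - m) * Q - (z - m) * Q" by (simp add: algebra_simps)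
  show "(N - z) * Q = (N - E) * (N - W) * (S - m)" unfolding N z unfolding Q_def by (simp add: algebra_simps)
  have S: "(S - z) * Q = (S - m) * Q - (z - m) * Q" by (simp add: algebra_simps)
  show "(S - z) * Q = (S - E) * (S - W) * (N - m)" unfolding S z unfolding Q_def by (simp add: algebra_simps)
  have E: "(z - E) * Q = (z - m) * Q - (E - m) * Q" by (simp add: algebra_simps)
  show "(z - E) * Q = (N - E) * (S - E) * (W - m)" unfolding E z unfolding Q_def by (simp add: algebra_simps)
  have W: "(z - W) * Q = (z - m) * Q - (W - m) * Q" by (simp add: algebra_simps)
  show "(z - W) * Q = (N - W) * (S - W) * (E - m)" unfolding W z unfolding Q_def by (simp add: algebra_simps)
qed

text \<open>\<open>z * Q\<close> is a polynomial in the five old values and equals m E N W S times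
  the determinant of their inverses. The second claim is the monomial by which inverting the weights
  changes the factor of a cell.\<close>

lemma dskp_inverse:
  assumes d: "dskp m E N W S z" and nz: "m \<noteq> 0" "E \<noteq> 0" "N \<noteq> 0" "W \<noteq> 0" "S \<noteq> 0" "z \<noteq> 0"
  shows "dskp (inverse m) (inverse E) (inverse N) (inverse W) (inverse S) (inverse z)"
    and "(inverse N - inverse m) * (inverse S - inverse m) - (inverse E - inverse m) * (inverse W - inverse m) =
      z * ((N - m) * (S - m) - (E - m) * (W - m)) / (m * E * N * W * S)"
proof -
  define Q where "Q = (N - m) * (S - m) - (E - m) * (W - m)"
  define Q' where "Q' = (inverse N - inverse m) * (inverse S - inverse m) - (inverse E - inverse m) * (inverse W - inverse m)"
  have Q: "Q \<noteq> 0" and ne: "E \<noteq> N" "N \<noteq> W" "W \<noteq> S" "S \<noteq> E"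
    and z: "(z - m) * Q = (N - m) * (S - m) * ((E - m) + (W - m)) - (E - m) * (W - m) * ((N - m) + (S - m))"
    using d unfolding dskp_def Q_def by blast+
  have zQ: "z * Q = m * (E * W - N * S) + N * S * (E + W) - E * W * (N + S)"
  proof -
    have "z * Q = (z - m) * Q + m * Q" by (simp add: algebra_simps)
    also have "\<dots> = m * (E * W - N * S) + N * S * (E + W) - E * W * (N + S)"
      unfolding z unfolding Q_def by (simp add: algebra_simps)
    finally show ?thesis .
  qed
  have "Q' * (m * E * N * W * S) = m * (E * W - N * S) + N * S * (E + W) - E * W * (N + S)"
    unfolding Q'_def using nz by (simp add: field_simps)
  then have Q': "Q' * (m * E * N * W * S) = z * Q" unfolding zQ .
  then have Q'_eq: "Q' = z * Q / (m * E * N * W * S)" using nz by (simp add: field_simps)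
  then show "(inverse N - inverse m) * (inverse S - inverse m) - (inverse E - inverse m) * (inverse W - inverse m) =
      z * ((N - m) * (S - m) - (E - m) * (W - m)) / (m * E * N * W * S)" unfolding Q'_def Q_def .
  have "Q' \<noteq> 0" using Q'_eq Q nz by simp
  define R where "R = (inverse N - inverse m) * (inverse S - inverse m) * ((inverse E - inverse m) + (inverse W - inverse m)) -
    (inverse E - inverse m) * (inverse W - inverse m) * ((inverse N - inverse m) + (inverse S - inverse m))"
  have R: "R * (m * m * E * N * W * S) = - ((z - m) * Q)"
    unfolding R_def z using nz by (simp add: field_simps)
  have "(inverse z - inverse m) * Q' * (m * m * E * N * W * S) = (inverse z - inverse m) * m * (z * Q)"
    unfolding Q'[symmetric] by (simp add: mult_ac)
  also have "\<dots> = - ((z - m) * Q)" using nz by (simp add: field_simps)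
  finally have "(inverse z - inverse m) * Q' = R"
    unfolding R[symmetric] using nz by simp
  then show "dskp (inverse m) (inverse E) (inverse N) (inverse W) (inverse S) (inverse z)"
    unfolding dskp_def using ne \<open>Q' \<noteq> 0\<close> unfolding Q'_def R_def by simp
qed

lemma face_edges_pairs:
  "(u, v) \<in> face_edges (x, y) \<longleftrightarrow>
    (u, v) \<in> {((x, y), (x + 1, y)), ((x, y), (x, y + 1)), ((x + 1, y + 1), (x + 1, y)), ((x + 1, y + 1), (x, y + 1)),
      ((x + 1, y), (x, y)), ((x, y + 1), (x, y)), ((x + 1, y), (x + 1, y + 1)), ((x, y + 1), (x + 1, y + 1))}"
proof -
  have adj: "adjacent (a, b) (c, d) \<longleftrightarrow> \<bar>a - c\<bar> + \<bar>b - d\<bar> = 1" for a b c d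
    by (simp add: adjacent_def)
  show ?thesis
  proof
    assume "(u, v) \<in> face_edges (x, y)"
    then have "u \<in> corners (x, y)" "v \<in> corners (x, y)" "adjacent u v" unfolding face_edges_def by auto
    then show "(u, v) \<in> {((x, y), (x + 1, y)), ((x, y), (x, y + 1)), ((x + 1, y + 1), (x + 1, y)), ((x + 1, y + 1), (x, y + 1)),
      ((x + 1, y), (x, y)), ((x, y + 1), (x, y)), ((x + 1, y), (x + 1, y + 1)), ((x, y + 1), (x + 1, y + 1))}"
      unfolding corners_def case_prod_conv by (elim insertE emptyE; simp add: adj)
  next
    assume "(u, v) \<in> {((x, y), (x + 1, y)), ((x, y), (x, y + 1)), ((x + 1, y + 1), (x + 1, y)), ((x + 1, y + 1), (x, y + 1)),
      ((x + 1, y), (x, y)), ((x, y + 1), (x, y)), ((x + 1, y), (x + 1, y + 1)), ((x, y + 1), (x + 1, y + 1))}"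
    then show "(u, v) \<in> face_edges (x, y)"
      by (elim insertE emptyE; simp add: face_edges_def corners_def adj)
  qed
qed

lemma white_edges_even:
  assumes "even (x + y)"
  shows "white_edges (x, y) = {((x, y), (x + 1, y)), ((x, y), (x, y + 1)),
    ((x + 1, y + 1), (x + 1, y)), ((x + 1, y + 1), (x, y + 1))}"
proof -
  have w: "white (x, y)" "white (x + 1, y + 1)" "\<not> white (x + 1, y)" "\<not> white (x, y + 1)"
    using assms by (simp_all add: white_def)
  have "(u, v) \<in> white_edges (x, y) \<longleftrightarrow> (u, v) \<in> {((x, y), (x + 1, y)), ((x, y), (x, y + 1)),
    ((x + 1, y + 1), (x + 1, y)), ((x + 1, y + 1), (x, y + 1))}" for u v
    unfolding white_edges_def mem_Collect_eq face_edges_pairs fst_conv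
    using w by (simp only: insert_iff empty_iff prod.inject simp_thms, blast)
  then show ?thesis by (intro set_eqI) (metis surj_pair)
qed

lemma white_edges_odd:
  assumes "odd (x + y)"
  shows "white_edges (x, y) = {((x + 1, y), (x, y)), ((x + 1, y), (x + 1, y + 1)),
    ((x, y + 1), (x, y)), ((x, y + 1), (x + 1, y + 1))}"
proof -
  have w: "\<not> white (x, y)" "\<not> white (x + 1, y + 1)" "white (x + 1, y)" "white (x, y + 1)"
    using assms by (simp_all add: white_def)
  have "(u, v) \<in> white_edges (x, y) \<longleftrightarrow> (u, v) \<in> {((x + 1, y), (x, y)), ((x + 1, y), (x + 1, y + 1)),
    ((x, y + 1), (x, y)), ((x, y + 1), (x + 1, y + 1))}" for u v
    unfolding white_edges_def mem_Collect_eq face_edges_pairs fst_conv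
    using w by (simp only: insert_iff empty_iff prod.inject simp_thms, blast)
  then show ?thesis by (intro set_eqI) (metis surj_pair)
qed

lemma sign_complement:
  fixes p q r s :: int
  assumes "p * q * r * s = -1" "p \<in> {-1, 1}" "q \<in> {-1, 1}" "r \<in> {-1, 1}" "s \<in> {-1, 1}"
  shows "q * r = - (p * s)"
  using assms by auto

text \<open>At the two eastern corners \<open>spider_gauge\<close> subtracts in the reversed order.
  The sign depending on the parity of x is reversed there too, so that one common sign
  \<open>s\<close> remains for the whole cell.\<close>

lemma spider_gauge_at_cell:
  assumes "odd (x + y + i + j + int k)"
  defines "s \<equiv> (if even x then 1 else -1) :: complex"
  shows "spider_gauge k (i, j) a (x, y) = s * (a (x, y - 1) - a (x - 1, y))"
    "spider_gauge k (i, j) a (x + 1, y) = s * (a (x, y - 1) - a (x + 1, y))"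
    "spider_gauge k (i, j) a (x + 1, y + 1) = s * (a (x, y + 1) - a (x + 1, y))"
    "spider_gauge k (i, j) a (x, y + 1) = s * (a (x, y + 1) - a (x - 1, y))"
proof -
  have par: "even (x + 1 + y + i + j + int k)" "even (x + (y + 1) + i + j + int k)"
    "odd (x + 1 + (y + 1) + i + j + int k)" using assms(1) by presburger+
  have x1: "even (x + 1) \<longleftrightarrow> odd x" by simp
  show "spider_gauge k (i, j) a (x, y) = s * (a (x, y - 1) - a (x - 1, y))"
    unfolding spider_gauge_def s_def case_prod_conv using assms(1) by simp
  show "spider_gauge k (i, j) a (x + 1, y) = s * (a (x, y - 1) - a (x + 1, y))"
    unfolding spider_gauge_def s_def case_prod_conv using par(1) x1 by (simp add: algebra_simps)
  show "spider_gauge k (i, j) a (x + 1, y + 1) = s * (a (x, y + 1) - a (x + 1, y))"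
    unfolding spider_gauge_def s_def case_prod_conv using par(3) x1 by (simp add: algebra_simps)
  show "spider_gauge k (i, j) a (x, y + 1) = s * (a (x, y + 1) - a (x - 1, y))"
    unfolding spider_gauge_def s_def case_prod_conv using par(2) by simp
qed

text \<open>One computation for all edges of a cell: g1 and g2 are the gauges at the ends, d is the
  old difference across the opposite edge, f1 and f2 are the Kasteleyn signs. The common sign t of
  the gauges occurs twice and disappears.\<close>

lemma spider_weight:
  fixes f1 f2 :: complex
  assumes "(z1 - z2) * Q = g1 * g2 * d" and "Q \<noteq> 0" "g1 \<noteq> 0" "g2 \<noteq> 0" "f1 * f1 = 1" "f2 * f2 = 1" "t * t = 1"
  shows "inverse (t * g1) * inverse (t * g2) * (f1 * (z1 - z2)) = f2 * d / (f1 * f2 * Q)"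
proof -
  have nz: "f1 \<noteq> 0" "f2 \<noteq> 0" "t \<noteq> 0" using assms(5-7) by auto
  have "z1 - z2 = g1 * g2 * d / Q" using assms(1,2) by (simp add: field_simps)
  then have "inverse (t * g1) * inverse (t * g2) * (f1 * (z1 - z2)) =
      inverse (t * g1) * inverse (t * g2) * (f1 * (g1 * g2 * d / Q))" by (simp only:)
  also have "\<dots> = f1 * d / (t * t * Q)"
    using assms(2-4) nz by (simp add: field_simps)
  also have "\<dots> = f1 * d / Q" using assms(7) by simp
  also have "\<dots> = f1 * f1 * (d / (f1 * Q))" using nz by simp
  also have "\<dots> = d / (f1 * Q)" using assms(5) by simp
  also have "\<dots> = f2 * d / (f1 * f2 * Q)" using nz by (simp add: field_simps)
  finally show ?thesis .
qed

text \<open>The sign \<open>\<sigma>\<close> allows for the inverse weights, where \<open>1/p - 1/q = - (p - q)/(p q)\<close>.\<close>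

lemma cell_complement:
  assumes kast: "kasteleyn k (i, j) \<phi>" and c: "(x, y) \<in> cells k (i, j)"
    and d: "dskp_at a (x, y) (a' (x, y))"
    and nb: "a' (x + 1, y) = a (x + 1, y)" "a' (x, y + 1) = a (x, y + 1)" "a' (x - 1, y) = a (x - 1, y)" "a' (x, y - 1) = a (x, y - 1)"
    and h: "\<And>v. h v = \<sigma> * spider_gauge k (i, j) a v" and \<sigma>: "\<sigma> * \<sigma> = 1"
    and S: "S \<subseteq> corners (x, y)"
  shows "matching_sum (white_edges (x, y)) S (dimer_weight \<phi> a) =
    (of_int (cell_sign \<phi> (x, y)) * cell_det a (x, y)) *
    matching_sum (white_edges (x, y)) (corners (x, y) - S)
      (\<lambda>e. inverse (h (fst e)) * inverse (h (snd e)) * dimer_weight \<phi> a' e)"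
    (is "_ = _ * matching_sum _ _ ?w'")
proof -
  define m E N W SS z where "m = a (x, y)" and "E = a (x + 1, y)" and "N = a (x, y + 1)" and "W = a (x - 1, y)"
    and "SS = a (x, y - 1)" and "z = a' (x, y)"
  note vars = m_def E_def N_def W_def SS_def z_def
  define Q where "Q = (N - m) * (SS - m) - (E - m) * (W - m)"
  have dd: "dskp m E N W SS z" using d unfolding dskp_at_def vars by simp
  then have Q: "Q \<noteq> 0" and ne: "E \<noteq> N" "N \<noteq> W" "W \<noteq> SS" "SS \<noteq> E" unfolding dskp_def Q_def by blast+
  note df = dskp_differences[OF dd, folded Q_def]
  have int: "(x, y) \<in> internal_faces k (i, j)" using c cells_subset by blast
  have par: "odd (x + y + i + j + int k)" using c unfolding cells_iff by blast
  have sgn: "\<phi> e \<in> {-1, 1}" "(of_int (\<phi> e) :: complex) * of_int (\<phi> e) = 1" if "e \<in> white_edges (x, y)" for e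
  proof -
    have "e \<in> aztec_edges k (i, j)" using that int unfolding white_edges_def aztec_edges_def by blast
    then show "\<phi> e \<in> {-1, 1}" using kast unfolding kasteleyn_def by (cases e) auto
    then show "(of_int (\<phi> e) :: complex) * of_int (\<phi> e) = 1" by auto
  qed
  have prod: "(\<Prod>e\<in>white_edges (x, y). \<phi> e) = -1"
    using kast int unfolding kasteleyn_def white_edges_def by blast
  define s where "s = (if even x then 1 else -1 :: complex)"
  have ss: "(\<sigma> * s) * (\<sigma> * s) = 1"
  proof -
    have "(\<sigma> * s) * (\<sigma> * s) = (\<sigma> * \<sigma>) * (s * s)" by (simp add: mult_ac)
    then show ?thesis using \<sigma> by (simp add: s_def)
  qed
  have g: "h (x, y) = \<sigma> * s * (SS - W)" "h (x + 1, y) = \<sigma> * s * (SS - E)"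
    "h (x + 1, y + 1) = \<sigma> * s * (N - E)" "h (x, y + 1) = \<sigma> * s * (N - W)"
    unfolding h spider_gauge_at_cell[OF par] vars s_def by (simp_all only: mult.assoc)
  have gne: "SS - W \<noteq> 0" "SS - E \<noteq> 0" "N - E \<noteq> 0" "N - W \<noteq> 0" using ne by auto
  have cd: "cell_det a (x, y) = Q" unfolding cell_det_def Q_def vars by simp
  have rf: "right_face ((x + 1, y + 1), (x + 1, y)) = (x, y)" "right_face ((x + 1, y), (x + 1, y + 1)) = (x + 1, y)"
    "right_face ((x + 1, y + 1), (x, y + 1)) = (x, y + 1)" "right_face ((x, y + 1), (x + 1, y + 1)) = (x, y)"
    by (simp_all add: right_face_def)
  show ?thesis
  proof (cases "even (x + y)")
    case True
    let ?a = "(x, y)" and ?b = "(x + 1, y)" and ?c = "(x + 1, y + 1)" and ?d = "(x, y + 1)"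
    note we = white_edges_even[OF True]
    have dist: "distinct [?a, ?b, ?c, ?d]" by simp
    have cor: "corners (x, y) = {?a, ?b, ?c, ?d}" by (simp add: corners_def)
    have fs: "(of_int (\<phi> (?a, ?b)) :: complex) * of_int (\<phi> (?a, ?b)) = 1" "(of_int (\<phi> (?a, ?d)) :: complex) * of_int (\<phi> (?a, ?d)) = 1"
      "(of_int (\<phi> (?c, ?b)) :: complex) * of_int (\<phi> (?c, ?b)) = 1" "(of_int (\<phi> (?c, ?d)) :: complex) * of_int (\<phi> (?c, ?d)) = 1"
      by (rule sgn(2), simp add: we)+
    have si: "\<phi> (?a, ?b) \<in> {-1, 1}" "\<phi> (?a, ?d) \<in> {-1, 1}" "\<phi> (?c, ?b) \<in> {-1, 1}" "\<phi> (?c, ?d) \<in> {-1, 1}"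
      by (rule sgn(1), simp add: we)+
    have "\<phi> (?a, ?b) * \<phi> (?a, ?d) * \<phi> (?c, ?b) * \<phi> (?c, ?d) = -1"
      using prod unfolding we by (simp add: mult.assoc)
    from sign_complement[OF this si] have sc: "\<phi> (?a, ?d) * \<phi> (?c, ?b) = - (\<phi> (?a, ?b) * \<phi> (?c, ?d))" .
    have w: "dimer_weight \<phi> a (?a, ?b) = of_int (\<phi> (?a, ?b)) * (SS - m)" "dimer_weight \<phi> a (?a, ?d) = of_int (\<phi> (?a, ?d)) * (m - W)"
      "dimer_weight \<phi> a (?c, ?b) = of_int (\<phi> (?c, ?b)) * (m - E)" "dimer_weight \<phi> a (?c, ?d) = of_int (\<phi> (?c, ?d)) * (N - m)"
      unfolding dimer_weight_def prod.swap_def fst_conv snd_conv rf right_face_simps vars by simp_all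
    have w': "dimer_weight \<phi> a' (?a, ?b) = of_int (\<phi> (?a, ?b)) * (SS - z)" "dimer_weight \<phi> a' (?a, ?d) = of_int (\<phi> (?a, ?d)) * (z - W)"
      "dimer_weight \<phi> a' (?c, ?b) = of_int (\<phi> (?c, ?b)) * (z - E)" "dimer_weight \<phi> a' (?c, ?d) = of_int (\<phi> (?c, ?d)) * (N - z)"
      unfolding dimer_weight_def prod.swap_def fst_conv snd_conv rf right_face_simps vars nb by simp_all
    have sc': "(of_int (\<phi> (?a, ?d)) :: complex) * of_int (\<phi> (?c, ?b)) = - (of_int (\<phi> (?a, ?b)) * of_int (\<phi> (?c, ?d)))"
      using arg_cong[OF sc, of "of_int :: int \<Rightarrow> complex"] by simp
    have cs: "of_int (cell_sign \<phi> (x, y)) = (of_int (\<phi> (?a, ?b)) * of_int (\<phi> (?c, ?d)) :: complex)"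
      unfolding cell_sign_def using True by simp
    have fnz: "(of_int (\<phi> (?a, ?b)) :: complex) \<noteq> 0" "(of_int (\<phi> (?c, ?d)) :: complex) \<noteq> 0"
      using fs by auto
    show ?thesis unfolding we cor cd cs
    proof (rule four_cycle_complement[OF dist S[unfolded cor]])
      have "dimer_weight \<phi> a (?a, ?b) * dimer_weight \<phi> a (?c, ?d) + dimer_weight \<phi> a (?a, ?d) * dimer_weight \<phi> a (?c, ?b) =
        of_int (\<phi> (?a, ?b)) * of_int (\<phi> (?c, ?d)) * ((SS - m) * (N - m)) +
        (of_int (\<phi> (?a, ?d)) * of_int (\<phi> (?c, ?b))) * ((m - W) * (m - E))"
        unfolding w by (simp add: mult_ac)
      also have "\<dots> = of_int (\<phi> (?a, ?b)) * of_int (\<phi> (?c, ?d)) * Q"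
        unfolding sc' Q_def by (simp add: algebra_simps)
      finally show "of_int (\<phi> (?a, ?b)) * of_int (\<phi> (?c, ?d)) * Q =
        dimer_weight \<phi> a (?a, ?b) * dimer_weight \<phi> a (?c, ?d) + dimer_weight \<phi> a (?a, ?d) * dimer_weight \<phi> a (?c, ?b)" by simp
      show "of_int (\<phi> (?a, ?b)) * of_int (\<phi> (?c, ?d)) * Q \<noteq> 0" using fnz Q by simp
      have eq1: "(SS - z) * Q = (SS - W) * (SS - E) * (N - m)" using df(2) by (simp only: mult_ac)
      show "?w' (?a, ?b) = dimer_weight \<phi> a (?c, ?d) / (of_int (\<phi> (?a, ?b)) * of_int (\<phi> (?c, ?d)) * Q)"
        unfolding w w' g fst_conv snd_conv
        by (rule spider_weight[OF eq1 Q gne(1,2) fs(1,4) ss])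
      have eq2: "(N - z) * Q = (N - E) * (N - W) * (SS - m)" using df(1) .
      have "?w' (?c, ?d) = dimer_weight \<phi> a (?a, ?b) / (of_int (\<phi> (?c, ?d)) * of_int (\<phi> (?a, ?b)) * Q)"
        unfolding w w' g fst_conv snd_conv
        by (rule spider_weight[OF eq2 Q gne(3,4) fs(4,1) ss])
      then show "?w' (?c, ?d) = dimer_weight \<phi> a (?a, ?b) / (of_int (\<phi> (?a, ?b)) * of_int (\<phi> (?c, ?d)) * Q)"
        by (simp only: mult.commute[of "of_int (\<phi> (?c, ?d))" "of_int (\<phi> (?a, ?b))"])
      \<comment> \<open>For the vertical edges the product of signs is the opposite one, so
        \<open>Q\<close> has to be replaced by \<open>- Q\<close>; this fits the order of the
        differences \<open>z - W\<close> and \<open>z - E\<close>.\<close>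
      have sQ: "of_int (\<phi> (?a, ?b)) * of_int (\<phi> (?c, ?d)) * Q = of_int (\<phi> (?a, ?d)) * of_int (\<phi> (?c, ?b)) * (- Q)"
        "of_int (\<phi> (?a, ?b)) * of_int (\<phi> (?c, ?d)) * Q = of_int (\<phi> (?c, ?b)) * of_int (\<phi> (?a, ?d)) * (- Q)"
        using sc' by (simp_all add: mult.commute)
      have Q': "- Q \<noteq> 0" using Q by simp
      have eq3: "(z - W) * (- Q) = (SS - W) * (N - W) * (m - E)" using df(4) by (simp add: algebra_simps)
      show "?w' (?a, ?d) = dimer_weight \<phi> a (?c, ?b) / (of_int (\<phi> (?a, ?b)) * of_int (\<phi> (?c, ?d)) * Q)"
        unfolding w w' g fst_conv snd_conv sQ(1)
        by (rule spider_weight[OF eq3 Q' gne(1,4) fs(2,3) ss])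
      have eq4: "(z - E) * (- Q) = (N - E) * (SS - E) * (m - W)" using df(3) by (simp add: algebra_simps)
      show "?w' (?c, ?b) = dimer_weight \<phi> a (?a, ?d) / (of_int (\<phi> (?a, ?b)) * of_int (\<phi> (?c, ?d)) * Q)"
        unfolding w w' g fst_conv snd_conv sQ(2)
        by (rule spider_weight[OF eq4 Q' gne(3,2) fs(3,2) ss])
    qed
  next
    case False
    \<comment> \<open>With the colours exchanged every difference of face weights is reversed, so
      the same factorisations are used with both sides negated.\<close>
    let ?a = "(x + 1, y)" and ?b = "(x, y)" and ?c = "(x, y + 1)" and ?d = "(x + 1, y + 1)"
    note we = white_edges_odd[OF False]
    have dist: "distinct [?a, ?b, ?c, ?d]" by simp
    have cor: "corners (x, y) = {?a, ?b, ?c, ?d}" by (auto simp: corners_def)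
    have fs: "(of_int (\<phi> (?a, ?b)) :: complex) * of_int (\<phi> (?a, ?b)) = 1" "(of_int (\<phi> (?a, ?d)) :: complex) * of_int (\<phi> (?a, ?d)) = 1"
      "(of_int (\<phi> (?c, ?b)) :: complex) * of_int (\<phi> (?c, ?b)) = 1" "(of_int (\<phi> (?c, ?d)) :: complex) * of_int (\<phi> (?c, ?d)) = 1"
      by (rule sgn(2), simp add: we)+
    have si: "\<phi> (?a, ?b) \<in> {-1, 1}" "\<phi> (?a, ?d) \<in> {-1, 1}" "\<phi> (?c, ?b) \<in> {-1, 1}" "\<phi> (?c, ?d) \<in> {-1, 1}"
      by (rule sgn(1), simp add: we)+
    have "\<phi> (?a, ?b) * \<phi> (?a, ?d) * \<phi> (?c, ?b) * \<phi> (?c, ?d) = -1"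
      using prod unfolding we by (simp add: mult.assoc)
    from sign_complement[OF this si] have sc: "\<phi> (?a, ?d) * \<phi> (?c, ?b) = - (\<phi> (?a, ?b) * \<phi> (?c, ?d))" .
    have w: "dimer_weight \<phi> a (?a, ?b) = of_int (\<phi> (?a, ?b)) * (m - SS)" "dimer_weight \<phi> a (?a, ?d) = of_int (\<phi> (?a, ?d)) * (E - m)"
      "dimer_weight \<phi> a (?c, ?b) = of_int (\<phi> (?c, ?b)) * (W - m)" "dimer_weight \<phi> a (?c, ?d) = of_int (\<phi> (?c, ?d)) * (m - N)"
      unfolding dimer_weight_def prod.swap_def fst_conv snd_conv rf right_face_simps vars by simp_all
    have w': "dimer_weight \<phi> a' (?a, ?b) = of_int (\<phi> (?a, ?b)) * (z - SS)" "dimer_weight \<phi> a' (?a, ?d) = of_int (\<phi> (?a, ?d)) * (E - z)"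
      "dimer_weight \<phi> a' (?c, ?b) = of_int (\<phi> (?c, ?b)) * (W - z)" "dimer_weight \<phi> a' (?c, ?d) = of_int (\<phi> (?c, ?d)) * (z - N)"
      unfolding dimer_weight_def prod.swap_def fst_conv snd_conv rf right_face_simps vars nb by simp_all
    have sc': "(of_int (\<phi> (?a, ?d)) :: complex) * of_int (\<phi> (?c, ?b)) = - (of_int (\<phi> (?a, ?b)) * of_int (\<phi> (?c, ?d)))"
      using arg_cong[OF sc, of "of_int :: int \<Rightarrow> complex"] by simp
    have cs: "of_int (cell_sign \<phi> (x, y)) = (of_int (\<phi> (?a, ?b)) * of_int (\<phi> (?c, ?d)) :: complex)"
      unfolding cell_sign_def using False by simp
    have fnz: "(of_int (\<phi> (?a, ?b)) :: complex) \<noteq> 0" "(of_int (\<phi> (?c, ?d)) :: complex) \<noteq> 0"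
      using fs by auto
    show ?thesis unfolding we cor cd cs
    proof (rule four_cycle_complement[OF dist S[unfolded cor]])
      have "dimer_weight \<phi> a (?a, ?b) * dimer_weight \<phi> a (?c, ?d) + dimer_weight \<phi> a (?a, ?d) * dimer_weight \<phi> a (?c, ?b) =
        of_int (\<phi> (?a, ?b)) * of_int (\<phi> (?c, ?d)) * ((m - SS) * (m - N)) +
        (of_int (\<phi> (?a, ?d)) * of_int (\<phi> (?c, ?b))) * ((E - m) * (W - m))"
        unfolding w by (simp add: mult_ac)
      also have "\<dots> = of_int (\<phi> (?a, ?b)) * of_int (\<phi> (?c, ?d)) * Q"
        unfolding sc' Q_def by (simp add: algebra_simps)
      finally show "of_int (\<phi> (?a, ?b)) * of_int (\<phi> (?c, ?d)) * Q =
        dimer_weight \<phi> a (?a, ?b) * dimer_weight \<phi> a (?c, ?d) + dimer_weight \<phi> a (?a, ?d) * dimer_weight \<phi> a (?c, ?b)" by simp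
      show "of_int (\<phi> (?a, ?b)) * of_int (\<phi> (?c, ?d)) * Q \<noteq> 0" using fnz Q by simp
      have eq1: "(z - SS) * Q = (SS - E) * (SS - W) * (m - N)" using df(2) by (simp add: algebra_simps)
      show "?w' (?a, ?b) = dimer_weight \<phi> a (?c, ?d) / (of_int (\<phi> (?a, ?b)) * of_int (\<phi> (?c, ?d)) * Q)"
        unfolding w w' g fst_conv snd_conv
        by (rule spider_weight[OF eq1 Q gne(2,1) fs(1,4) ss])
      have eq2: "(z - N) * Q = (N - W) * (N - E) * (m - SS)" using df(1) by (simp add: algebra_simps)
      have "?w' (?c, ?d) = dimer_weight \<phi> a (?a, ?b) / (of_int (\<phi> (?c, ?d)) * of_int (\<phi> (?a, ?b)) * Q)"
        unfolding w w' g fst_conv snd_conv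
        by (rule spider_weight[OF eq2 Q gne(4,3) fs(4,1) ss])
      then show "?w' (?c, ?d) = dimer_weight \<phi> a (?a, ?b) / (of_int (\<phi> (?a, ?b)) * of_int (\<phi> (?c, ?d)) * Q)"
        by (simp only: mult.commute[of "of_int (\<phi> (?c, ?d))" "of_int (\<phi> (?a, ?b))"])
      have sQ: "of_int (\<phi> (?a, ?b)) * of_int (\<phi> (?c, ?d)) * Q = of_int (\<phi> (?a, ?d)) * of_int (\<phi> (?c, ?b)) * (- Q)"
        "of_int (\<phi> (?a, ?b)) * of_int (\<phi> (?c, ?d)) * Q = of_int (\<phi> (?c, ?b)) * of_int (\<phi> (?a, ?d)) * (- Q)"
        using sc' by (simp_all add: mult.commute)
      have Q': "- Q \<noteq> 0" using Q by simp
      have eq3: "(E - z) * (- Q) = (SS - E) * (N - E) * (W - m)" using df(3) by (simp add: algebra_simps)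
      show "?w' (?a, ?d) = dimer_weight \<phi> a (?c, ?b) / (of_int (\<phi> (?a, ?b)) * of_int (\<phi> (?c, ?d)) * Q)"
        unfolding w w' g fst_conv snd_conv sQ(1)
        by (rule spider_weight[OF eq3 Q' gne(2,3) fs(2,3) ss])
      have eq4: "(W - z) * (- Q) = (N - W) * (SS - W) * (E - m)" using df(4) by (simp add: algebra_simps)
      show "?w' (?c, ?b) = dimer_weight \<phi> a (?a, ?d) / (of_int (\<phi> (?a, ?b)) * of_int (\<phi> (?c, ?d)) * Q)"
        unfolding w w' g fst_conv snd_conv sQ(2)
        by (rule spider_weight[OF eq4 Q' gne(4,1) fs(3,2) ss])
    qed
  qed
qed

lemma matching_sum_step:
  assumes kast: "kasteleyn k (i, j) \<phi>" and k: "k \<ge> 1"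
    and d: "\<And>c. c \<in> cells k (i, j) \<Longrightarrow> dskp_at a c (a' c)"
    and nb: "\<And>x y. even (x + y + i + j + int k) \<Longrightarrow> a' (x, y) = a (x, y)"
    and \<sigma>: "\<sigma> * \<sigma> = 1"
  shows "matching_sum (aztec_white_edges k (i, j)) (aztec_vertices k (i, j)) (dimer_weight \<phi> a) =
    (\<Prod>c\<in>cells k (i, j). of_int (cell_sign \<phi> c) * cell_det a c) *
    ((\<Prod>v\<in>aztec_vertices (k - 1) (i, j). inverse (\<sigma> * spider_gauge k (i, j) a v)) *
      matching_sum (aztec_white_edges (k - 1) (i, j)) (aztec_vertices (k - 1) (i, j)) (dimer_weight \<phi> a'))"
proof -
  define h where "h = (\<lambda>v. \<sigma> * spider_gauge k (i, j) a v)"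
  let ?w' = "\<lambda>e. inverse (h (fst e)) * inverse (h (snd e)) * dimer_weight \<phi> a' e"
  have "matching_sum (aztec_white_edges k (i, j)) (aztec_vertices k (i, j)) (dimer_weight \<phi> a) =
    (\<Prod>c\<in>cells k (i, j). of_int (cell_sign \<phi> c) * cell_det a c) *
      matching_sum (aztec_white_edges k (i, j)) (aztec_vertices (k - 1) (i, j)) ?w'"
    unfolding aztec_white_edges_cells
  proof (rule matching_sum_complement[where K = corners])
    show "white_edges c \<inter> white_edges e = {}" if "c \<in> cells k (i, j)" "e \<in> cells k (i, j)" "c \<noteq> e" for c e
      using white_edges_disjoint that by blast
    show "fst e \<in> corners c \<and> snd e \<in> corners c" if "e \<in> white_edges c" for c e
      using that unfolding white_edges_def face_edges_def by auto
    show "(\<Sum>c\<in>cells k (i, j). of_bool (v \<in> corners c)) =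
        (of_bool (v \<in> aztec_vertices k (i, j)) + of_bool (v \<in> aztec_vertices (k - 1) (i, j)) :: nat)" for v
      by (rule cells_at_vertex[OF k])
    fix c S assume c: "c \<in> cells k (i, j)" and S: "S \<subseteq> corners c"
    obtain x y where xy: "c = (x, y)" by (cases c)
    have "odd (x + y + i + j + int k)" using c unfolding xy cells_iff by blast
    then have "a' (x + 1, y) = a (x + 1, y)" "a' (x, y + 1) = a (x, y + 1)" "a' (x - 1, y) = a (x - 1, y)" "a' (x, y - 1) = a (x, y - 1)"
      by (intro nb; presburger)+
    then show "matching_sum (white_edges c) S (dimer_weight \<phi> a) =
        of_int (cell_sign \<phi> c) * cell_det a c * matching_sum (white_edges c) (corners c - S) ?w'"
      using cell_complement[OF kast, of x y a a' h \<sigma> S] c d[OF c] S \<sigma> unfolding xy h_def by blast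
  qed (simp_all add: finite_cells finite_white_edges finite_corners)
  also have "matching_sum (aztec_white_edges k (i, j)) (aztec_vertices (k - 1) (i, j)) ?w' =
      matching_sum (aztec_white_edges (k - 1) (i, j)) (aztec_vertices (k - 1) (i, j)) ?w'"
    by (rule matching_sum_smaller_diamond)
  also have "\<dots> = (\<Prod>v\<in>aztec_vertices (k - 1) (i, j). inverse (h v)) *
      matching_sum (aztec_white_edges (k - 1) (i, j)) (aztec_vertices (k - 1) (i, j)) (dimer_weight \<phi> a')"
  proof (rule matching_sum_gauge[OF finite_aztec_white_edges, of _ _ _ "\<lambda>v. inverse (h v)"])
    show "fst e \<noteq> snd e" if "e \<in> aztec_white_edges (k - 1) (i, j)" for e
    proof -
      have "(fst e, snd e) \<in> aztec_edges (k - 1) (i, j)" "white (fst e)" using that unfolding aztec_white_edges_def by simp_all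
      from adjacent_white[OF aztec_edgesD(1)[OF this(1)]] this(2) show ?thesis by metis
    qed
    show "finite (aztec_vertices (k - 1) (i, j))"
      unfolding aztec_vertices_def using finite_internal_faces finite_corners by blast
  qed
  finally show ?thesis unfolding h_def .
qed

section \<open>Exponents of the face weights\<close>

lemma faces_iff: "(x, y) \<in> faces k (i, j) \<longleftrightarrow> \<bar>x - i\<bar> + \<bar>y - j\<bar> \<le> int k"
  by (auto simp: faces_def internal_faces_def open_faces_def)

lemma faces_pred: "k \<ge> 1 \<Longrightarrow> faces (k - 1) f = internal_faces k f"
  by (cases f) (auto simp: faces_iff internal_faces_iff)

lemma finite_faces: "finite (faces k f)"
  using finite_internal_faces[of "Suc k" f] faces_pred[of "Suc k" f] by simp

text \<open>The faces of the Aztec diamond, internal or open, at which no renewal takes place.\<close>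

definition coface :: "nat \<Rightarrow> face \<Rightarrow> face set" where
  "coface k = (\<lambda>(i, j). {(x, y). (x, y) \<in> faces k (i, j) \<and> even (x + y + i + j + int k)})"

lemma coface_iff: "(x, y) \<in> coface k (i, j) \<longleftrightarrow> \<bar>x - i\<bar> + \<bar>y - j\<bar> \<le> int k \<and> even (x + y + i + j + int k)"
  by (simp add: coface_def faces_iff)

lemma finite_coface: "finite (coface k f)"
  by (rule finite_subset[OF _ finite_faces[of k f]]) (cases f, auto simp: coface_def)

lemma dist_parity: "odd (dx + dy + K) \<Longrightarrow> \<bar>dx\<bar> + \<bar>dy\<bar> \<le> K \<Longrightarrow> \<bar>dx\<bar> + \<bar>dy\<bar> < (K :: int)"
proof -
  assume "odd (dx + dy + K)" and le: "\<bar>dx\<bar> + \<bar>dy\<bar> \<le> K"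
  then have "odd (\<bar>dx\<bar> + \<bar>dy\<bar> + K)" by simp
  then have "\<bar>dx\<bar> + \<bar>dy\<bar> \<noteq> K" by presburger
  with le show ?thesis by linarith
qed

text \<open>By \<open>dist_parity\<close> a face with the parity of the cells is never at distance
  exactly k, so all open faces are cofaces.\<close>

lemma faces_split: "faces k f = cells k f \<union> coface k f"
proof -
  obtain i j where f: "f = (i, j)" by (cases f)
  have "(x, y) \<in> faces k f \<longleftrightarrow> (x, y) \<in> cells k f \<union> coface k f" for x y
  proof (cases "odd (x + y + i + j + int k)")
    case True
    then have "odd ((x - i) + (y - j) + int k)" by presburger
    then show ?thesis using True dist_parity[of "x - i" "y - j" "int k"]
      unfolding f Un_iff faces_iff cells_iff coface_iff by linarith
  next
    case False
    then show ?thesis unfolding f Un_iff faces_iff cells_iff coface_iff by blast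
  qed
  then show ?thesis by (intro set_eqI) (metis surj_pair)
qed

lemma cells_coface_disjoint: "cells k f \<inter> coface k f = {}"
  by (cases f) (auto simp: cells_def coface_def)

text \<open>The four conjunctions add up to (e + w)(n + s), so the claim is ((e + w) - 1)((n + s) -
  1) = b. If b holds, both factors are 1; otherwise one of them vanishes.\<close>

lemma incidence_identity:
  assumes "b \<Longrightarrow> e \<and> w \<and> n \<and> s" "\<not> b \<Longrightarrow> e \<noteq> w \<or> n \<noteq> s"
  shows "1 + (of_bool (w \<and> s) + of_bool (e \<and> s) + of_bool (e \<and> n) + of_bool (w \<and> n)) =
    of_bool b + (of_bool e + of_bool w + of_bool n + of_bool s :: nat)"
  using assms by (cases b; cases e; cases w; cases n; cases s) auto

lemma card_filter_four:
  assumes "distinct [p, q, r, s]"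
  shows "card {z \<in> {p, q, r, s}. P z} = of_bool (P p) + of_bool (P q) + of_bool (P r) + of_bool (P s)"
proof -
  have "card {z \<in> {p, q, r, s}. P z} = (\<Sum>z\<in>{p, q, r, s}. of_bool (P z))"
    by (subst sum_of_bool_eq) (simp_all only: Int_def mem_Collect_eq finite.insertI finite.emptyI of_nat_id)
  also have "\<dots> = of_bool (P p) + (of_bool (P q) + (of_bool (P r) + of_bool (P s)))"
    using assms by simp
  finally show ?thesis by (simp only: add.assoc)
qed

text \<open>These are the exponents of \<open>a d\<close> in \<open>coface_product\<close>. On the
  left: one from the product over all cofaces, and one for each vertex whose gauge involves d. On
  the right: one if d is still a face of the smaller diamond, and one for each adjacent
  cell.\<close>

lemma coface_incidences:
  assumes k: "k \<ge> 1" and d: "d \<in> coface k f"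
  shows "1 + card {v \<in> aztec_vertices (k - 1) f. v \<in> corners d} =
    of_bool (d \<in> internal_faces k f) + card {c \<in> cells k f. adjacent c d}"
proof -
  obtain i j x y where f: "f = (i, j)" and xy: "d = (x, y)" by (cases f, cases d)
  define dx dy K where "dx = x - i" and "dy = y - j" and "K = int k"
  have K: "int (k - 1) = K - 1" "K \<ge> 1" using k by (simp_all add: K_def)
  have le: "\<bar>dx\<bar> + \<bar>dy\<bar> \<le> K" and "even (x + y + i + j + int k)"
    using d unfolding f xy coface_iff dx_def dy_def K_def by blast+
  then have par: "even (dx + dy + K)" unfolding dx_def dy_def K_def by presburger
  define e w n s b where "e \<longleftrightarrow> \<bar>dx + 1\<bar> + \<bar>dy\<bar> < K" and "w \<longleftrightarrow> \<bar>dx - 1\<bar> + \<bar>dy\<bar> < K"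
    and "n \<longleftrightarrow> \<bar>dx\<bar> + \<bar>dy + 1\<bar> < K" and "s \<longleftrightarrow> \<bar>dx\<bar> + \<bar>dy - 1\<bar> < K" and "b \<longleftrightarrow> \<bar>dx\<bar> + \<bar>dy\<bar> < K"
  note defs = e_def w_def n_def s_def b_def
  have shift: "x + 1 - i = dx + 1" "x - 1 - i = dx - 1" "y + 1 - j = dy + 1" "y - 1 - j = dy - 1" "x - i = dx" "y - j = dy" "int k = K"
    unfolding dx_def dy_def K_def by simp_all
  have int: "(x + 1, y) \<in> internal_faces k f \<longleftrightarrow> e" "(x - 1, y) \<in> internal_faces k f \<longleftrightarrow> w"
    "(x, y + 1) \<in> internal_faces k f \<longleftrightarrow> n" "(x, y - 1) \<in> internal_faces k f \<longleftrightarrow> s" "d \<in> internal_faces k f \<longleftrightarrow> b"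
    unfolding f xy internal_faces_iff defs shift by (rule refl)+
  have "{c \<in> cells k f. adjacent c d} = {c \<in> {(x + 1, y), (x - 1, y), (x, y + 1), (x, y - 1)}. c \<in> internal_faces k f}"
  proof -
    have "adjacent c d \<longleftrightarrow> c \<in> {(x + 1, y), (x - 1, y), (x, y + 1), (x, y - 1)}" for c
      using adjacent_sym adjacent_iff[of x y c] unfolding xy by blast
    moreover have "c \<in> cells k f \<longleftrightarrow> c \<in> internal_faces k f" if "c \<in> {(x + 1, y), (x - 1, y), (x, y + 1), (x, y - 1)}" for c
    proof -
      have "odd (x + 1 + y + i + j + int k)" "odd (x - 1 + y + i + j + int k)" "odd (x + (y + 1) + i + j + int k)"
        "odd (x + (y - 1) + i + j + int k)"
        using \<open>even (x + y + i + j + int k)\<close> by presburger+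
      then show ?thesis using that unfolding f by (elim insertE emptyE) (simp_all only: cells_iff internal_faces_iff simp_thms)
    qed
    ultimately show ?thesis by blast
  qed
  then have cn: "card {c \<in> cells k f. adjacent c d} = of_bool e + of_bool w + of_bool n + of_bool s"
    by (simp only:) (subst card_filter_four, simp, simp only: int)
  have cor: "v \<in> corners d \<longleftrightarrow> v \<in> {(x, y), (x + 1, y), (x + 1, y + 1), (x, y + 1)}" for v
    unfolding xy corners_def by simp
  have "{v \<in> aztec_vertices (k - 1) f. v \<in> corners d} =
      {v \<in> {(x, y), (x + 1, y), (x + 1, y + 1), (x, y + 1)}. v \<in> aztec_vertices (k - 1) f}"
    unfolding cor by blast
  \<comment> \<open>A corner of d belongs to the smaller diamond exactly if both candidates for
    cells at this corner are internal; these are the neighbours of d on the two sides meeting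
    there.\<close>
  moreover have "(x, y) \<in> aztec_vertices (k - 1) f \<longleftrightarrow> w \<and> s"
    using antidiagonal_dist_le[OF par] unfolding f aztec_vertices_iff defs shift K by blast
  moreover have "(x + 1, y) \<in> aztec_vertices (k - 1) f \<longleftrightarrow> e \<and> s"
  proof -
    have "odd (dx + 1 + dy + K)" using par by presburger
    from diagonal_dist_le[OF this] show ?thesis unfolding f aztec_vertices_iff defs shift K by (simp only: add_diff_cancel_right')
  qed
  moreover have "(x, y + 1) \<in> aztec_vertices (k - 1) f \<longleftrightarrow> w \<and> n"
  proof -
    have "odd (dx + (dy + 1) + K)" using par by presburger
    from diagonal_dist_le[OF this] show ?thesis unfolding f aztec_vertices_iff defs shift K
      by (simp only: add_diff_cancel_right') blast
  qed
  moreover have "(x + 1, y + 1) \<in> aztec_vertices (k - 1) f \<longleftrightarrow> e \<and> n"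
  proof -
    have "even (dx + 1 + (dy + 1) + K)" using par by presburger
    from antidiagonal_dist_le[OF this] show ?thesis unfolding f aztec_vertices_iff defs shift K
      by (simp only: add_diff_cancel_right') blast
  qed
  ultimately have cm: "card {v \<in> aztec_vertices (k - 1) f. v \<in> corners d} =
      of_bool (w \<and> s) + of_bool (e \<and> s) + of_bool (e \<and> n) + of_bool (w \<and> n)"
    by (simp only:) (subst card_filter_four, simp, simp only:)
  have "e \<and> w \<and> n \<and> s" if b
  proof -
    have lt: "\<bar>dx\<bar> + \<bar>dy\<bar> < K" using that unfolding b_def .
    show ?thesis unfolding defs
      by (intro conjI neighbour_dist_less[OF par lt]) simp_all
  qed
  \<comment> \<open>Such a d is at distance exactly k \<ge> 1, so one of its relative coordinates is
    nonzero. In that direction the inner neighbour is internal and the outer one is not.\<close>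
  moreover have "e \<noteq> w \<or> n \<noteq> s" if "\<not> b"
  proof -
    have "\<bar>dx\<bar> + \<bar>dy\<bar> = K" using that le unfolding b_def by linarith
    then have "dx > 0 \<or> dx < 0 \<or> dy > 0 \<or> dy < 0" using K by linarith
    then show ?thesis unfolding defs using \<open>\<bar>dx\<bar> + \<bar>dy\<bar> = K\<close> by (elim disjE) (simp_all add: abs_if split: if_splits)
  qed
  ultimately show ?thesis unfolding cn cm int by (rule incidence_identity)
qed

definition cell_neighbours :: "(face \<Rightarrow> complex) \<Rightarrow> face \<Rightarrow> complex" where
  "cell_neighbours a = (\<lambda>(x, y). a (x + 1, y) * a (x, y + 1) * a (x - 1, y) * a (x, y - 1))"

text \<open>The two faces are those whose weights \<open>spider_gauge\<close> subtracts; the product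
  of these weights appears when the gauge is formed from inverse weights.\<close>

definition coface_pair :: "nat \<Rightarrow> face \<Rightarrow> (face \<Rightarrow> complex) \<Rightarrow> vertex \<Rightarrow> complex" where
  "coface_pair k = (\<lambda>(i, j) a (x, y). if odd (x + y + i + j + int k) then a (x, y - 1) * a (x - 1, y) else a (x, y) * a (x - 1, y - 1))"

lemma cell_neighbours_eq:
  assumes "c \<in> cells k f"
  shows "cell_neighbours a c = (\<Prod>d\<in>{d \<in> coface k f. adjacent c d}. a d)"
proof -
  obtain i j x y where f: "f = (i, j)" and xy: "c = (x, y)" by (cases f, cases c)
  have c: "\<bar>x - i\<bar> + \<bar>y - j\<bar> < int k" "odd (x + y + i + j + int k)" using assms unfolding f xy cells_iff by blast+
  have "even (x + 1 + y + i + j + int k)" "even (x - 1 + y + i + j + int k)" "even (x + (y + 1) + i + j + int k)"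
    "even (x + (y - 1) + i + j + int k)" using c(2) by presburger+
  moreover have "\<bar>x + 1 - i\<bar> + \<bar>y - j\<bar> \<le> int k" "\<bar>x - 1 - i\<bar> + \<bar>y - j\<bar> \<le> int k" "\<bar>x - i\<bar> + \<bar>y + 1 - j\<bar> \<le> int k"
    "\<bar>x - i\<bar> + \<bar>y - 1 - j\<bar> \<le> int k" using c(1) by linarith+
  ultimately have "(x + 1, y) \<in> coface k f" "(x - 1, y) \<in> coface k f" "(x, y + 1) \<in> coface k f" "(x, y - 1) \<in> coface k f"
    unfolding f coface_iff by blast+
  then have "{d \<in> coface k f. adjacent c d} = {(x + 1, y), (x, y + 1), (x - 1, y), (x, y - 1)}"
    unfolding xy adjacent_iff by blast
  then show ?thesis unfolding cell_neighbours_def xy by simp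
qed

lemma coface_pair_eq:
  assumes v: "v \<in> aztec_vertices (k - 1) f" and k: "k \<ge> 1"
  shows "coface_pair k f a v = (\<Prod>d\<in>{d \<in> coface k f. v \<in> corners d}. a d)"
proof -
  obtain i j x y where f: "f = (i, j)" and xy: "v = (x, y)" by (cases f, cases v)
  have in_corner: "v \<in> corners c \<longleftrightarrow> c = (x, y) \<or> c = (x - 1, y) \<or> c = (x, y - 1) \<or> c = (x - 1, y - 1)" for c
    by (cases c) (simp only: xy corners_iff prod.inject, blast)
  have half: "2 * \<bar>u\<bar> \<le> \<bar>2 * u - 1\<bar> + 1" "2 * \<bar>u - 1\<bar> \<le> \<bar>2 * u - 1\<bar> + 1" for u :: int by arith+
  have lin: "p + q \<le> r" if "P + Q \<le> 2 * (r - 1)" "2 * p \<le> P + 1" "2 * q \<le> Q + 1" for p q r P Q :: int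
    using that by presburger
  have near: "\<bar>2 * (x - i) - 1\<bar> + \<bar>2 * (y - j) - 1\<bar> \<le> 2 * (int k - 1)" using v k unfolding f xy aztec_vertices_iff by simp
  have b: "\<bar>x - i\<bar> + \<bar>y - j\<bar> \<le> int k" "\<bar>x - 1 - i\<bar> + \<bar>y - j\<bar> \<le> int k" "\<bar>x - i\<bar> + \<bar>y - 1 - j\<bar> \<le> int k"
    "\<bar>x - 1 - i\<bar> + \<bar>y - 1 - j\<bar> \<le> int k"
    using lin[OF near half(1) half(1)] lin[OF near half(2) half(1)] lin[OF near half(1) half(2)] lin[OF near half(2) half(2)]
    unfolding diff_one_right_commute[of x i] diff_one_right_commute[of y j] by blast+
  show ?thesis
  proof (cases "odd (x + y + i + j + int k)")
    case True
    then have "odd (x - 1 + (y - 1) + i + j + int k)" "even (x - 1 + y + i + j + int k)" "even (x + (y - 1) + i + j + int k)"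
      by presburger+
    then have "(x, y - 1) \<in> coface k f" "(x - 1, y) \<in> coface k f" "(x, y) \<notin> coface k f" "(x - 1, y - 1) \<notin> coface k f"
      using b True unfolding f coface_iff by blast+
    then have "{d \<in> coface k f. v \<in> corners d} = {(x, y - 1), (x - 1, y)}" unfolding in_corner by blast
    then show ?thesis using True unfolding coface_pair_def f xy by simp
  next
    case False
    then have "even (x - 1 + (y - 1) + i + j + int k)" "odd (x - 1 + y + i + j + int k)" "odd (x + (y - 1) + i + j + int k)"
      by presburger+
    then have "(x, y - 1) \<notin> coface k f" "(x - 1, y) \<notin> coface k f" "(x, y) \<in> coface k f" "(x - 1, y - 1) \<in> coface k f"
      using b False unfolding f coface_iff by blast+
    then have "{d \<in> coface k f. v \<in> corners d} = {(x, y), (x - 1, y - 1)}" unfolding in_corner by blast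
    then show ?thesis using False unfolding coface_pair_def f xy by simp
  qed
qed

lemma finite_aztec_vertices: "finite (aztec_vertices k f)"
  unfolding aztec_vertices_def using finite_internal_faces finite_corners by blast

text \<open>Both sides become products over the cofaces, where \<open>coface_incidences\<close>
  compares exponents. In \<open>Y_step\<close> this identity removes all remaining factors.\<close>

lemma coface_product:
  assumes k: "k \<ge> 1"
  shows "(\<Prod>d\<in>coface k f. a d) * (\<Prod>v\<in>aztec_vertices (k - 1) f. coface_pair k f a v) =
    (\<Prod>d\<in>coface k f \<inter> internal_faces k f. a d) * (\<Prod>c\<in>cells k f. cell_neighbours a c)"
proof -
  let ?O = "coface k f" and ?V = "aztec_vertices (k - 1) f"
  have "(\<Prod>v\<in>?V. coface_pair k f a v) = (\<Prod>v\<in>?V. \<Prod>d\<in>{d \<in> ?O. v \<in> corners d}. a d)"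
    using coface_pair_eq k by (intro prod.cong) auto
  also have "\<dots> = (\<Prod>d\<in>?O. a d ^ card {v \<in> ?V. v \<in> corners d})"
    by (subst prod.swap_restrict) (simp_all add: finite_coface finite_aztec_vertices)
  finally have V: "(\<Prod>v\<in>?V. coface_pair k f a v) = (\<Prod>d\<in>?O. a d ^ card {v \<in> ?V. v \<in> corners d})" .
  have "(\<Prod>c\<in>cells k f. cell_neighbours a c) = (\<Prod>c\<in>cells k f. \<Prod>d\<in>{d \<in> ?O. adjacent c d}. a d)"
    using cell_neighbours_eq by (intro prod.cong) auto
  also have "\<dots> = (\<Prod>d\<in>?O. a d ^ card {c \<in> cells k f. adjacent c d})"
    by (subst prod.swap_restrict) (simp_all add: finite_coface finite_cells)
  finally have C: "(\<Prod>c\<in>cells k f. cell_neighbours a c) = (\<Prod>d\<in>?O. a d ^ card {c \<in> cells k f. adjacent c d})" .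
  have I: "(\<Prod>d\<in>?O \<inter> internal_faces k f. a d) = (\<Prod>d\<in>?O. a d ^ of_bool (d \<in> internal_faces k f))"
    unfolding prod.inter_restrict[OF finite_coface] by (intro prod.cong) auto
  have "(\<Prod>d\<in>?O. a d) * (\<Prod>v\<in>?V. coface_pair k f a v) = (\<Prod>d\<in>?O. a d ^ (1 + card {v \<in> ?V. v \<in> corners d}))"
    unfolding V prod.distrib[symmetric] by simp
  also have "\<dots> = (\<Prod>d\<in>?O. a d ^ (of_bool (d \<in> internal_faces k f) + card {c \<in> cells k f. adjacent c d}))"
    using coface_incidences[OF k] by (intro prod.cong) simp_all
  also have "\<dots> = (\<Prod>d\<in>?O \<inter> internal_faces k f. a d) * (\<Prod>c\<in>cells k f. cell_neighbours a c)"
    unfolding I C prod.distrib[symmetric] power_add ..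
  finally show ?thesis .
qed

section \<open>Invariance of Y under renewal\<close>

lemma kasteleyn_pred:
  assumes "kasteleyn k f \<phi>"
  shows "kasteleyn (k - 1) f \<phi>"
proof -
  have "internal_faces (k - 1) f \<subseteq> internal_faces k f" by (rule internal_faces_mono) simp
  then have "internal_faces (k - 1) f \<subseteq> internal_faces k f" "aztec_edges (k - 1) f \<subseteq> aztec_edges k f"
    unfolding aztec_edges_def by blast+
  then show ?thesis using assms unfolding kasteleyn_def by (meson subset_iff)
qed

lemma cell_sign_nonzero:
  assumes kast: "kasteleyn k f \<phi>" and c: "c \<in> cells k f"
  shows "cell_sign \<phi> c \<noteq> 0"
proof -
  obtain x y where xy: "c = (x, y)" by (cases c)
  have "c \<in> internal_faces k f" using c cells_subset by blast
  then have nz: "\<phi> e \<noteq> 0" if "e \<in> white_edges c" for e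
  proof -
    have "e \<in> aztec_edges k f" using that \<open>c \<in> internal_faces k f\<close> unfolding white_edges_def aztec_edges_def by blast
    then have "\<phi> e \<in> {-1, 1}" using kast unfolding kasteleyn_def by (cases e) auto
    then show ?thesis by auto
  qed
  show ?thesis
  proof (cases "even (x + y)")
    case True
    have "\<phi> ((x, y), (x + 1, y)) \<noteq> 0" "\<phi> ((x + 1, y + 1), (x, y + 1)) \<noteq> 0"
      by (rule nz, simp add: xy white_edges_even[OF True])+
    then show ?thesis using True unfolding xy cell_sign_def by simp
  next
    case False
    have "\<phi> ((x + 1, y), (x, y)) \<noteq> 0" "\<phi> ((x, y + 1), (x + 1, y + 1)) \<noteq> 0"
      by (rule nz, simp add: xy white_edges_odd[OF False])+
    then show ?thesis using False unfolding xy cell_sign_def by simp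
  qed
qed

lemma spider_gauge_nonzero:
  assumes d: "\<And>c. c \<in> cells k f \<Longrightarrow> dskp_at a c (z c)" and k: "k \<ge> 1" and v: "v \<in> aztec_vertices (k - 1) f"
  shows "spider_gauge k f a v \<noteq> 0"
proof -
  have "(\<Sum>c\<in>cells k f. of_bool (v \<in> corners c)) \<noteq> (0 :: nat)"
    unfolding cells_at_vertex[OF k] using v by simp
  then obtain c where c: "c \<in> cells k f" "v \<in> corners c"
    by (metis (mono_tags, lifting) of_bool_eq(1) sum.neutral)
  obtain i j x y where f: "f = (i, j)" and xy: "c = (x, y)" by (cases f, cases c)
  have par: "odd (x + y + i + j + int k)" using c(1) unfolding f xy cells_iff by blast
  have "dskp (a (x, y)) (a (x + 1, y)) (a (x, y + 1)) (a (x - 1, y)) (a (x, y - 1)) (z c)"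
    using d[OF c(1)] unfolding dskp_at_def xy by simp
  then have ne: "a (x + 1, y) \<noteq> a (x, y + 1)" "a (x, y + 1) \<noteq> a (x - 1, y)" "a (x - 1, y) \<noteq> a (x, y - 1)"
    "a (x, y - 1) \<noteq> a (x + 1, y)" unfolding dskp_def by blast+
  have "v = (x, y) \<or> v = (x + 1, y) \<or> v = (x + 1, y + 1) \<or> v = (x, y + 1)"
    using c(2) unfolding xy corners_def by simp
  then show ?thesis
    unfolding f by (elim disjE) (simp_all only: spider_gauge_at_cell[OF par], use ne in simp_all)
qed

lemma spider_gauge_inverse:
  assumes nz: "\<And>g. g \<in> faces k f \<Longrightarrow> a g \<noteq> 0" and v: "v \<in> aztec_vertices (k - 1) f" and k: "k \<ge> 1"
  shows "inverse (- 1 * spider_gauge k f (\<lambda>g. inverse (a g)) v) = coface_pair k f a v * inverse (spider_gauge k f a v)"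
    and "coface_pair k f a v \<noteq> 0"
proof -
  have inv: "inverse (- 1 * (s * (inverse p - inverse q))) = (p * q) * inverse (s * (p - q))"
    if "p \<noteq> 0" "q \<noteq> 0" for s p q :: complex
  proof -
    have "- 1 * (s * (inverse p - inverse q)) = s * (p - q) * inverse (p * q)"
      using that by (simp add: field_simps)
    then show ?thesis by simp
  qed
  obtain i j x y where f: "f = (i, j)" and xy: "v = (x, y)" by (cases f, cases v)
  have "a d \<noteq> 0" if "d \<in> coface k f" for d using nz that faces_split by blast
  then have "(\<Prod>d\<in>{d \<in> coface k f. v \<in> corners d}. a d) \<noteq> 0"
    using finite_coface by simp
  then show nz2: "coface_pair k f a v \<noteq> 0" unfolding coface_pair_eq[OF v k] .
  show "inverse (- 1 * spider_gauge k f (\<lambda>g. inverse (a g)) v) = coface_pair k f a v * inverse (spider_gauge k f a v)"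
  proof (cases "odd (x + y + i + j + int k)")
    case True
    then have "coface_pair k f a v = a (x, y - 1) * a (x - 1, y)" unfolding coface_pair_def f xy by simp
    moreover from this nz2 have "a (x, y - 1) \<noteq> 0" "a (x - 1, y) \<noteq> 0" by auto
    ultimately show ?thesis unfolding spider_gauge_def f xy case_prod_conv using True inv by (simp only: if_True not_False_eq_True)
  next
    case False
    then have "coface_pair k f a v = a (x, y) * a (x - 1, y - 1)" unfolding coface_pair_def f xy by simp
    moreover from this nz2 have "a (x, y) \<noteq> 0" "a (x - 1, y - 1) \<noteq> 0" by auto
    ultimately show ?thesis unfolding spider_gauge_def f xy case_prod_conv using False inv by (simp only: if_False not_True_eq_False)
  qed
qed

text \<open>The products \<open>Pe\<close> of determinants and \<open>Pg\<close> of inverse gauges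
  occur in both partition functions. What remains is
  \<open>a' c / (a c * cell_neighbours a c)\<close> for each cell and \<open>coface_pair\<close> for
  each vertex of the smaller diamond; \<open>coface_product\<close> turns these and the prefactor of
  size k into that of size k - 1.\<close>

lemma Y_step:
  fixes i j :: int
  defines "f \<equiv> (i, j)"
  assumes kast: "kasteleyn k f \<phi>" and k: "k \<ge> 1"
    and d: "\<And>c. c \<in> cells k f \<Longrightarrow> dskp_at a c (a' c)"
    and nb: "\<And>x y. even (x + y + i + j + int k) \<Longrightarrow> a' (x, y) = a (x, y)"
    and nz: "\<And>g. g \<in> faces k f \<Longrightarrow> a g \<noteq> 0" and nz': "\<And>c. c \<in> cells k f \<Longrightarrow> a' c \<noteq> 0"
  shows "Y k f a \<phi> = Y (k - 1) f a' \<phi>"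
proof -
  note f = f_def
  have nbc: "a' g = a g" if "g \<in> coface k f" for g
    using that nb unfolding f coface_def by auto
  let ?C = "cells k f" and ?V = "aztec_vertices (k - 1) f"
  let ?ia = "\<lambda>g. inverse (a g)" and ?ia' = "\<lambda>g. inverse (a' g)"
  have cell_nz: "cell_neighbours a c \<noteq> 0" "a c \<noteq> 0" if "c \<in> ?C" for c
  proof -
    have "a d \<noteq> 0" if "d \<in> coface k f" for d using nz that faces_split by blast
    then show "cell_neighbours a c \<noteq> 0" unfolding cell_neighbours_eq[OF that] using finite_coface by simp
    show "a c \<noteq> 0" using nz that faces_split by blast
  qed
  have inv: "dskp_at ?ia c (?ia' c)" "cell_det ?ia c = a' c * cell_det a c / (a c * cell_neighbours a c)"
    "cell_det a c \<noteq> 0" if c: "c \<in> ?C" for c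
  proof -
    obtain x y where xy: "c = (x, y)" by (cases c)
    have dd: "dskp (a (x, y)) (a (x + 1, y)) (a (x, y + 1)) (a (x - 1, y)) (a (x, y - 1)) (a' c)"
      using d[OF c] unfolding dskp_at_def xy by simp
    have n: "a (x, y) \<noteq> 0" "a (x + 1, y) \<noteq> 0" "a (x, y + 1) \<noteq> 0" "a (x - 1, y) \<noteq> 0" "a (x, y - 1) \<noteq> 0"
      using cell_nz[OF c] unfolding cell_neighbours_def xy by auto
    note i = dskp_inverse[OF dd n nz'[OF c]]
    show "dskp_at ?ia c (?ia' c)" using i(1) unfolding dskp_at_def xy by simp
    show "cell_det ?ia c = a' c * cell_det a c / (a c * cell_neighbours a c)"
      using i(2) unfolding cell_det_def cell_neighbours_def xy case_prod_conv by (simp only: mult.assoc)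
    show "cell_det a c \<noteq> 0" using dd unfolding dskp_def cell_det_def xy by simp
  qed
  define Pe where "Pe = (\<Prod>c\<in>?C. of_int (cell_sign \<phi> c) * cell_det a c)"
  define Pg where "Pg = (\<Prod>v\<in>?V. inverse (spider_gauge k f a v))"
  have step: "Z k f w \<phi> = (\<Prod>c\<in>?C. of_int (cell_sign \<phi> c) * cell_det w c) *
      ((\<Prod>v\<in>?V. inverse (\<sigma> * spider_gauge k f w v)) * Z (k - 1) f w' \<phi>)"
    if "\<And>c. c \<in> ?C \<Longrightarrow> dskp_at w c (w' c)" "\<And>x y. even (x + y + i + j + int k) \<Longrightarrow> w' (x, y) = w (x, y)" "\<sigma> * \<sigma> = 1"
    for w w' \<sigma>
    unfolding Z_eq_matching_sum[OF kast] Z_eq_matching_sum[OF kasteleyn_pred[OF kast]]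
    unfolding f using kast[unfolded f] k that[unfolded f] by (rule matching_sum_step)
  have Za: "Z k f a \<phi> = Pe * (Pg * Z (k - 1) f a' \<phi>)"
    using step[OF d nb, of 1] unfolding Pe_def Pg_def by simp
  \<comment> \<open>For the inverse weights the gauge is taken with \<sigma> = -1, which absorbs the
    minus sign in 1/p - 1/q = - (p - q)/(p q).\<close>
  have Zi: "Z k f ?ia \<phi> = (\<Prod>c\<in>?C. of_int (cell_sign \<phi> c) * cell_det ?ia c) *
      ((\<Prod>v\<in>?V. inverse (- 1 * spider_gauge k f ?ia v)) * Z (k - 1) f ?ia' \<phi>)"
    using inv(1) nb by (intro step) simp_all
  have "(\<Prod>c\<in>?C. of_int (cell_sign \<phi> c) * cell_det ?ia c) =
      (\<Prod>c\<in>?C. (of_int (cell_sign \<phi> c) * cell_det a c) * (a' c / (a c * cell_neighbours a c)))"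
    using inv(2) by (intro prod.cong) simp_all
  then have Pi: "(\<Prod>c\<in>?C. of_int (cell_sign \<phi> c) * cell_det ?ia c) =
      Pe * ((\<Prod>c\<in>?C. a' c) / ((\<Prod>c\<in>?C. a c) * (\<Prod>c\<in>?C. cell_neighbours a c)))"
    unfolding Pe_def by (simp only: prod.distrib prod_dividef)
  have "(\<Prod>v\<in>?V. inverse (- 1 * spider_gauge k f ?ia v)) = (\<Prod>v\<in>?V. coface_pair k f a v * inverse (spider_gauge k f a v))"
  proof (rule prod.cong[OF refl])
    fix v assume v: "v \<in> ?V"
    show "inverse (- 1 * spider_gauge k f ?ia v) = coface_pair k f a v * inverse (spider_gauge k f a v)"
      using nz v k by (rule spider_gauge_inverse(1))
  qed
  then have Gi: "(\<Prod>v\<in>?V. inverse (- 1 * spider_gauge k f ?ia v)) = (\<Prod>v\<in>?V. coface_pair k f a v) * Pg"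
    unfolding Pg_def by (simp only: prod.distrib)
  have Pe: "Pe \<noteq> 0" unfolding Pe_def using inv(3) cell_sign_nonzero[OF kast] finite_cells by simp
  have Pg: "Pg \<noteq> 0" unfolding Pg_def using spider_gauge_nonzero[OF d k] finite_aztec_vertices by simp
  define A B N O1 O2 V where "A = (\<Prod>c\<in>?C. a c)" and "B = (\<Prod>c\<in>?C. a' c)" and "N = (\<Prod>c\<in>?C. cell_neighbours a c)"
    and "O1 = (\<Prod>g\<in>coface k f. a g)" and "O2 = (\<Prod>g\<in>coface k f \<inter> internal_faces k f. a g)"
    and "V = (\<Prod>v\<in>?V. coface_pair k f a v)"
  have "A \<noteq> 0" "N \<noteq> 0" unfolding A_def N_def using cell_nz finite_cells by simp_all
  have O: "O1 * V = O2 * N" unfolding O1_def V_def O2_def N_def by (rule coface_product[OF k])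
  have F: "(\<Prod>g\<in>faces k f. a g) = A * O1" unfolding A_def O1_def faces_split
    by (rule prod.union_disjoint[OF finite_cells finite_coface cells_coface_disjoint])
  have FS: "faces (k - 1) f = ?C \<union> (coface k f \<inter> internal_faces k f)"
  proof -
    have "internal_faces k f \<subseteq> ?C \<union> coface k f" unfolding faces_split[symmetric] faces_def by blast
    then show ?thesis unfolding faces_pred[OF k] using cells_subset[of k f] by blast
  qed
  have "(\<Prod>g\<in>faces (k - 1) f. a' g) = B * (\<Prod>g\<in>coface k f \<inter> internal_faces k f. a' g)"
  proof -
    have fin: "finite (coface k f \<inter> internal_faces k f)" using finite_coface by blast
    have dj: "?C \<inter> (coface k f \<inter> internal_faces k f) = {}" using cells_coface_disjoint[of k f] by blast
    show ?thesis unfolding FS B_def by (rule prod.union_disjoint[OF finite_cells fin dj])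
  qed
  also have "(\<Prod>g\<in>coface k f \<inter> internal_faces k f. a' g) = O2" unfolding O2_def using nbc by (intro prod.cong) auto
  finally have F': "(\<Prod>g\<in>faces (k - 1) f. a' g) = B * O2" .
  define z zi where "z = Z (k - 1) f a' \<phi>" and "zi = Z (k - 1) f ?ia' \<phi>"
  have "Y k f a \<phi> = A * O1 * (Pe * (B / (A * N)) * (V * Pg * zi) / (Pe * (Pg * z)))"
    unfolding Y_def F Za Zi Pi Gi A_def B_def N_def V_def z_def zi_def by (simp only: mult.assoc)
  \<comment> \<open>The quotient \<open>zi / z\<close> is kept as it stands, since z may vanish;
    both sides are then 0 by the convention for division.\<close>
  also have "\<dots> = (O1 * V) * B / N * (zi / z)"
    using \<open>A \<noteq> 0\<close> Pe Pg by (simp add: field_simps)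
  also have "\<dots> = B * O2 * (zi / z)" unfolding O using \<open>N \<noteq> 0\<close> by simp
  also have "\<dots> = Y (k - 1) f a' \<phi>" unfolding Y_def F' z_def zi_def ..
  finally show ?thesis .
qed

text \<open>The diamond of size 0 has no vertices and its center as the only face, open instead of
  internal. The empty configuration gives Z = 1, so the recursion can end at size 0.\<close>

lemma Y_0: "Y 0 f a \<phi> = a f"
proof -
  obtain i j where f: "f = (i, j)" by (cases f)
  have "internal_faces 0 f = {}" unfolding f internal_faces_def by auto
  then have e: "aztec_edges 0 f = {}" "aztec_vertices 0 f = {}" unfolding aztec_edges_def aztec_vertices_def by simp_all
  have "oriented_dimers 0 f = {{}}" unfolding oriented_dimers_def perfect_matching_def e by auto
  moreover have "faces 0 f = {f}"
  proof (intro set_eqI)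
    fix g :: face
    obtain x y where g: "g = (x, y)" by (cases g)
    have "\<bar>x - i\<bar> + \<bar>y - j\<bar> \<le> int 0 \<longleftrightarrow> x = i \<and> y = j" by arith
    then show "g \<in> faces 0 f \<longleftrightarrow> g \<in> {f}" unfolding f g faces_iff by simp
  qed
  ultimately show ?thesis unfolding Y_def Z_def by simp
qed

text \<open>At time l the remaining diamond has size n - l, and the parity conditions single out its
  cells. The induction shifts the sequence by one time step, which leaves this difference
  unchanged.\<close>

lemma Y_iterate:
  fixes \<tau> :: "nat \<Rightarrow> face \<Rightarrow> complex"
  assumes kast: "kasteleyn n (i, j) \<phi>"
    and d: "\<And>l x y. l < n \<Longrightarrow> odd (x + y + i + j + int (n - l)) \<Longrightarrow> dskp_at (\<tau> l) (x, y) (\<tau> (Suc l) (x, y))"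
    and nb: "\<And>l x y. l < n \<Longrightarrow> even (x + y + i + j + int (n - l)) \<Longrightarrow> \<tau> (Suc l) (x, y) = \<tau> l (x, y)"
    and nz: "\<And>l g. l \<le> n \<Longrightarrow> g \<in> faces n (i, j) \<Longrightarrow> \<tau> l g \<noteq> 0"
  shows "Y n (i, j) (\<tau> 0) \<phi> = \<tau> n (i, j)"
  using assms
proof (induction n arbitrary: \<tau>)
  case 0
  then show ?case by (simp add: Y_0)
next
  case (Suc n)
  have sub: "faces n (i, j) \<subseteq> faces (Suc n) (i, j)" by (auto simp: faces_iff)
  have "Y (Suc n) (i, j) (\<tau> 0) \<phi> = Y (Suc n - 1) (i, j) (\<tau> 1) \<phi>"
  proof (rule Y_step[OF Suc.prems(1)])
    fix c assume c: "c \<in> cells (Suc n) (i, j)"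
    obtain x y where xy: "c = (x, y)" by (cases c)
    have "odd (x + y + i + j + int (Suc n - 0))" using c unfolding xy cells_iff diff_zero by blast
    from Suc.prems(2)[OF _ this] show "dskp_at (\<tau> 0) c (\<tau> 1 c)" unfolding xy by simp
    show "\<tau> 1 c \<noteq> 0" using Suc.prems(4)[of 1 c] c cells_subset[of "Suc n" "(i, j)"] unfolding faces_def by auto
  next
    fix x y :: int assume "even (x + y + i + j + int (Suc n))"
    then show "\<tau> 1 (x, y) = \<tau> 0 (x, y)" using Suc.prems(3)[of 0 x y] by simp
  next
    fix g assume "g \<in> faces (Suc n) (i, j)"
    then show "\<tau> 0 g \<noteq> 0" using Suc.prems(4)[of 0 g] by simp
  qed simp
  also have "\<dots> = Y n (i, j) ((\<lambda>l. \<tau> (Suc l)) 0) \<phi>" by simp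
  also have "\<dots> = \<tau> (Suc n) (i, j)"
  proof (rule Suc.IH)
    show "kasteleyn n (i, j) \<phi>" using kasteleyn_pred[OF Suc.prems(1)] by simp
    show "dskp_at (\<tau> (Suc l)) (x, y) (\<tau> (Suc (Suc l)) (x, y))" if "l < n" "odd (x + y + i + j + int (n - l))" for l x y
      using Suc.prems(2)[of "Suc l" x y] that by simp
    show "\<tau> (Suc (Suc l)) (x, y) = \<tau> (Suc l) (x, y)" if "l < n" "even (x + y + i + j + int (n - l))" for l x y
      using Suc.prems(3)[of "Suc l" x y] that by simp
    show "\<tau> (Suc l) g \<noteq> 0" if "l \<le> n" "g \<in> faces n (i, j)" for l g
      using Suc.prems(4)[of "Suc l" g] that sub by auto
  qed
  finally show ?case .
qed

section \<open>Translation of the weights and passage to the limit\<close>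

lemma right_face_in_faces:
  assumes "(u, v) \<in> aztec_edges k f"
  shows "right_face (u, v) \<in> faces k f"
proof -
  obtain g where g: "g \<in> internal_faces k f" "(u, v) \<in> face_edges g" using assms unfolding aztec_edges_def by blast
  have adj: "adjacent u v" by (rule aztec_edgesD(1)[OF assms])
  obtain i j x y x' y' where f: "f = (i, j)" "right_face (u, v) = (x, y)" "right_face (v, u) = (x', y')"
    by (cases f, cases "right_face (u, v)", cases "right_face (v, u)")
  have "g = (x, y) \<or> g = (x', y')" using g(2) unfolding face_edges_iff f by blast
  then have "\<bar>x - i\<bar> + \<bar>y - j\<bar> < int k \<or> \<bar>x' - i\<bar> + \<bar>y' - j\<bar> < int k"
    using g(1) unfolding f by (auto simp: internal_faces_iff)
  moreover have "\<bar>x - x'\<bar> + \<bar>y - y'\<bar> = 1" by (rule right_face_parity(2)[OF adj f(2,3)])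
  ultimately show ?thesis unfolding f faces_iff by linarith
qed

lemma tendsto_Z:
  assumes "\<And>g. g \<in> faces k f \<Longrightarrow> ((\<lambda>s. w s g) \<longlongrightarrow> a g) F"
  shows "((\<lambda>s. Z k f (w s) \<phi>) \<longlongrightarrow> Z k f a \<phi>) F"
  unfolding Z_def
proof (intro tendsto_sum tendsto_prod tendsto_mult tendsto_const)
  fix M e assume "M \<in> oriented_dimers k f" "e \<in> M"
  then have "(fst e, snd e) \<in> aztec_edges k f" unfolding oriented_dimers_def by auto
  from right_face_in_faces[OF this] show "((\<lambda>s. w s (right_face e)) \<longlongrightarrow> a (right_face e)) F"
    using assms by simp
qed

lemma tendsto_Y_shift:
  assumes nz: "\<And>g. g \<in> faces k f \<Longrightarrow> a g \<noteq> 0" and Z: "Z k f a \<phi> \<noteq> 0"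
  shows "((\<lambda>s. Y k f (\<lambda>g. a g + s) \<phi>) \<longlongrightarrow> Y k f a \<phi>) (at 0)"
proof -
  have sh: "((\<lambda>s. a g + s) \<longlongrightarrow> a g) (at 0)" for g
    by (rule tendsto_eq_intros tendsto_ident_at refl)+ simp
  have "((\<lambda>s. inverse (a g + s)) \<longlongrightarrow> inverse (a g)) (at 0)" if "g \<in> faces k f" for g
    by (rule tendsto_inverse[OF sh nz[OF that]])
  then show ?thesis unfolding Y_def
    using sh Z by (intro tendsto_mult tendsto_prod tendsto_divide tendsto_Z) auto
qed

lemma eventually_at_avoids_finite:
  assumes "finite S"
  shows "\<forall>\<^sub>F s in at (0 :: complex). s \<notin> S"
proof -
  \<comment> \<open>The set S may contain 0. Removing it yields an open neighbourhood of 0, and the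
    punctured filter ignores the point 0 itself.\<close>
  have "open (- (S - {0}))" using assms by (intro open_Compl finite_imp_closed) simp
  then have "\<forall>\<^sub>F s in nhds 0. s \<in> - (S - {0})" by (intro eventually_nhds_in_open) simp_all
  then show ?thesis unfolding eventually_at_filter by (rule eventually_mono) auto
qed

lemma dskp_shift: "dskp (m + r) (E + r) (N + r) (W + r) (S + r) (z + r) \<longleftrightarrow> dskp m E N W S z"
  by (simp add: dskp_def)

theorem theorem3p5:
  fixes t :: "int \<times> int \<Rightarrow> complex"
    and p :: "int \<times> int \<Rightarrow> complex option"
    and c :: "int \<times> int \<Rightarrow> complex option set"
    and i j :: int and k :: nat
    and \<phi> :: "(int \<times> int) \<times> (int \<times> int) \<Rightarrow> int"
  assumes "t_realization t"
    and "circle_pattern p c"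
    and "\<And>f. is_center (t f) (c f)"
    and "k \<ge> 1" and "(i + j + int k) mod 2 = 1"
    and "miquel_defined k c"
    and "kasteleyn k (i, j) \<phi>"
    and "\<And>f. f \<in> faces k (i, j) \<Longrightarrow> t f \<noteq> 0"
    and "Z k (i, j) t \<phi> \<noteq> 0"
  shows "center (miquel k c (i, j)) = Y k (i, j) t \<phi>"
proof -
  define \<tau> where "\<tau> = (\<lambda>m f. center (miquel m c f))"
  have \<tau>0: "\<tau> 0 = t" using center_eq[OF assms(3)] by (auto simp: \<tau>_def)
  \<comment> \<open>Since i + j + k is odd, the parity of the cells for size k - l says that x + y +
    l is even, which is the rule for the replacement number l + 1.\<close>
  have upd: "updated (Suc l) (x, y) \<longleftrightarrow> odd (x + y + i + j + int (k - l))" if "l < k" for l x y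
  proof -
    have "int (k - l) = int k - int l" using that by simp
    moreover have "odd (i + j + int k)" using assms(5) by presburger
    ultimately have "odd (x + y + i + j + int (k - l)) \<longleftrightarrow> even (x + y + int l)" by presburger
    then show ?thesis by (simp add: updated_def)
  qed
  have d: "dskp_at (\<tau> l) (x, y) (\<tau> (Suc l) (x, y))" if "l < k" "odd (x + y + i + j + int (k - l))" for l x y
    using miquel_centers_dskp[OF assms(2,6) that(1), of x y] upd[OF that(1)] that(2)
    unfolding dskp_at_def \<tau>_def case_prod_conv by blast
  have nb: "\<tau> (Suc l) (x, y) = \<tau> l (x, y)" if "l < k" "even (x + y + i + j + int (k - l))" for l x y
  proof -
    have "\<not> updated (Suc l) (x, y)" using upd[OF that(1)] that(2) by blast
    then show ?thesis unfolding \<tau>_def miquel.simps by (simp only: if_False)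
  qed
  \<comment> \<open>The finitely many shifts for which a center occurring in the iteration would
    vanish. A center at the origin is legitimate, but \<open>Y_step\<close> has to invert all
    weights.\<close>
  define S where "S = (\<lambda>(l, g). - \<tau> l g) ` ({..k} \<times> faces k (i, j))"
  have "finite S" unfolding S_def by (intro finite_imageI finite_cartesian_product finite_faces) simp
  have "Y k (i, j) (\<lambda>g. t g + s) \<phi> = \<tau> k (i, j) + s" if s: "s \<notin> S" for s
  proof -
    have nz: "\<tau> l g + s \<noteq> 0" if "l \<le> k" "g \<in> faces k (i, j)" for l g
    proof
      assume "\<tau> l g + s = 0"
      then have "s = (\<lambda>(l, g). - \<tau> l g) (l, g)" by (simp add: add_eq_0_iff)
      then have "s \<in> S" unfolding S_def using that by (intro image_eqI) auto
      with s show False ..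
    qed
    have "Y k (i, j) ((\<lambda>l g. \<tau> l g + s) 0) \<phi> = (\<lambda>l g. \<tau> l g + s) k (i, j)"
    proof (rule Y_iterate[OF assms(7)])
      show "dskp_at (\<lambda>g. \<tau> l g + s) (x, y) (\<tau> (Suc l) (x, y) + s)"
        if "l < k" "odd (x + y + i + j + int (k - l))" for l x y
        using d[OF that] unfolding dskp_at_def case_prod_conv dskp_shift .
      show "\<tau> (Suc l) (x, y) + s = \<tau> l (x, y) + s"
        if "l < k" "even (x + y + i + j + int (k - l))" for l x y
        using nb[OF that] by simp
      show "\<tau> l g + s \<noteq> 0" if "l \<le> k" "g \<in> faces k (i, j)" for l g
        using nz[OF that] .
    qed
    then show ?thesis by (simp add: \<tau>0)
  qed
  then have "\<forall>\<^sub>F s in at 0. Y k (i, j) (\<lambda>g. t g + s) \<phi> = \<tau> k (i, j) + s"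
    using eventually_at_avoids_finite[OF \<open>finite S\<close>] by (rule eventually_mono[rotated])
  \<comment> \<open>Y is continuous at the unshifted weights because these and their partition
    function are nonzero, even if some later center is 0 and blocks the iteration at s = 0.\<close>
  then have "((\<lambda>s. \<tau> k (i, j) + s) \<longlongrightarrow> Y k (i, j) t \<phi>) (at 0)"
    using tendsto_Y_shift[OF assms(8,9)] by (rule Lim_transform_eventually[rotated])
  moreover have "((\<lambda>s. \<tau> k (i, j) + s) \<longlongrightarrow> \<tau> k (i, j)) (at 0)"
    by (rule tendsto_eq_intros tendsto_ident_at refl)+ simp
  ultimately show ?thesis unfolding \<tau>_def using tendsto_unique[OF trivial_limit_at] by blast
qed

end
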